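(* Assume $\sigma^2=o(np)$ and $\frac{np}{\log n}\rightarrow\infty$. Then, for any $\gamma=o(1)$, there exist some $\delta_1=o(1)$ and $\delta_2=o(1)$ such that $$\mathbb{P}\left(\ell(f(z),z^* )\leq \delta_1 \ell(z,z^* ) + (1+\delta_2)\frac{\sigma^2}{2p}\ \text{ for any }z\in \mathbb{C}_1^n\text{ such that }\ell(z,z^* )\leq \gamma n\right)\geq 1-(2n)^{-1}-\exp\left(-\left(\frac{np}{\sigma^2}\right)^{1/4}\right).$$ In particular, $\delta_1$ and $\delta_2$ can be chosen to satisfy $\delta_1=O\left(\sqrt{\frac{\log n+\sigma^2}{np}}\right)$ and $\delta_2=O\left(\left(\gamma^2+\frac{\log n+\sigma^2}{np}\right)^{1/4}\right)$.
   Context: Asymptotic conventions: $n\to\infty$; $p=p_n\in(0,1]$, $\sigma=\sigma_n>0$ and $\gamma=\gamma_n\ge 0$ may depend on $n$; $o(\cdot)$, $O(\cdot)$ are as $n\to\infty$. $\delta_1,\delta_2$ depend only on the sequences $(p_n),(\sigma_n),(\gamma_n)$, not on $z^*$; nonasymptotic inequalities are understood for all sufficiently large $n$ and every $z^*$. Model: $\mathbb{C}_1=\{x\in\mathbb{C}:|x|=1\}$, $z^*\in\mathbb{C}_1^n$. For $1\le j<k\le n$, $A_{jk}\sim\text{Bernoulli}(p)$ independently, and $Y_{jk}=z_j^*\bar z_k^*+\sigma W_{jk}$, where the $W_{jk}$ are i.i.d. standard complex Gaussian $\mathcal{CN}(0,1)$ (real and imaginary parts are independent $\mathcal N(0,1/2)$),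 independent of $A$. Set $A_{kj}=A_{jk}$, $Y_{kj}=\bar Y_{jk}$ for $j<k$, and $A_{jj}=Y_{jj}=0$. Loss: $\ell(z,z^* )=\min_{a\in\mathbb{C}_1}\sum_{j=1}^n|z_j a-z_j^*|^2$. Power iteration map: $f:\mathbb{C}_1^n\to\mathbb{C}_1^n$ is given by $[f(z)]_j=\frac{s_j}{|s_j|}$ with $s_j=\sum_{k\in[n]\setminus\{j\}}A_{jk}Y_{jk}z_k$ if $s_j\neq0$, and $[f(z)]_j=1$ if $s_j=0$. *)

theory Defs
  imports "HOL-Probability.Probability" "HOL-Library.Landau_Symbols"
begin

text \<open>
  Vectors in \<open>\<complex>\<^sub>1\<^sup>n\<close> are functions on the index set \<open>{1..n}\<close>, extended by \<^const>\<open>undefined\<close>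
  outside of it.
\<close>

definition unit_vecs :: "nat \<Rightarrow> (nat \<Rightarrow> complex) set" where
  "unit_vecs n = {1..n} \<rightarrow>\<^sub>E sphere 0 1"

text \<open>The infimum is attained, see \<open>loss_attained\<close> below.\<close>

definition loss :: "nat \<Rightarrow> (nat \<Rightarrow> complex) \<Rightarrow> (nat \<Rightarrow> complex) \<Rightarrow> real" where
  "loss n z z' = (INF a\<in>sphere 0 1. \<Sum>j=1..n. (cmod (z j * a - z' j))\<^sup>2)"

lemma loss_attained:
  "\<exists>a\<in>sphere 0 1. loss n z z' = (\<Sum>j=1..n. (cmod (z j * a - z' j))\<^sup>2) \<and>
     (\<forall>b\<in>sphere 0 1. loss n z z' \<le> (\<Sum>j=1..n. (cmod (z j * b - z' j))\<^sup>2))"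
proof -
  let ?g = "\<lambda>a. \<Sum>j=1..n. (cmod (z j * a - z' j))\<^sup>2"
  have "compact (sphere (0::complex) 1)" "sphere (0::complex) 1 \<noteq> {}"
    by auto
  moreover have "continuous_on (sphere 0 1) ?g"
    by (intro continuous_intros)
  ultimately obtain a where a: "a \<in> sphere 0 1" "\<forall>b\<in>sphere 0 1. ?g a \<le> ?g b"
    using continuous_attains_inf by blast
  have "loss n z z' = ?g a"
    unfolding loss_def using a by (intro cInf_eq_minimum) auto
  with a show ?thesis by auto
qed

definition edges :: "nat \<Rightarrow> (nat \<times> nat) set" where
  "edges n = {(j, k). 1 \<le> j \<and> j < k \<and> k \<le> n}"

text \<open>
  The random variables are indexed by the pairs \<open>(j, k)\<close> with \<open>j < k\<close>. Since \<^const>\<open>prob_space.indep_vars\<close>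
  needs a common value type, the Bernoulli variables enter the joint independence assumption
  through their \<open>{0, 1}\<close>-valued complex indicators, which generate the same \<open>\<sigma>\<close>-algebras.
  The second parameter of \<^const>\<open>normal_density\<close> is the standard deviation.
\<close>

locale synchronization_model = prob_space M
  for M :: "'a measure" +
  fixes n :: nat and p :: real
    and A :: "nat \<times> nat \<Rightarrow> 'a \<Rightarrow> bool"
    and W :: "nat \<times> nat \<Rightarrow> 'a \<Rightarrow> complex"
  assumes measurable_A: "\<And>e. e \<in> edges n \<Longrightarrow> A e \<in> measurable M (count_space UNIV)"
    and distr_A: "\<And>e. e \<in> edges n \<Longrightarrow>
          distr M (count_space UNIV) (A e) = measure_pmf (bernoulli_pmf p)"
    and measurable_W: "\<And>e. e \<in> edges n \<Longrightarrow> W e \<in> borel_measurable M"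
    and distributed_Re_W: "\<And>e. e \<in> edges n \<Longrightarrow>
          distributed M lborel (\<lambda>\<omega>. Re (W e \<omega>)) (normal_density 0 (sqrt (1/2)))"
    and distributed_Im_W: "\<And>e. e \<in> edges n \<Longrightarrow>
          distributed M lborel (\<lambda>\<omega>. Im (W e \<omega>)) (normal_density 0 (sqrt (1/2)))"
    and indep_Re_Im_W: "\<And>e. e \<in> edges n \<Longrightarrow>
          indep_var borel (\<lambda>\<omega>. Re (W e \<omega>)) borel (\<lambda>\<omega>. Im (W e \<omega>))"
    and indep_A_W:
          "indep_vars (\<lambda>_. borel) (case_sum (\<lambda>e \<omega>. of_bool (A e \<omega>)) W) (edges n <+> edges n)"

text \<open>
  In the following, \<open>a\<close> and \<open>w\<close> are realizations of the families \<open>A\<close> and \<open>W\<close>, of which only the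
  entries above the diagonal are used.
\<close>

definition adjacency :: "(nat \<times> nat \<Rightarrow> bool) \<Rightarrow> nat \<Rightarrow> nat \<Rightarrow> complex" where
  "adjacency a j k =
     (if j < k then of_bool (a (j, k)) else if k < j then of_bool (a (k, j)) else 0)"

definition observation ::
  "real \<Rightarrow> (nat \<Rightarrow> complex) \<Rightarrow> (nat \<times> nat \<Rightarrow> complex) \<Rightarrow> nat \<Rightarrow> nat \<Rightarrow> complex" where
  "observation \<sigma> z' w j k =
     (if j < k then z' j * cnj (z' k) + of_real \<sigma> * w (j, k)
      else if k < j then cnj (z' k * cnj (z' j) + of_real \<sigma> * w (k, j))
      else 0)"

definition power_iteration ::
  "nat \<Rightarrow> (nat \<Rightarrow> nat \<Rightarrow> complex) \<Rightarrow> (nat \<Rightarrow> nat \<Rightarrow> complex) \<Rightarrow> (nat \<Rightarrow> complex) \<Rightarrow> nat \<Rightarrow> complex"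
  where
  "power_iteration n A Y z = (\<lambda>j\<in>{1..n}.
     let s = (\<Sum>k\<in>{1..n} - {j}. A j k * Y j k * z k)
     in if s \<noteq> 0 then s / of_real (cmod s) else 1)"

end

theory Submission
  imports Defs "HOL-Real_Asymp.Real_Asymp"
begin

text \<open>
  Fix \<open>z\<close>, let \<open>b\<close> be the phase that aligns \<open>z\<close> best with \<open>z'\<close>, and write \<open>z\<^sub>k b = u\<^sub>k z'\<^sub>k\<close> and
  \<open>v = u - 1\<close>, so that \<open>l = loss n z z'\<close> is the squared norm of \<open>v\<close>. Optimality of \<open>b\<close> makes the sum of
  the \<open>u\<^sub>k\<close> real, equal to \<open>n - l/2\<close>. Let \<open>B\<close> be the centred adjacency matrix and \<open>X\<close> the masked noise
  matrix, rotated by \<open>z'\<close> so that it is Hermitian with the law of the unrotated one. After rotation by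
  \<open>b\<close> and \<open>z'\<^sub>j\<close> and division by \<open>n p\<close>, the sum that defines coordinate \<open>j\<close> of the power iteration is
  \<open>1 - t\<^sub>j + H\<^sub>j + E\<^sub>j\<close>. Here \<open>t\<^sub>j\<close> is real and uniformly small (it contains \<open>l/(2n)\<close> and the deviation
  of the degree of \<open>j\<close>), \<open>H\<^sub>j\<close> is the noise \<open>\<sigma>/(n p)\<close> times the row sum of \<open>X\<close>, which does not involve
  \<open>z\<close>, and \<open>E\<close> is linear in \<open>v\<close>. Normalizing a complex number close to \<open>1\<close> moves it away from \<open>1\<close> by
  its imaginary part only, up to relative errors. Hence the new loss is at most, up to factors
  \<open>1 + o(1)\<close>, the sum of \<open>(Im H\<^sub>j)\<^sup>2\<close>, plus a large multiple of the squared norm of \<open>E\<close>, plus \<open>4\<close> for each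
  row with \<open>H\<^sub>j\<close> not small (\<open>power_iteration_loss_bound\<close>). The first sum is about \<open>\<sigma>\<^sup>2/(2p)\<close>, the other
  two are of lower order.

  \<^item> The contribution \<open>B v\<close> to \<open>E\<close> only needs a bound of order \<open>sqrt (n p log n)\<close> for the operator norm of
    \<open>B\<close>. The trace of a power of order \<open>log n\<close> of \<open>B\<close> gives it by a crude count of closed walks
    (\<open>expected_trace_bound\<close>, \<open>nearly_regular_whp\<close>).

  \<^item> For the contribution \<open>X v\<close> a logarithm would be too much. However \<open>v\<close> has entries of modulus at
    most \<open>2\<close>, so its binary expansion reduces the claim to vectors with entries in \<open>{-1, 0, 1}\<close>, where a
    union bound over vectors of support size \<open>m\<close> costs an exponent of order \<open>n (m/n)\<^bsup>2/3\<^esup>\<close>. This yields a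
    squared norm of order \<open>n\<^sup>2 p (l/n)\<^bsup>2/3\<^esup>\<close> (\<open>sign_vectors_control_bounded_vectors\<close>), and by Young's
    inequality the excess over \<open>n p l\<close> is absorbed in the allowed error terms
    (\<open>two_thirds_power_le\<close>).

  \<^item> The sharp constant in the sum of \<open>(Im H\<^sub>j)\<^sup>2\<close> comes from exponential moments. The imaginary part of \<open>X\<close> is
    antisymmetric, so its row sums form a Gaussian vector whose covariance is half the graph Laplacian,
    and by the operator norm bound on \<open>B\<close> the Laplacian is at most \<open>n p (1 + o(1))\<close> times the identity
    (\<open>laplacian_bound\<close>, \<open>noise_main_term_tail\<close>).

  \<^item> The expected proportion of rows with large \<open>H\<^sub>j\<close> is exponentially small in \<open>sqrt (n p / \<sigma>\<^sup>2)\<close>; Markov's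
    inequality for it produces the second term of the failure probability (\<open>noise_good_whp\<close>).

  All Gaussian estimates are made for a fixed graph, which is legitimate since the graph has only
  finitely many values and is independent of the noise (\<open>prob_given_graph\<close>). Finally, the event in the
  theorem quantifies over uncountably many \<open>z\<close> and the power iteration is discontinuous where some
  coordinate vanishes before normalization; the event is nevertheless measurable, because its complement
  is a countable union of projections of closed sets along a compact factor (\<open>contraction_event\<close>).
\<close>

section \<open>Exponential moments of Gaussian quadratic forms\<close>

lemma (in prob_space) normal_mgf:
  assumes X: "distributed M lborel X (normal_density 0 s)" and s: "0 < s"
  shows "(\<integral>\<^sup>+\<omega>. ennreal (exp (t * X \<omega>)) \<partial>M) = ennreal (exp (t\<^sup>2 * s\<^sup>2 / 2))"
proof -
  \<comment> \<open>Tilting a Gaussian density by a linear exponential shifts it.\<close>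
  have eq: "normal_density 0 s x * exp (t * x) = exp (t\<^sup>2 * s\<^sup>2 / 2) * normal_density (t * s\<^sup>2) s x" for x
  proof -
    have "- (x - 0)\<^sup>2 / (2 * s\<^sup>2) + t * x = t\<^sup>2 * s\<^sup>2 / 2 + (- (x - t * s\<^sup>2)\<^sup>2 / (2 * s\<^sup>2))"
      using s by (simp add: field_simps power2_eq_square)
    then have "exp (- (x - 0)\<^sup>2 / (2 * s\<^sup>2)) * exp (t * x)
        = exp (t\<^sup>2 * s\<^sup>2 / 2) * exp (- (x - t * s\<^sup>2)\<^sup>2 / (2 * s\<^sup>2))"
      by (simp only: exp_add[symmetric])
    then show ?thesis
      unfolding normal_density_def by (metis (no_types, lifting) mult.assoc mult.left_commute)
  qed
  have "(\<integral>\<^sup>+\<omega>. ennreal (exp (t * X \<omega>)) \<partial>M)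
      = (\<integral>\<^sup>+x. ennreal (normal_density 0 s x) * ennreal (exp (t * x)) \<partial>lborel)"
    by (rule distributed_nn_integral[symmetric, OF X]) auto
  also have "\<dots> = (\<integral>\<^sup>+x. ennreal (exp (t\<^sup>2 * s\<^sup>2 / 2)) * ennreal (normal_density (t * s\<^sup>2) s x) \<partial>lborel)"
    by (simp add: ennreal_mult'[symmetric] eq)
  also have "\<dots> = ennreal (exp (t\<^sup>2 * s\<^sup>2 / 2)) * (\<integral>\<^sup>+x. ennreal (normal_density (t * s\<^sup>2) s x) \<partial>lborel)"
    by (rule nn_integral_cmult) auto
  also have "(\<integral>\<^sup>+x. ennreal (normal_density (t * s\<^sup>2) s x) \<partial>lborel) = 1"
    using s by (simp add: nn_integral_eq_integral)
  finally show ?thesis by simp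
qed

text \<open>
  The law of a standard complex Gaussian variable enters the proof only through this identity.
\<close>

lemma (in prob_space) complex_normal_mgf:
  assumes Re: "distributed M lborel (\<lambda>\<omega>. Re (w \<omega>)) (normal_density 0 (sqrt (1/2)))"
    and Im: "distributed M lborel (\<lambda>\<omega>. Im (w \<omega>)) (normal_density 0 (sqrt (1/2)))"
    and ind: "indep_var borel (\<lambda>\<omega>. Re (w \<omega>)) borel (\<lambda>\<omega>. Im (w \<omega>))"
  shows "(\<integral>\<^sup>+\<omega>. ennreal (exp (Re (c * w \<omega>))) \<partial>M) = ennreal (exp ((cmod c)\<^sup>2 / 4))"
proof -
  define X where "X = (\<lambda>b. if b then (\<lambda>\<omega>. ennreal (exp (Re c * Re (w \<omega>)))) else (\<lambda>\<omega>. ennreal (exp (- Im c * Im (w \<omega>)))))"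
  have ind': "indep_vars (\<lambda>_. borel) X UNIV"
  proof -
    have "indep_vars (case_bool borel borel) (case_bool (\<lambda>\<omega>. Re (w \<omega>)) (\<lambda>\<omega>. Im (w \<omega>))) UNIV"
      using ind unfolding indep_var_def .
    then have "indep_vars (\<lambda>_. borel) (\<lambda>b \<omega>. (case b of True \<Rightarrow> (\<lambda>x. ennreal (exp (Re c * x))) | False \<Rightarrow> (\<lambda>x. ennreal (exp (- Im c * x))))
        (case_bool (\<lambda>\<omega>. Re (w \<omega>)) (\<lambda>\<omega>. Im (w \<omega>)) b \<omega>)) UNIV"
      by (rule indep_vars_compose2) (auto split: bool.split)
    also have "(\<lambda>b \<omega>. (case b of True \<Rightarrow> (\<lambda>x. ennreal (exp (Re c * x))) | False \<Rightarrow> (\<lambda>x. ennreal (exp (- Im c * x))))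
        (case_bool (\<lambda>\<omega>. Re (w \<omega>)) (\<lambda>\<omega>. Im (w \<omega>)) b \<omega>)) = X"
      by (auto simp: fun_eq_iff X_def split: bool.split)
    finally show ?thesis .
  qed
  have "(\<integral>\<^sup>+\<omega>. ennreal (exp (Re (c * w \<omega>))) \<partial>M) = (\<integral>\<^sup>+\<omega>. (\<Prod>b\<in>UNIV. X b \<omega>) \<partial>M)"
    by (intro nn_integral_cong) (simp add: X_def UNIV_bool exp_diff exp_minus ennreal_mult'[symmetric] divide_inverse)
  also have "\<dots> = (\<Prod>b\<in>UNIV. \<integral>\<^sup>+\<omega>. X b \<omega> \<partial>M)"
    by (rule indep_vars_nn_integral[OF _ ind']) auto
  also have "\<dots> = ennreal (exp ((Re c)\<^sup>2 / 4)) * ennreal (exp ((Im c)\<^sup>2 / 4))"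
    using normal_mgf[OF Re, of "Re c"] normal_mgf[OF Im, of "- Im c"]
    by (simp add: X_def UNIV_bool mult.commute)
  also have "\<dots> = ennreal (exp ((cmod c)\<^sup>2 / 4))"
    by (simp add: ennreal_mult'[symmetric] exp_add[symmetric] cmod_power2 add_divide_distrib)
  finally show ?thesis .
qed

lemma (in prob_space) complex_gaussian_linear_mgf:
  assumes E: "finite E" and ind: "indep_vars (\<lambda>_. borel) W E"
    and mgf: "\<And>e c. e \<in> E \<Longrightarrow> (\<integral>\<^sup>+\<omega>. ennreal (exp (Re (c * W e \<omega>))) \<partial>M) = ennreal (exp ((cmod c)\<^sup>2 / 4))"
  shows "(\<integral>\<^sup>+\<omega>. ennreal (exp (\<Sum>e\<in>E. Re (c e * W e \<omega>))) \<partial>M) = ennreal (exp ((\<Sum>e\<in>E. (cmod (c e))\<^sup>2) / 4))"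
proof -
  have "indep_vars (\<lambda>_. borel) (\<lambda>e \<omega>. ennreal (exp (Re (c e * W e \<omega>)))) E"
    by (rule indep_vars_compose2[OF ind]) auto
  then have "(\<integral>\<^sup>+\<omega>. (\<Prod>e\<in>E. ennreal (exp (Re (c e * W e \<omega>)))) \<partial>M) = (\<Prod>e\<in>E. \<integral>\<^sup>+\<omega>. ennreal (exp (Re (c e * W e \<omega>))) \<partial>M)"
    by (intro indep_vars_nn_integral E) auto
  then show ?thesis
    using E by (simp add: exp_sum prod_ennreal mgf sum_divide_distrib del: times_complex.sel cong: prod.cong)
qed

definition std_normal :: "real measure" where
  "std_normal = density lborel std_normal_density"

lemma sets_std_normal[measurable_cong, simp]: "sets std_normal = sets borel"
  by (simp add: std_normal_def)

lemma prob_space_std_normal: "prob_space std_normal"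
  unfolding std_normal_def by (rule prob_space_normal_density) simp

lemma std_normal_mgf: "(\<integral>\<^sup>+y. ennreal (exp (t * y)) \<partial>std_normal) = ennreal (exp (t\<^sup>2 / 2))"
proof -
  interpret prob_space std_normal by (rule prob_space_std_normal)
  have "distributed std_normal lborel (\<lambda>x. x) (normal_density 0 1)"
    by (simp add: distributed_def std_normal_def distr_id2)
  from normal_mgf[OF this, of t] show ?thesis by simp
qed

lemma std_normal_square_mgf:
  assumes "2 * a < 1"
  shows "(\<integral>\<^sup>+y. ennreal (exp (a * y\<^sup>2)) \<partial>std_normal) = ennreal (1 / sqrt (1 - 2 * a))"
proof -
  define s where "s = 1 / sqrt (1 - 2 * a)"
  have s: "s > 0" "s\<^sup>2 = 1 / (1 - 2 * a)" using assms by (auto simp: s_def power_divide)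
  \<comment> \<open>Tilting a centred Gaussian density by a square rescales it.\<close>
  have eq: "std_normal_density x * exp (a * x\<^sup>2) = s * normal_density 0 s x" for x
  proof -
    have "- (x - 0)\<^sup>2 / (2 * 1\<^sup>2) + a * x\<^sup>2 = - (x - 0)\<^sup>2 / (2 * s\<^sup>2)"
      using assms by (simp add: s(2) field_simps)
    then have "exp (- (x - 0)\<^sup>2 / (2 * 1\<^sup>2)) * exp (a * x\<^sup>2) = exp (- (x - 0)\<^sup>2 / (2 * s\<^sup>2))"
      by (simp only: exp_add[symmetric])
    then have "1 / sqrt (2 * pi) * exp (- (x - 0)\<^sup>2 / (2 * 1\<^sup>2)) * exp (a * x\<^sup>2)
        = 1 / sqrt (2 * pi) * exp (- (x - 0)\<^sup>2 / (2 * s\<^sup>2))"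
      by (simp only: mult.assoc)
    then show ?thesis
      using s(1) unfolding normal_density_def by (simp add: real_sqrt_mult)
  qed
  have "(\<integral>\<^sup>+y. ennreal (exp (a * y\<^sup>2)) \<partial>std_normal)
      = (\<integral>\<^sup>+x. ennreal s * ennreal (normal_density 0 s x) \<partial>lborel)"
    using s(1) by (simp add: std_normal_def nn_integral_density ennreal_mult'[symmetric] eq)
  also have "\<dots> = ennreal s * (\<integral>\<^sup>+x. ennreal (normal_density 0 s x) \<partial>lborel)"
    by (rule nn_integral_cmult) auto
  also have "(\<integral>\<^sup>+x. ennreal (normal_density 0 s x) \<partial>lborel) = 1"
    using s by (simp add: nn_integral_eq_integral)
  finally show ?thesis by (simp add: s_def)
qed

text \<open>
  If the exponential moments of all linear combinations of the \<open>g\<^sub>j\<close> are at most those of independent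
  centred Gaussian variables of variances \<open>v\<^sub>j\<close>, then the sum of squares is bounded as in the independent
  case. This removes the dependence between the rows of a Hermitian matrix. The reason is that
  \<open>exp (\<lambda> g\<^sup>2)\<close> is the mean of \<open>exp (sqrt (2 \<lambda>) g y)\<close> over a standard Gaussian \<open>y\<close>; exchanging the two
  expectations leaves a product of one-dimensional Gaussian integrals.
\<close>

lemma (in prob_space) diagonal_subgaussian_square_mgf:
  fixes g :: "'j \<Rightarrow> 'a \<Rightarrow> real"
  assumes J: "finite J" and g[measurable]: "\<And>j. j \<in> J \<Longrightarrow> g j \<in> borel_measurable M"
    and subg: "\<And>y. (\<integral>\<^sup>+\<omega>. ennreal (exp (\<Sum>j\<in>J. y j * g j \<omega>)) \<partial>M) \<le> ennreal (exp ((\<Sum>j\<in>J. (y j)\<^sup>2 * v j) / 2))"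
    and lam: "0 \<le> lam" "\<And>j. j \<in> J \<Longrightarrow> 2 * lam * v j < 1"
  shows "(\<integral>\<^sup>+\<omega>. ennreal (exp (lam * (\<Sum>j\<in>J. (g j \<omega>)\<^sup>2))) \<partial>M)
      \<le> ennreal (\<Prod>j\<in>J. 1 / sqrt (1 - 2 * lam * v j))"
proof -
  define r where "r = sqrt (2 * lam)"
  have r: "r\<^sup>2 = 2 * lam" using lam by (simp add: r_def)
  interpret N: prob_space std_normal by (rule prob_space_std_normal)
  interpret P: product_prob_space "\<lambda>_::'j. std_normal" J
    by unfold_locales
  let ?P = "Pi\<^sub>M J (\<lambda>_. std_normal)"
  interpret PP: prob_space ?P by (rule P.P.prob_space_axioms)
  interpret pair_sigma_finite M ?P by unfold_locales
  have "(\<integral>\<^sup>+\<omega>. ennreal (exp (lam * (\<Sum>j\<in>J. (g j \<omega>)\<^sup>2))) \<partial>M)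
      = (\<integral>\<^sup>+\<omega>. (\<Prod>j\<in>J. \<integral>\<^sup>+y. ennreal (exp (r * g j \<omega> * y)) \<partial>std_normal) \<partial>M)"
    using J by (intro nn_integral_cong)
      (simp add: std_normal_mgf prod_ennreal exp_sum[symmetric] power_mult_distrib r sum_distrib_left)
  also have "\<dots> = (\<integral>\<^sup>+\<omega>. (\<integral>\<^sup>+y. (\<Prod>j\<in>J. ennreal (exp (r * g j \<omega> * y j))) \<partial>?P) \<partial>M)"
    by (intro nn_integral_cong P.product_nn_integral_prod[symmetric] J) auto
  also have "\<dots> = (\<integral>\<^sup>+y. (\<integral>\<^sup>+\<omega>. (\<Prod>j\<in>J. ennreal (exp (r * g j \<omega> * y j))) \<partial>M) \<partial>?P)"
    by (rule Fubini'[symmetric]) measurable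
  also have "\<dots> = (\<integral>\<^sup>+y. (\<integral>\<^sup>+\<omega>. ennreal (exp (\<Sum>j\<in>J. (r * y j) * g j \<omega>)) \<partial>M) \<partial>?P)"
    using J by (intro nn_integral_cong) (simp add: prod_ennreal exp_sum mult_ac)
  also have "\<dots> \<le> (\<integral>\<^sup>+y. ennreal (exp ((\<Sum>j\<in>J. (r * y j)\<^sup>2 * v j) / 2)) \<partial>?P)"
    by (intro nn_integral_mono subg)
  also have "\<dots> = (\<integral>\<^sup>+y. (\<Prod>j\<in>J. ennreal (exp ((lam * v j) * (y j)\<^sup>2))) \<partial>?P)"
    using J by (intro nn_integral_cong)
       (simp add: prod_ennreal exp_sum[symmetric] power_mult_distrib r sum_divide_distrib mult_ac)
  also have "\<dots> = (\<Prod>j\<in>J. \<integral>\<^sup>+y. ennreal (exp ((lam * v j) * y\<^sup>2)) \<partial>std_normal)"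
    by (intro P.product_nn_integral_prod J) auto
  also have "\<dots> = (\<Prod>j\<in>J. ennreal (1 / sqrt (1 - 2 * lam * v j)))"
    using lam(2) by (intro prod.cong refl) (subst std_normal_square_mgf, auto simp: mult_ac)
  also have "\<dots> = ennreal (\<Prod>j\<in>J. 1 / sqrt (1 - 2 * lam * v j))"
    using lam(2) by (intro prod_ennreal) (auto simp: less_imp_le)
  finally show ?thesis .
qed

section \<open>The trace of a high power of a random symmetric matrix\<close>

text \<open>
  The powers of the matrix with entries \<open>R j k\<close> for \<open>j\<close>, \<open>k\<close> in \<open>I\<close>.
\<close>

primrec mpow :: "'i set \<Rightarrow> ('i \<Rightarrow> 'i \<Rightarrow> real) \<Rightarrow> nat \<Rightarrow> 'i \<Rightarrow> 'i \<Rightarrow> real" where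
  "mpow I R 0 j k = of_bool (j = k)"
| "mpow I R (Suc m) j k = (\<Sum>i\<in>I. R j i * mpow I R m i k)"

lemma mpow_add:
  assumes "finite I" "j \<in> I"
  shows "mpow I R (a + b) j k = (\<Sum>i\<in>I. mpow I R a j i * mpow I R b i k)"
  using assms(2)
proof (induction a arbitrary: j)
  case 0
  then show ?case using assms(1) by (simp add: of_bool_def if_distrib[of "\<lambda>x. x * _"] sum.delta cong: if_cong)
next
  case (Suc a)
  have "mpow I R (Suc a + b) j k = (\<Sum>l\<in>I. R j l * (\<Sum>i\<in>I. mpow I R a l i * mpow I R b i k))"
    using Suc.IH by simp
  also have "\<dots> = (\<Sum>i\<in>I. mpow I R (Suc a) j i * mpow I R b i k)"
    by (simp add: sum_distrib_left sum_distrib_right mult.assoc) (rule sum.swap)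
  finally show ?case .
qed

lemma mpow_sym:
  assumes "finite I" and sym: "\<And>j k. R j k = R k j" and "j \<in> I" "k \<in> I"
  shows "mpow I R m j k = mpow I R m k j"
  using assms(3,4)
proof (induction m arbitrary: j k)
  case (Suc m)
  have "mpow I R (m + 1) k j = (\<Sum>i\<in>I. mpow I R m k i * mpow I R 1 i j)"
    by (rule mpow_add[OF assms(1)]) fact
  also have "\<dots> = (\<Sum>i\<in>I. R j i * mpow I R m i k)"
  proof (rule sum.cong[OF refl])
    fix i assume "i \<in> I"
    have "mpow I R 1 i j = R i j"
      using assms(1) Suc.prems by (simp add: of_bool_def if_distrib[of "\<lambda>x. _ * x"] sum.delta' cong: if_cong)
    then show "mpow I R m k i * mpow I R 1 i j = R j i * mpow I R m i k"
      using Suc.IH[OF Suc.prems(2) \<open>i \<in> I\<close>] sym[of i j] by simp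
  qed
  finally show ?case by simp
qed auto

lemma trace_even_power:
  assumes "finite I" and sym: "\<And>j k. R j k = R k j"
  shows "(\<Sum>j\<in>I. \<Sum>k\<in>I. (mpow I R q j k)\<^sup>2) = (\<Sum>j\<in>I. mpow I R (2 * q) j j)"
  using mpow_add[OF assms(1), of _ R q q] mpow_sym[OF assms]
  by (simp add: mult_2 power2_eq_square cong: sum.cong)

text \<open>
  Without spectral theory: the squared norms \<open>F m\<close> of \<open>R\<^sup>m v\<close> satisfy \<open>(F m)\<^sup>2 \<le> |v|\<^sup>2 F (2 m)\<close> by Cauchy--Schwarz,
  since \<open>F m\<close> is the inner product of \<open>v\<close> with \<open>R\<^bsup>2m\<^esup> v\<close>. Iterating along powers of two bounds the norm of
  \<open>R v\<close> by that of \<open>R\<^bsup>q\<^esup> v\<close>, and the latter is at most the Frobenius norm of \<open>R\<^bsup>q\<^esup>\<close> times the norm of \<open>v\<close>.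
\<close>

lemma op_bound_by_trace:
  fixes v :: "'i \<Rightarrow> real"
  assumes I: "finite I" and sym: "\<And>j k. R j k = R k j"
  shows "(\<Sum>j\<in>I. (\<Sum>k\<in>I. R j k * v k)\<^sup>2) ^ (2 ^ r) \<le> (\<Sum>j\<in>I. (v j)\<^sup>2) ^ (2 ^ r) * (\<Sum>j\<in>I. mpow I R (2 * 2 ^ r) j j)"
proof -
  define ap where "ap m j = (\<Sum>k\<in>I. mpow I R m j k * v k)" for m j
  define F where "F m = (\<Sum>j\<in>I. (ap m j)\<^sup>2)" for m
  define V where "V = (\<Sum>j\<in>I. (v j)\<^sup>2)"
  have V0: "V \<ge> 0" unfolding V_def by (intro sum_nonneg) auto
  have F0: "F m \<ge> 0" for m unfolding F_def by (intro sum_nonneg) auto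
  have inner: "F m = (\<Sum>j\<in>I. v j * ap (2 * m) j)" for m
  proof -
    have "F m = (\<Sum>j\<in>I. \<Sum>k\<in>I. \<Sum>l\<in>I. v k * (mpow I R m k j * mpow I R m j l) * v l)"
      unfolding F_def ap_def power2_eq_square sum_product
    proof (intro sum.cong refl)
      fix j k l assume "j \<in> I" "k \<in> I" "l \<in> I"
      then show "mpow I R m j k * v k * (mpow I R m j l * v l) = v k * (mpow I R m k j * mpow I R m j l) * v l"
        using mpow_sym[OF I sym, where m=m and j=j and k=k] by simp
    qed
    also have "\<dots> = (\<Sum>k\<in>I. \<Sum>l\<in>I. \<Sum>j\<in>I. v k * (mpow I R m k j * mpow I R m j l) * v l)"
      by (subst sum.swap) (rule sum.cong[OF refl], rule sum.swap)
    also have "\<dots> = (\<Sum>k\<in>I. v k * ap (2 * m) k)"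
      unfolding ap_def sum_distrib_left using mpow_add[OF I, where R=R and a=m and b=m]
      by (intro sum.cong refl) (simp add: mult_2 sum_distrib_left sum_distrib_right mult.assoc)
    finally show ?thesis .
  qed
  have step: "(F m)\<^sup>2 \<le> V * F (2 * m)" for m
    unfolding inner[of m] unfolding V_def F_def by (rule Cauchy_Schwarz_ineq_sum)
  have iter: "F 1 ^ (2 ^ r) \<le> V ^ (2 ^ r - 1) * F (2 ^ r)" for r
  proof (induction r)
    case (Suc r)
    have "F 1 ^ (2 ^ Suc r) = (F 1 ^ (2 ^ r))\<^sup>2" by (simp add: power_mult[symmetric] mult.commute)
    also have "\<dots> \<le> (V ^ (2 ^ r - 1) * F (2 ^ r))\<^sup>2"
      using Suc F0 by (intro power_mono) auto
    also have "\<dots> \<le> (V ^ (2 ^ r - 1))\<^sup>2 * (V * F (2 ^ Suc r))"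
      using step[of "2 ^ r"] V0 by (simp add: power_mult_distrib mult_left_mono)
    also have "\<dots> = V ^ (2 * (2 ^ r - 1) + 1) * F (2 ^ Suc r)"
      by (simp add: power_mult[symmetric] power_add mult.commute mult.left_commute)
    also have "2 * (2 ^ r - 1) + 1 = (2::nat) ^ Suc r - 1"
      using one_le_power[of "2::nat" r] unfolding power_Suc by linarith
    finally show ?case .
  qed simp
  have last: "F m \<le> V * (\<Sum>j\<in>I. mpow I R (2 * m) j j)" for m
  proof -
    have "F m \<le> (\<Sum>j\<in>I. (\<Sum>k\<in>I. (mpow I R m j k)\<^sup>2) * V)"
      unfolding F_def ap_def V_def by (intro sum_mono Cauchy_Schwarz_ineq_sum)
    also have "\<dots> = V * (\<Sum>j\<in>I. \<Sum>k\<in>I. (mpow I R m j k)\<^sup>2)"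
      by (simp add: sum_distrib_left sum_distrib_right mult.commute)
    finally show ?thesis by (simp only: trace_even_power[OF I sym])
  qed
  have "F 1 = (\<Sum>j\<in>I. (\<Sum>k\<in>I. R j k * v k)\<^sup>2)"
    unfolding F_def ap_def using I
    by (intro sum.cong refl arg_cong[of _ _ "\<lambda>x. x\<^sup>2"])
       (simp add: of_bool_def if_distrib[of "\<lambda>x. _ * x"] sum.delta' cong: if_cong)
  moreover have "F 1 ^ (2 ^ r) \<le> V ^ (2 ^ r - 1) * (V * (\<Sum>j\<in>I. mpow I R (2 * 2 ^ r) j j))"
    using iter[of r] mult_left_mono[OF last[of "2 ^ r"], of "V ^ (2 ^ r - 1)"] V0 by simp
  moreover have "V ^ (2 ^ r - 1) * V = V ^ (2 ^ r)"
    by (metis power_minus_mult zero_less_numeral zero_less_power)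
  ultimately show ?thesis by (simp add: V_def mult.assoc[symmetric])
qed

text \<open>
  Edges are stored in increasing order, so that both directions of traversal count as the same edge.
\<close>

fun walk_edges :: "nat list \<Rightarrow> (nat \<times> nat) list" where
  "walk_edges (x # y # xs) = (min x y, max x y) # walk_edges (y # xs)"
| "walk_edges _ = []"

lemma length_walk_edges: "length (walk_edges xs) = length xs - 1"
  by (induction xs rule: walk_edges.induct) auto

lemma walk_edges_subset: "(a, b) \<in> set (walk_edges xs) \<Longrightarrow> a \<in> set xs \<and> b \<in> set xs"
  by (induction xs rule: walk_edges.induct) (auto simp: min_def max_def split: if_splits)

text \<open>
  A step to a new vertex uses a new edge.
\<close>

lemma card_set_walk: "xs \<noteq> [] \<Longrightarrow> card (set xs) \<le> card (set (walk_edges xs)) + 1"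
proof (induction xs rule: walk_edges.induct)
  case (1 x y xs)
  show ?case
  proof (cases "x \<in> set (y # xs)")
    case True
    then have "set (x # y # xs) = set (y # xs)" by auto
    moreover have "card (set (walk_edges (y # xs))) \<le> card (set (walk_edges (x # y # xs)))"
      by (intro card_mono) auto
    ultimately show ?thesis using 1 by (simp add: insert_absorb)
  next
    case False
    then have "(min x y, max x y) \<notin> set (walk_edges (y # xs))"
      using walk_edges_subset[of "min x y" "max x y" "y # xs"] by (auto simp: min_def max_def split: if_splits)
    then show ?thesis using 1 False by auto
  qed
qed auto

definition walks :: "nat set \<Rightarrow> nat \<Rightarrow> nat list set" where
  "walks I m = {xs. set xs \<subseteq> I \<and> length xs = m}"

lemma walks_Suc: "walks I (Suc m) = (\<lambda>(x, xs). x # xs) ` (I \<times> walks I m)"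
  unfolding walks_def by (auto simp: length_Suc_conv image_iff)

lemma sum_walks_Suc: "(\<Sum>xs\<in>walks I (Suc m). f xs) = (\<Sum>x\<in>I. \<Sum>xs\<in>walks I m. f (x # xs))"
  unfolding walks_Suc
  by (subst sum.reindex) (auto simp: inj_on_def sum.cartesian_product o_def case_prod_unfold)

lemma mpow_as_walks:
  assumes "finite I" and "j \<in> I" "k \<in> I"
  shows "mpow I R m j k = (\<Sum>xs\<in>walks I m. of_bool (last (j # xs) = k) * prod_list (map2 R (j # xs) xs))"
  using assms(2)
proof (induction m arbitrary: j)
  case 0
  have "walks I 0 = {[]}" by (auto simp: walks_def)
  then show ?case by simp
next
  case (Suc m)
  have "mpow I R (Suc m) j k = (\<Sum>i\<in>I. R j i * (\<Sum>xs\<in>walks I m. of_bool (last (i # xs) = k) * prod_list (map2 R (i # xs) xs)))"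
    using Suc.IH by simp
  also have "\<dots> = (\<Sum>i\<in>I. \<Sum>xs\<in>walks I m. of_bool (last (j # i # xs) = k) * prod_list (map2 R (j # i # xs) (i # xs)))"
    by (simp add: sum_distrib_left mult_ac)
  finally show ?case by (simp add: sum_walks_Suc)
qed

text \<open>
  Extending a walk by an old vertex leaves its weight unchanged, and there are at most \<open>m\<close> of them;
  extending it by a new vertex costs a factor \<open>x\<close>, and there are at most \<open>card I\<close> of them.
\<close>

lemma sum_walks_power_card:
  fixes x :: real
  assumes I: "finite I" and x: "0 \<le> x"
  shows "(\<Sum>xs\<in>walks I (Suc m). x ^ card (set xs)) \<le> card I * x * (real m + card I * x) ^ m"
proof -
  have step: "(\<Sum>xs\<in>walks I (Suc l). x ^ card (set xs)) \<le> (real l + card I * x) * (\<Sum>xs\<in>walks I l. x ^ card (set xs))" for l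
  proof -
    have "(\<Sum>xs\<in>walks I (Suc l). x ^ card (set xs)) = (\<Sum>xs\<in>walks I l. \<Sum>y\<in>I. x ^ card (insert y (set xs)))"
      by (simp add: sum_walks_Suc) (rule sum.swap)
    also have "\<dots> \<le> (\<Sum>xs\<in>walks I l. (real l + card I * x) * x ^ card (set xs))"
    proof (rule sum_mono)
      fix xs assume xs: "xs \<in> walks I l"
      have "(\<Sum>y\<in>I. x ^ card (insert y (set xs))) \<le> (\<Sum>y\<in>I. (of_bool (y \<in> set xs) + x) * x ^ card (set xs))"
        using x by (intro sum_mono) (auto simp: card_insert_if insert_absorb distrib_right)
      also have "\<dots> = (card (I \<inter> set xs) + card I * x) * x ^ card (set xs)"
        using I by (simp add: sum_distrib_right[symmetric] sum.distrib of_bool_def sum.If_cases Int_def)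
      also have "\<dots> \<le> (real l + card I * x) * x ^ card (set xs)"
      proof -
        have "card (I \<inter> set xs) \<le> card (set xs)" by (intro card_mono) auto
        also have "\<dots> \<le> l" using xs card_length[of xs] by (simp add: walks_def)
        finally show ?thesis using x by (intro mult_right_mono add_right_mono) auto
      qed
      finally show "(\<Sum>y\<in>I. x ^ card (insert y (set xs))) \<le> (real l + card I * x) * x ^ card (set xs)" .
    qed
    finally show ?thesis by (simp add: sum_distrib_left)
  qed
  have "l \<le> m \<Longrightarrow> (\<Sum>xs\<in>walks I (Suc l). x ^ card (set xs)) \<le> card I * x * (real m + card I * x) ^ l" for l
  proof (induction l)
    case 0
    have "walks I 0 = {[]}" by (auto simp: walks_def)
    then show ?case using I by (simp add: sum_walks_Suc)
  next
    case (Suc l)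
    have "(\<Sum>xs\<in>walks I (Suc (Suc l)). x ^ card (set xs)) \<le> (real (Suc l) + card I * x) * (\<Sum>xs\<in>walks I (Suc l). x ^ card (set xs))"
      by (rule step)
    also have "\<dots> \<le> (real m + card I * x) * (card I * x * (real m + card I * x) ^ l)"
      using Suc x by (intro mult_mono sum_nonneg add_right_mono) auto
    finally show ?case by (simp add: mult_ac)
  qed
  then show ?thesis by simp
qed

lemma prod_list_count:
  fixes f :: "'e \<Rightarrow> 'b::comm_monoid_mult"
  assumes "finite E" "set es \<subseteq> E"
  shows "prod_list (map f es) = (\<Prod>e\<in>E. f e ^ count_list es e)"
  using assms(2)
proof (induction es)
  case (Cons a es)
  have "(\<Prod>e\<in>E. f e ^ count_list (a # es) e) = (\<Prod>e\<in>E. (if e = a then f a else 1) * f e ^ count_list es e)"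
    by (intro prod.cong) auto
  also have "\<dots> = f a * (\<Prod>e\<in>E. f e ^ count_list es e)"
    using Cons.prems assms(1) by (simp add: prod.distrib)
  finally show ?case using Cons by simp
qed simp

lemma finite_edges: "finite (edges n)"
proof (rule finite_subset)
  show "edges n \<subseteq> {1..n} \<times> {1..n}" by (auto simp: edges_def)
qed auto

definition sym_matrix :: "(nat \<times> nat \<Rightarrow> real) \<Rightarrow> nat \<Rightarrow> nat \<Rightarrow> real" where
  "sym_matrix b j k = (if j = k then 0 else b (min j k, max j k))"

lemma sym_matrix_sym: "sym_matrix b j k = sym_matrix b k j"
  by (simp add: sym_matrix_def min.commute max.commute)

lemma walk_prod_sym_matrix:
  "prod_list (map2 (sym_matrix b) (j # xs) xs) =
    (if \<exists>(a, c)\<in>set (walk_edges (j # xs)). a = c then 0 else prod_list (map b (walk_edges (j # xs))))"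
proof (induction xs arbitrary: j)
  case (Cons x xs)
  then show ?case by (auto simp: sym_matrix_def min_def max_def split: if_splits)
qed simp

lemma walk_edges_in_edges:
  assumes "set xs \<subseteq> {1..n}" "\<not> (\<exists>(a, c)\<in>set (walk_edges xs). a = c)"
  shows "set (walk_edges xs) \<subseteq> edges n"
  using assms
proof (induction xs rule: walk_edges.induct)
  case (1 x y xs)
  then show ?case by (auto simp: edges_def)
qed auto

text \<open>
  A closed walk of length \<open>2 q\<close> contributes to the expected trace only if each of its edges is used at
  least twice, and then at most \<open>p\<close> per distinct edge. There are at most \<open>q\<close> distinct edges, and at least
  as many as there are vertices besides the first one. Because \<open>2 q \<le> n p\<close>, the contribution of a walk is
  bounded by \<open>(n p / (2 q))\<^sup>q\<close> times the weight \<open>2 q / n\<close> per new vertex, and the weights are summed over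
  all walks, closed or not.
\<close>

lemma (in prob_space) expected_trace_bound:
  fixes b :: "nat \<times> nat \<Rightarrow> 'a \<Rightarrow> real"
  assumes ind: "indep_vars (\<lambda>_. borel) b (edges n)"
    and bnd: "\<And>e \<omega>. e \<in> edges n \<Longrightarrow> \<bar>b e \<omega>\<bar> \<le> 1"
    and mean: "\<And>e. e \<in> edges n \<Longrightarrow> expectation (b e) = 0"
    and var: "\<And>e. e \<in> edges n \<Longrightarrow> expectation (\<lambda>\<omega>. (b e \<omega>)\<^sup>2) \<le> p"
    and p: "0 < p" "p \<le> 1" and q: "1 \<le> q" "2 * real q \<le> n * p"
  shows "expectation (\<lambda>\<omega>. \<Sum>j=1..n. mpow {1..n} (sym_matrix (\<lambda>e. b e \<omega>)) (2 * q) j j) \<le> n * (8 * real q * (real n * p)) ^ q"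
    and "integrable M (\<lambda>\<omega>. \<Sum>j=1..n. mpow {1..n} (sym_matrix (\<lambda>e. b e \<omega>)) (2 * q) j j)"
proof -
  let ?E = "edges n" and ?I = "{1..n}"
  define wp where "wp xs \<omega> = (if \<exists>(a, c)\<in>set (walk_edges xs). a = c then 0 else \<Prod>e\<in>?E. b e \<omega> ^ count_list (walk_edges xs) e)" for xs \<omega>
  have n: "n \<ge> 1" using q p by (cases n) auto
  have rv[measurable]: "e \<in> ?E \<Longrightarrow> b e \<in> borel_measurable M" for e
    using ind by (auto simp: indep_vars_def)
  have int_pow: "integrable M (\<lambda>\<omega>. b e \<omega> ^ m)" if "e \<in> ?E" for e m
  proof (rule integrable_const_bound[where B=1])
    show "AE x in M. norm (b e x ^ m) \<le> 1"
      using bnd[OF that] by (auto simp: power_abs power_le_one)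
  qed (use that in auto)
  have int_wp: "integrable M (wp xs)" for xs
  proof -
    have "\<bar>\<Prod>e\<in>?E. b e \<omega> ^ count_list (walk_edges xs) e\<bar> \<le> 1" for \<omega>
      unfolding abs_prod using bnd by (intro prod_le_1) (auto simp: power_abs intro!: power_le_one)
    then show ?thesis
      unfolding wp_def[abs_def] by (cases "\<exists>(a, c)\<in>set (walk_edges xs). a = c")
         (auto intro!: integrable_const_bound[where B=1])
  qed
  have Ewp: "expectation (wp xs) \<le> p ^ card (set (walk_edges xs)) * of_bool (\<forall>e\<in>set (walk_edges xs). 2 \<le> count_list (walk_edges xs) e)"
    if xs: "xs \<in> walks ?I m" for xs m
  proof (cases "\<exists>(a, c)\<in>set (walk_edges xs). a = c")
    case True
    then show ?thesis using p by (simp add: wp_def[abs_def])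
  next
    case False
    let ?c = "count_list (walk_edges xs)"
    have sub: "set (walk_edges xs) \<subseteq> ?E"
      using walk_edges_in_edges[OF _ False] xs by (auto simp: walks_def)
    have "expectation (wp xs) = expectation (\<lambda>\<omega>. \<Prod>e\<in>?E. b e \<omega> ^ ?c e)"
      using False by (simp add: wp_def[abs_def])
    also have "\<dots> = (\<Prod>e\<in>?E. expectation (\<lambda>\<omega>. b e \<omega> ^ ?c e))"
    proof (rule indep_vars_lebesgue_integral)
      show "indep_vars (\<lambda>_. borel) (\<lambda>e \<omega>. b e \<omega> ^ ?c e) ?E"
        by (rule indep_vars_compose2[OF ind]) auto
    qed (auto intro: finite_edges int_pow)
    also have "\<dots> \<le> (\<Prod>e\<in>?E. \<bar>expectation (\<lambda>\<omega>. b e \<omega> ^ ?c e)\<bar>)"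
      by (subst abs_prod[symmetric]) simp
    also have "\<dots> \<le> (\<Prod>e\<in>?E. if e \<in> set (walk_edges xs) then p * of_bool (2 \<le> ?c e) else 1)"
    proof (rule prod_mono, safe)
      fix e assume e: "e \<in> ?E"
      consider "?c e = 0" | "?c e = 1" | "?c e \<ge> 2" by linarith
      then show "\<bar>expectation (\<lambda>\<omega>. b e \<omega> ^ ?c e)\<bar> \<le> (if e \<in> set (walk_edges xs) then p * of_bool (2 \<le> ?c e) else 1)"
      proof cases
        case 1
        then show ?thesis by (simp add: prob_space count_list_0_iff)
      next
        case 2
        then show ?thesis using mean[OF e] by simp
      next
        case 3
        have "\<bar>expectation (\<lambda>\<omega>. b e \<omega> ^ ?c e)\<bar> \<le> expectation (\<lambda>\<omega>. \<bar>b e \<omega> ^ ?c e\<bar>)"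
          by (rule integral_abs_bound)
        also have "\<dots> \<le> expectation (\<lambda>\<omega>. (b e \<omega>)\<^sup>2)"
        proof (rule integral_mono)
          show "\<bar>b e \<omega> ^ ?c e\<bar> \<le> (b e \<omega>)\<^sup>2" for \<omega>
            using power_decreasing[OF 3, of "\<bar>b e \<omega>\<bar>"] bnd[OF e] by (simp add: power_abs)
        qed (use int_pow[OF e] in auto)
        also have "\<dots> \<le> p" by (rule var[OF e])
        finally show ?thesis using 3 by (auto simp: count_list_0_iff dest: count_notin)
      qed
    qed auto
    also have "\<dots> = (\<Prod>e\<in>set (walk_edges xs). p * of_bool (2 \<le> ?c e))"
      using sub finite_edges[of n] by (simp add: prod.If_cases Int_absorb1)
    also have "\<dots> = p ^ card (set (walk_edges xs)) * of_bool (\<forall>e\<in>set (walk_edges xs). 2 \<le> ?c e)"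
      by (simp add: prod.distrib of_bool_def prod.If_cases) (auto simp: card_gt_0_iff power_0_left)
    finally show ?thesis .
  qed
  \<comment> \<open>The weight of a new vertex; with this choice new and old vertices contribute equally.\<close>
  define x where "x = 2 * real q / n"
  have x: "x > 0" using q n by (simp add: x_def)
  have nx: "n * x = 2 * q" using n by (simp add: x_def)
  have Ewp2: "expectation (wp xs) \<le> (n * p / (2 * q)) ^ q * (x ^ card (set xs) / x)"
    if xs: "xs \<in> walks ?I (Suc (2 * q))" for xs
  proof -
    let ?es = "walk_edges xs" and ?c = "count_list (walk_edges xs)"
    have rhs0: "0 \<le> (n * p / (2 * q)) ^ q * (x ^ card (set xs) / x)" using x p by simp
    show ?thesis
    proof (cases "\<forall>e\<in>set ?es. 2 \<le> ?c e")
      case True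
      have "2 * card (set ?es) \<le> (\<Sum>e\<in>set ?es. ?c e)"
        using sum_mono[of "set ?es" "\<lambda>_. 2" ?c] True by simp
      also have "\<dots> = 2 * q"
        using xs by (simp add: sum_count_set length_walk_edges walks_def)
      finally have cq: "card (set ?es) \<le> q" by simp
      obtain k where k: "card (set xs) = Suc k"
        using xs by (cases "card (set xs)") (auto simp: walks_def)
      have "xs \<noteq> []" using xs by (auto simp: walks_def)
      then have "k \<le> card (set ?es)" using card_set_walk[of xs] k by simp
      have "expectation (wp xs) \<le> p ^ card (set ?es)" using Ewp[OF xs] True by simp
      also have "\<dots> \<le> p ^ k" using p \<open>k \<le> _\<close> by (intro power_decreasing) auto
      also have "\<dots> = (n * p / (2 * q)) ^ k * x ^ k"
        using n q by (simp add: x_def power_mult_distrib[symmetric])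
      also have "\<dots> \<le> (n * p / (2 * q)) ^ q * x ^ k"
        using q x \<open>k \<le> _\<close> cq by (intro mult_right_mono power_increasing) (auto simp: field_simps)
      also have "x ^ k = x ^ card (set xs) / x" using x k by simp
      finally show ?thesis .
    next
      case False
      then have "of_bool (\<forall>e\<in>set ?es. 2 \<le> ?c e) = (0::real)" by simp
      then have "expectation (wp xs) \<le> 0" using Ewp[OF xs] by (metis mult_zero_right)
      then show ?thesis using rhs0 by linarith
    qed
  qed
  have tr: "(\<Sum>j=1..n. mpow ?I (sym_matrix (\<lambda>e. b e \<omega>)) (2 * q) j j) =
     (\<Sum>xs\<in>walks ?I (Suc (2 * q)). of_bool (last xs = hd xs) * wp xs \<omega>)" for \<omega>
  proof -
    have "prod_list (map2 (sym_matrix (\<lambda>e. b e \<omega>)) (j # xs) xs) = wp (j # xs) \<omega>"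
      if "j \<in> ?I" "xs \<in> walks ?I m" for j xs m
    proof (cases "\<exists>(a, c)\<in>set (walk_edges (j # xs)). a = c")
      case False
      have "set (walk_edges (j # xs)) \<subseteq> edges n"
        by (rule walk_edges_in_edges[OF _ False]) (use that in \<open>auto simp: walks_def\<close>)
      from prod_list_count[OF finite_edges this] False show ?thesis
        by (simp add: walk_prod_sym_matrix wp_def)
    qed (simp add: walk_prod_sym_matrix wp_def)
    then have "mpow ?I (sym_matrix (\<lambda>e. b e \<omega>)) (2 * q) j j = (\<Sum>xs\<in>walks ?I (2 * q). of_bool (last (j # xs) = hd (j # xs)) * wp (j # xs) \<omega>)"
      if "j \<in> ?I" for j
      using that by (subst mpow_as_walks) (auto intro!: sum.cong)
    then show ?thesis by (simp add: sum_walks_Suc)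
  qed
  show "integrable M (\<lambda>\<omega>. \<Sum>j=1..n. mpow ?I (sym_matrix (\<lambda>e. b e \<omega>)) (2 * q) j j)"
    unfolding tr by (intro Bochner_Integration.integrable_sum integrable_mult_right int_wp)
  have "expectation (\<lambda>\<omega>. \<Sum>j=1..n. mpow ?I (sym_matrix (\<lambda>e. b e \<omega>)) (2 * q) j j)
      = (\<Sum>xs\<in>walks ?I (Suc (2 * q)). of_bool (last xs = hd xs) * expectation (wp xs))"
    unfolding tr by (subst Bochner_Integration.integral_sum) (auto intro!: integrable_mult_right int_wp)
  also have "\<dots> \<le> (\<Sum>xs\<in>walks ?I (Suc (2 * q)). (n * p / (2 * q)) ^ q * (x ^ card (set xs) / x))"
  proof (rule sum_mono)
    fix xs assume xs: "xs \<in> walks ?I (Suc (2 * q))"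
    have "0 \<le> (n * p / (2 * q)) ^ q * (x ^ card (set xs) / x)" using x p by simp
    then show "of_bool (last xs = hd xs) * expectation (wp xs) \<le> (n * p / (2 * q)) ^ q * (x ^ card (set xs) / x)"
      using Ewp2[OF xs] by simp
  qed
  also have "\<dots> = (n * p / (2 * q)) ^ q / x * (\<Sum>xs\<in>walks ?I (Suc (2 * q)). x ^ card (set xs))"
    by (simp add: sum_distrib_left)
  also have "\<dots> \<le> (n * p / (2 * q)) ^ q / x * (card ?I * x * (real (2 * q) + card ?I * x) ^ (2 * q))"
    using x p by (intro mult_left_mono sum_walks_power_card) auto
  also have "\<dots> = n * ((n * p / (2 * q)) * (4 * real q)\<^sup>2) ^ q"
  proof -
    have cancel: "X / x * (N * x * Y) = N * (X * Y)" for X N Y :: real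
      using x by simp
    have base: "real (2 * q) + card ?I * x = real (4 * q)" using nx by simp
    have "(n * p / (2 * q)) ^ q / x * (card ?I * x * (real (2 * q) + card ?I * x) ^ (2 * q))
        = n * ((n * p / (2 * q)) ^ q * (real (4 * q)) ^ (2 * q))"
      unfolding base cancel by simp
    also have "\<dots> = n * ((n * p / (2 * q)) * (4 * real q)\<^sup>2) ^ q"
      unfolding power_mult[of "real (4 * q)" 2 q] power_mult_distrib[of "n * p / (2 * q)", symmetric] by simp
    finally show ?thesis .
  qed
  also have "(n * p / (2 * q)) * (4 * real q)\<^sup>2 = 8 * real q * (real n * p)"
    using q by (simp add: power2_eq_square field_simps)
  finally show "expectation (\<lambda>\<omega>. \<Sum>j=1..n. mpow ?I (sym_matrix (\<lambda>e. b e \<omega>)) (2 * q) j j) \<le> n * (8 * real q * (real n * p)) ^ q" .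
qed

section \<open>Degrees and operator norm of the centred random graph\<close>

lemma (in prob_space) chernoff:
  assumes [measurable]: "f \<in> borel_measurable M" and s: "0 < s"
    and C: "(\<integral>\<^sup>+\<omega>. ennreal (exp (s * f \<omega>)) \<partial>M) \<le> ennreal C" "0 \<le> C"
  shows "prob {\<omega>\<in>space M. a \<le> f \<omega>} \<le> exp (- s * a) * C"
proof -
  have "emeasure M {\<omega>\<in>space M. a \<le> f \<omega>} \<le> ennreal (exp (- s * a)) * (\<integral>\<^sup>+\<omega>. ennreal (exp (s * f \<omega>)) * indicator (space M) \<omega> \<partial>M)"
    by (rule Chernoff_ineq_nn_integral_ge[OF s]) auto
  also have "(\<integral>\<^sup>+\<omega>. ennreal (exp (s * f \<omega>)) * indicator (space M) \<omega> \<partial>M) = (\<integral>\<^sup>+\<omega>. ennreal (exp (s * f \<omega>)) \<partial>M)"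
    by (intro nn_integral_cong) auto
  also have "ennreal (exp (- s * a)) * \<dots> \<le> ennreal (exp (- s * a)) * ennreal C"
    by (intro mult_left_mono C) auto
  also have "\<dots> = ennreal (exp (- s * a) * C)" by (simp add: ennreal_mult' C)
  finally show ?thesis using C(2) by (simp add: emeasure_eq_measure)
qed

lemma exp_le_quadratic:
  fixes x :: real
  assumes "\<bar>x\<bar> \<le> 1"
  shows "exp x \<le> 1 + x + x\<^sup>2"
proof (cases "0 \<le> x")
  case True
  then show ?thesis using exp_bound[of x] assms by simp
next
  case False
  define y where "y = - x"
  have y: "0 \<le> y" "y \<le> 1" using False assms by (auto simp: y_def)
  have "(1 - y + y\<^sup>2) * (1 + y + y\<^sup>2 / 2) = 1 + (y ^ 2 + y ^ 3 + y ^ 4) / 2"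
    by (simp add: field_simps power2_eq_square power3_eq_cube power4_eq_xxxx)
  then have "1 \<le> (1 - y + y\<^sup>2) * (1 + y + y\<^sup>2 / 2)"
    using y by (simp add: add_nonneg_nonneg)
  also have "\<dots> \<le> (1 - y + y\<^sup>2) * exp y"
  proof (rule mult_left_mono)
    have "0 \<le> (1 - y) + y\<^sup>2" using y by (intro add_nonneg_nonneg) auto
    then show "0 \<le> 1 - y + y\<^sup>2" .
  qed (use exp_lower_Taylor_quadratic[of y] y in simp)
  finally have "exp (- y) \<le> 1 - y + y\<^sup>2" by (simp add: exp_minus field_simps)
  then show ?thesis by (simp add: y_def)
qed

lemma sum_sym_matrix_row:
  assumes "j \<in> {1..n}"
  shows "(\<Sum>k=1..n. sym_matrix b j k) = (\<Sum>e\<in>{e \<in> edges n. fst e = j \<or> snd e = j}. b e)"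
proof -
  have "(\<Sum>k=1..n. sym_matrix b j k) = (\<Sum>k\<in>{1..n} - {j}. b (min j k, max j k))"
    using assms by (simp add: sum.remove[of _ j] sym_matrix_def)
  also have "\<dots> = (\<Sum>e\<in>{e \<in> edges n. fst e = j \<or> snd e = j}. b e)"
    by (rule sum.reindex_bij_witness[where j="\<lambda>k. (min j k, max j k)" and i="\<lambda>e. if fst e = j then snd e else fst e"])
       (use assms in \<open>auto simp: edges_def min_def max_def split: if_splits\<close>)
  finally show ?thesis .
qed

lemma card_incident: "j \<in> {1..n} \<Longrightarrow> card {e \<in> edges n. fst e = j \<or> snd e = j} \<le> n"
  using sum_sym_matrix_row[of j n "\<lambda>_. 1"] sum_bounded_above[of "{1..n}" "sym_matrix (\<lambda>_. 1) j" 1]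
  by (simp add: sym_matrix_def split: if_splits)

text \<open>
  The centred entries of the adjacency matrix form the intended instance.
\<close>

locale bounded_edge_weights = prob_space M for M :: "'a measure" +
  fixes n :: nat and b :: "nat \<times> nat \<Rightarrow> 'a \<Rightarrow> real" and p :: real
  assumes ind: "indep_vars (\<lambda>_. borel) b (edges n)"
    and bnd: "\<And>e \<omega>. e \<in> edges n \<Longrightarrow> \<bar>b e \<omega>\<bar> \<le> 1"
    and mean: "\<And>e. e \<in> edges n \<Longrightarrow> expectation (b e) = 0"
    and var: "\<And>e. e \<in> edges n \<Longrightarrow> expectation (\<lambda>\<omega>. (b e \<omega>)\<^sup>2) \<le> p"
    and p: "0 < p" "p \<le> 1"
begin

lemma weight_measurable[measurable]: "e \<in> edges n \<Longrightarrow> b e \<in> borel_measurable M"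
  using ind by (auto simp: indep_vars_def)

lemma edge_mgf:
  assumes e: "e \<in> edges n" and t: "\<bar>t\<bar> \<le> 1"
  shows "(\<integral>\<^sup>+\<omega>. ennreal (exp (t * b e \<omega>)) \<partial>M) \<le> ennreal (exp (p * t\<^sup>2))"
proof -
  note [measurable] = weight_measurable[OF e]
  have i1: "integrable M (b e)" by (rule integrable_const_bound[where B=1]) (use bnd[OF e] in auto)
  have i2: "integrable M (\<lambda>\<omega>. (b e \<omega>)\<^sup>2)"
    by (rule integrable_const_bound[where B=1]) (use bnd[OF e] in \<open>auto simp: abs_square_le_1\<close>)
  have "(\<integral>\<^sup>+\<omega>. ennreal (exp (t * b e \<omega>)) \<partial>M) \<le> (\<integral>\<^sup>+\<omega>. ennreal (1 + t * b e \<omega> + t\<^sup>2 * (b e \<omega>)\<^sup>2) \<partial>M)"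
  proof (intro nn_integral_mono ennreal_leI)
    fix \<omega>
    have "\<bar>t * b e \<omega>\<bar> \<le> 1" using bnd[OF e, of \<omega>] t by (simp add: abs_mult mult_le_one)
    then show "exp (t * b e \<omega>) \<le> 1 + t * b e \<omega> + t\<^sup>2 * (b e \<omega>)\<^sup>2"
      using exp_le_quadratic[of "t * b e \<omega>"] by (simp add: power_mult_distrib)
  qed
  also have "\<dots> = ennreal (expectation (\<lambda>\<omega>. 1 + t * b e \<omega> + t\<^sup>2 * (b e \<omega>)\<^sup>2))"
  proof (rule nn_integral_eq_integral)
    show "AE \<omega> in M. 0 \<le> 1 + t * b e \<omega> + t\<^sup>2 * (b e \<omega>)\<^sup>2"
    proof (rule AE_I2)
      fix \<omega>
      have "\<bar>t * b e \<omega>\<bar> \<le> 1" using bnd[OF e, of \<omega>] t by (simp add: abs_mult mult_le_one)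
      then have "0 \<le> 1 + t * b e \<omega>" by (simp add: abs_le_iff)
      then show "0 \<le> 1 + t * b e \<omega> + t\<^sup>2 * (b e \<omega>)\<^sup>2" by (rule add_nonneg_nonneg) simp
    qed
  qed (intro Bochner_Integration.integrable_add integrable_mult_right i1 i2 integrable_const)
  also have "expectation (\<lambda>\<omega>. 1 + t * b e \<omega> + t\<^sup>2 * (b e \<omega>)\<^sup>2) = 1 + t\<^sup>2 * expectation (\<lambda>\<omega>. (b e \<omega>)\<^sup>2)"
    using i1 i2 mean[OF e]
    by (subst Bochner_Integration.integral_add, simp, simp, subst Bochner_Integration.integral_add) (auto simp: prob_space)
  also have "\<dots> \<le> 1 + p * t\<^sup>2" using mult_left_mono[OF var[OF e], of "t\<^sup>2"] by (simp add: mult.commute[of p])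
  also have "\<dots> \<le> exp (p * t\<^sup>2)" by (rule exp_ge_add_one_self)
  finally show ?thesis by (simp add: ennreal_leI)
qed

lemma row_sum_tail:
  assumes j: "j \<in> {1..n}" and n: "1 < n" "ln n \<le> n * p"
  shows "prob {\<omega>\<in>space M. 4 * sqrt (n * p * ln n) \<le> \<bar>\<Sum>k=1..n. sym_matrix (\<lambda>e. b e \<omega>) j k\<bar>} \<le> 2 / real n ^ 3"
proof -
  let ?S = "{e \<in> edges n. fst e = j \<or> snd e = j}"
  define X where "X \<omega> = (\<Sum>e\<in>?S. b e \<omega>)" for \<omega>
  have fin: "finite ?S" using finite_edges[of n] by simp
  have [measurable]: "X \<in> borel_measurable M" unfolding X_def by (rule borel_measurable_sum) auto
  define L where "L = ln (real n)"
  have L: "L > 0" using n by (simp add: L_def)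
  have np: "real n * p > 0" using n p by simp
  \<comment> \<open>Up to a constant this is the minimizer of the Chernoff exponent.\<close>
  define t where "t = sqrt (L / (n * p))"
  have t: "0 < t" "t \<le> 1" using L np n by (auto simp: t_def L_def)
  have t2: "n * p * t\<^sup>2 = L" using L np n p by (simp add: t_def)
  have ta: "t * (4 * sqrt (n * p * L)) = 4 * L"
    using L np n p by (simp add: t_def real_sqrt_divide real_sqrt_mult)
  have mgf: "(\<integral>\<^sup>+\<omega>. ennreal (exp (u * X \<omega>)) \<partial>M) \<le> ennreal (exp L)" if "u = t \<or> u = - t" for u
  proof -
    have u: "\<bar>u\<bar> \<le> 1" "u\<^sup>2 = t\<^sup>2" using that t by auto
    have iv: "indep_vars (\<lambda>_. borel) (\<lambda>e \<omega>. ennreal (exp (u * b e \<omega>))) ?S"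
      by (rule indep_vars_compose2[OF indep_vars_subset[OF ind]]) auto
    have "(\<integral>\<^sup>+\<omega>. ennreal (exp (u * X \<omega>)) \<partial>M) = (\<integral>\<^sup>+\<omega>. (\<Prod>e\<in>?S. ennreal (exp (u * b e \<omega>))) \<partial>M)"
      using fin by (intro nn_integral_cong) (simp add: X_def prod_ennreal sum_distrib_left exp_sum)
    also have "\<dots> = (\<Prod>e\<in>?S. \<integral>\<^sup>+\<omega>. ennreal (exp (u * b e \<omega>)) \<partial>M)"
      by (rule indep_vars_nn_integral[OF fin iv]) auto
    also have "\<dots> \<le> (\<Prod>e\<in>?S. ennreal (exp (p * u\<^sup>2)))"
      by (rule prod_mono_ennreal) (use edge_mgf[OF _ u(1)] in auto)
    also have "\<dots> = ennreal (exp (card ?S * (p * t\<^sup>2)))"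
      by (simp add: ennreal_power exp_of_nat_mult[symmetric] u)
    also have "\<dots> \<le> ennreal (exp (n * (p * t\<^sup>2)))"
      using card_incident[OF j] p by (intro ennreal_leI exp_mono mult_right_mono) auto
    finally show ?thesis using t2 by (simp add: mult.assoc)
  qed
  let ?P = "{\<omega>\<in>space M. 4 * sqrt (n * p * L) \<le> X \<omega>}" and ?N = "{\<omega>\<in>space M. 4 * sqrt (n * p * L) \<le> - X \<omega>}"
  have P: "prob ?P \<le> exp (- t * (4 * sqrt (n * p * L))) * exp L"
    by (rule chernoff) (use t mgf[of t] in auto)
  have N: "prob ?N \<le> exp (- t * (4 * sqrt (n * p * L))) * exp L"
    by (rule chernoff) (use t mgf[of "-t"] in auto)
  have val: "exp (- t * (4 * sqrt (n * p * L))) * exp L = 1 / real n ^ 3"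
  proof -
    have "exp (- t * (4 * sqrt (n * p * L))) * exp L = exp (- (of_nat 3 * L))"
      by (simp add: ta exp_add[symmetric])
    also have "\<dots> = inverse (exp L ^ 3)" by (simp only: exp_minus exp_of_nat_mult)
    finally show ?thesis using n by (simp add: L_def inverse_eq_divide)
  qed
  have "{\<omega>\<in>space M. 4 * sqrt (n * p * ln n) \<le> \<bar>\<Sum>k=1..n. sym_matrix (\<lambda>e. b e \<omega>) j k\<bar>} = ?P \<union> ?N"
    unfolding sum_sym_matrix_row[OF j] X_def L_def by auto
  moreover have "prob (?P \<union> ?N) \<le> prob ?P + prob ?N"
    by (rule measure_Un_le) auto
  moreover have "prob ?P + prob ?N \<le> 2 / real n ^ 3"
    using P N unfolding val by linarith
  ultimately show ?thesis by (metis (no_types, lifting) order_trans)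
qed

end

lemma power_of_two_between:
  fixes x :: real
  assumes "1 \<le> x"
  obtains r where "x \<le> 2 ^ r" "2 ^ r \<le> 2 * x"
proof -
  obtain m where m: "x < 2 ^ m" using real_arch_pow[of 2 x] by auto
  define r where "r = (LEAST r. x \<le> 2 ^ r)"
  have r: "x \<le> 2 ^ r" unfolding r_def by (rule LeastI[of _ m]) (use m in simp)
  have "2 ^ r \<le> 2 * x"
  proof (cases r)
    case (Suc s)
    then have "\<not> x \<le> 2 ^ s" using not_less_Least[of s "\<lambda>r. x \<le> 2 ^ r"] by (simp add: r_def)
    then show ?thesis by (simp add: Suc)
  qed (use assms in simp)
  with r show thesis by (rule that)
qed

text \<open>
  These two properties of the centred adjacency matrix are everything that is used about the graph.
  The operator norm bound is off by a factor \<open>sqrt (log n)\<close> from the true order.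
\<close>

definition nearly_regular :: "nat \<Rightarrow> real \<Rightarrow> (nat \<Rightarrow> nat \<Rightarrow> real) \<Rightarrow> bool" where
  "nearly_regular n p B \<longleftrightarrow>
     (\<forall>j\<in>{1..n}. \<bar>\<Sum>k=1..n. B j k\<bar> \<le> 4 * sqrt (n * p * ln n)) \<and>
     (\<forall>v. (\<Sum>j=1..n. (\<Sum>k=1..n. B j k * v k)\<^sup>2) \<le> 432 * (n * p * ln n) * (\<Sum>j=1..n. (v j)\<^sup>2))"

context bounded_edge_weights
begin

text \<open>
  The exponent \<open>q\<close> is a power of two between \<open>log n\<close> and \<open>2 log n\<close>, so that \<open>n\<close> is at most \<open>e\<^sup>q\<close> and
  disappears in the \<open>q\<close>-th root of the trace bound. The constant is \<open>432 = 16 * 27 \<ge> 16 e\<^sup>3\<close>.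
\<close>

lemma nearly_regular_whp:
  assumes n: "3 \<le> n" "4 * ln n \<le> n * p"
    and meas: "{\<omega>\<in>space M. \<not> nearly_regular n p (sym_matrix (\<lambda>e. b e \<omega>))} \<in> events"
  shows "prob {\<omega>\<in>space M. \<not> nearly_regular n p (sym_matrix (\<lambda>e. b e \<omega>))} \<le> 3 / real n ^ 2"
proof -
  define L where "L = ln (real n)"
  have "exp 1 \<le> real n" using exp_le n by linarith
  then have L: "1 \<le> L" using n unfolding L_def by (subst ln_ge_iff) auto
  have expL: "exp L = real n" using n by (simp add: L_def)
  have np: "real n * p > 0" using n p by simp
  obtain r where r: "L \<le> 2 ^ r" "2 ^ r \<le> 2 * L" using power_of_two_between[OF L] .
  define q :: nat where "q = 2 ^ r"
  have q: "1 \<le> q" "L \<le> q" "q \<le> 2 * L" using r by (auto simp: q_def)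
  have nq: "real n \<le> exp (real q)" using q(2) exp_le_cancel_iff[of L q] by (simp add: expL)
  define z where "z = 8 * real q * (real n * p)"
  have z0: "z \<ge> 0" using np by (simp add: z_def)
  define Tr where "Tr \<omega> = (\<Sum>j=1..n. mpow {1..n} (sym_matrix (\<lambda>e. b e \<omega>)) (2 * q) j j)" for \<omega>
  have q2: "2 * real q \<le> n * p" using q n by (simp add: L_def)
  note tr = expected_trace_bound[OF ind bnd mean var p q(1) q2, folded Tr_def]
  define c where "c = n * (8 * real q * (real n * p)) ^ q * exp (2 * q)"
  have c0: "c > 0" unfolding c_def using n np q p by (intro mult_pos_pos zero_less_power) auto
  have Tr0: "Tr \<omega> \<ge> 0" for \<omega>
    unfolding Tr_def trace_even_power[OF finite_atLeastAtMost sym_matrix_sym, symmetric]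
    by (intro sum_nonneg) auto
  let ?N1 = "{\<omega>\<in>space M. c \<le> Tr \<omega>}"
  let ?N2 = "\<lambda>j. {\<omega>\<in>space M. 4 * sqrt (n * p * ln n) \<le> \<bar>\<Sum>k=1..n. sym_matrix (\<lambda>e. b e \<omega>) j k\<bar>}"
  have [measurable]: "Tr \<in> borel_measurable M" using tr(2) by (rule borel_measurable_integrable)
  have N2_ev: "?N2 j \<in> events" if "j \<in> {1..n}" for j
    unfolding sum_sym_matrix_row[OF that] by measurable
  have "prob ?N1 \<le> expectation Tr / c"
    by (rule integral_Markov_inequality_measure[OF tr(2) sets.empty_sets]) (use Tr0 c0 in auto)
  also have "\<dots> \<le> (n * (8 * real q * (real n * p)) ^ q) / c"
    using tr(1) c0 by (intro divide_right_mono) auto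
  also have "\<dots> = exp (- (2 * q))"
    using n np q p unfolding c_def by (simp add: exp_minus field_simps)
  also have "\<dots> \<le> exp (- (L + L))" using q by simp
  also have "\<dots> = 1 / real n ^ 2"
    using expL by (simp only: exp_minus exp_add) (simp add: power2_eq_square inverse_eq_divide)
  finally have N1: "prob ?N1 \<le> 1 / real n ^ 2" .
  have "prob (\<Union>j\<in>{1..n}. ?N2 j) \<le> (\<Sum>j=1..n. prob (?N2 j))"
    by (rule measure_UNION_le[OF finite_atLeastAtMost N2_ev])
  also have "\<dots> \<le> (\<Sum>j=1..n. 2 / real n ^ 3)"
    by (intro sum_mono row_sum_tail) (use n L in \<open>auto simp: L_def\<close>)
  also have "\<dots> = 2 / real n ^ 2" using n by (simp add: power3_eq_cube power2_eq_square)
  finally have N2: "prob (\<Union>j\<in>{1..n}. ?N2 j) \<le> 2 / real n ^ 2" .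
  have sub: "{\<omega>\<in>space M. \<not> nearly_regular n p (sym_matrix (\<lambda>e. b e \<omega>))} \<subseteq> ?N1 \<union> (\<Union>j\<in>{1..n}. ?N2 j)"
  proof (rule subsetI, rule ccontr)
    fix \<omega> assume a: "\<omega> \<in> {\<omega>\<in>space M. \<not> nearly_regular n p (sym_matrix (\<lambda>e. b e \<omega>))}"
      and b: "\<omega> \<notin> ?N1 \<union> (\<Union>j\<in>{1..n}. ?N2 j)"
    let ?B = "sym_matrix (\<lambda>e. b e \<omega>)"
    have trc: "Tr \<omega> \<le> c" using a b by auto
    have "(\<Sum>j=1..n. (\<Sum>k=1..n. ?B j k * v k)\<^sup>2) \<le> 432 * (n * p * ln n) * (\<Sum>j=1..n. (v j)\<^sup>2)" for v
    proof -
      define V where "V = (\<Sum>j=1..n. (v j)\<^sup>2)"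
      have V0: "V \<ge> 0" unfolding V_def by (intro sum_nonneg) auto
      have "(\<Sum>j=1..n. (\<Sum>k=1..n. ?B j k * v k)\<^sup>2) ^ q \<le> V ^ q * Tr \<omega>"
        unfolding q_def V_def Tr_def by (rule op_bound_by_trace[OF finite_atLeastAtMost sym_matrix_sym])
      also have "\<dots> \<le> V ^ q * (exp 3 * z) ^ q"
      proof -
        have "c = real n * (z ^ q * exp (2 * real q))" by (simp add: c_def z_def)
        also have "\<dots> \<le> exp (real q) * (z ^ q * exp (2 * real q))"
          using nq z0 by (intro mult_right_mono) auto
        also have "\<dots> = (exp (real q) * exp (2 * real q)) * z ^ q" by simp
        also have "exp (real q) * exp (2 * real q) = exp 3 ^ q"
          by (simp add: exp_add[symmetric] exp_of_nat_mult[symmetric])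
        finally have "c \<le> (exp 3 * z) ^ q" by (simp add: power_mult_distrib)
        then show ?thesis using trc V0 by (intro mult_left_mono) auto
      qed
      also have "\<dots> = (V * (exp 3 * (8 * real q * (real n * p)))) ^ q"
        by (simp add: power_mult_distrib z_def)
      finally have "(\<Sum>j=1..n. (\<Sum>k=1..n. ?B j k * v k)\<^sup>2) ^ q \<le> (V * (exp 3 * (8 * real q * (real n * p)))) ^ q" .
      then have "(\<Sum>j=1..n. (\<Sum>k=1..n. ?B j k * v k)\<^sup>2) ^ Suc (q - 1) \<le> (V * (exp 3 * (8 * real q * (real n * p)))) ^ Suc (q - 1)"
        using q(1) by simp
      then have "(\<Sum>j=1..n. (\<Sum>k=1..n. ?B j k * v k)\<^sup>2) \<le> V * (exp 3 * (8 * real q * (real n * p)))"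
        by (rule power_le_imp_le_base) (use z0 V0 in \<open>simp add: z_def\<close>)
      also have "\<dots> \<le> V * (27 * (8 * (2 * L) * (n * p)))"
      proof -
        have "exp (3::real) = exp 1 ^ 3" by (simp add: exp_of_nat_mult[symmetric])
        also have "\<dots> \<le> 3 ^ 3" by (intro power_mono exp_le) auto
        finally show ?thesis using q np V0 L by (intro mult_left_mono mult_mono mult_right_mono) auto
      qed
      finally show ?thesis by (simp add: V_def L_def mult_ac)
    qed
    moreover have "\<forall>j\<in>{1..n}. \<bar>\<Sum>k=1..n. ?B j k\<bar> \<le> 4 * sqrt (n * p * ln n)"
      using a b by (auto simp: not_le less_imp_le)
    ultimately have "nearly_regular n p ?B" unfolding nearly_regular_def by blast
    then show False using a by simp
  qed
  have "prob {\<omega>\<in>space M. \<not> nearly_regular n p (sym_matrix (\<lambda>e. b e \<omega>))} \<le> prob (?N1 \<union> (\<Union>j\<in>{1..n}. ?N2 j))"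
    by (rule finite_measure_mono[OF sub sets.Un[OF _ sets.finite_UN[OF finite_atLeastAtMost N2_ev]]]) measurable
  also have "\<dots> \<le> prob ?N1 + prob (\<Union>j\<in>{1..n}. ?N2 j)"
    by (rule measure_Un_le[OF _ sets.finite_UN[OF finite_atLeastAtMost N2_ev]]) measurable
  also have "\<dots> \<le> 3 / real n ^ 2" using N1 N2 by (simp add: field_simps)
  finally show ?thesis .
qed

end

section \<open>Conditioning on the graph\<close>

lemma (in prob_space) indep_vars_reindex:
  assumes ind: "indep_vars M' X (f ` I)" and f: "inj_on f I"
  shows "indep_vars (\<lambda>i. M' (f i)) (\<lambda>i. X (f i)) I"
proof -
  have "indep_vars (\<lambda>i. PiM {f i} M') (\<lambda>i \<omega>. restrict (\<lambda>j. X j \<omega>) {f i}) I"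
    by (rule indep_vars_restrict[OF ind]) (use f in \<open>auto simp: disjoint_family_on_def inj_on_def\<close>)
  then have "indep_vars (\<lambda>i. M' (f i)) (\<lambda>i \<omega>. (\<lambda>x. x (f i)) (restrict (\<lambda>j. X j \<omega>) {f i})) I"
    by (rule indep_vars_compose2) (auto intro!: measurable_component_singleton)
  then show ?thesis by simp
qed

context synchronization_model
begin

definition graph :: "'a \<Rightarrow> (nat \<times> nat) set" where
  "graph \<omega> = {e \<in> edges n. A e \<omega>}"

definition noise :: "'a \<Rightarrow> nat \<times> nat \<Rightarrow> complex" where
  "noise \<omega> = (\<lambda>e\<in>edges n. W e \<omega>)"

lemma indep_A: "indep_vars (\<lambda>_. borel) (\<lambda>e \<omega>. of_bool (A e \<omega>) :: complex) (edges n)"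
proof -
  have "indep_vars (\<lambda>_. borel) (case_sum (\<lambda>e \<omega>. of_bool (A e \<omega>)) W) (Inl ` edges n)"
    by (rule indep_vars_subset[OF indep_A_W]) auto
  from indep_vars_reindex[OF this] show ?thesis by simp
qed

lemma indep_W: "indep_vars (\<lambda>_. borel) W (edges n)"
proof -
  have "indep_vars (\<lambda>_. borel) (case_sum (\<lambda>e \<omega>. of_bool (A e \<omega>)) W) (Inr ` edges n)"
    by (rule indep_vars_subset[OF indep_A_W]) auto
  from indep_vars_reindex[OF this] show ?thesis by simp
qed

lemma centered_adjacency_weights:
  assumes p: "0 < p" "p \<le> 1"
  shows "bounded_edge_weights M n (\<lambda>e \<omega>. of_bool (A e \<omega>) - p) p"
proof
  have E: "expectation (\<lambda>\<omega>. f (A e \<omega>)) = p * f True + (1 - p) * f False" if "e \<in> edges n" for e and f :: "bool \<Rightarrow> real"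
  proof -
    have "expectation (\<lambda>\<omega>. f (A e \<omega>)) = integral\<^sup>L (distr M (count_space UNIV) (A e)) f"
      using measurable_A[OF that] by (subst integral_distr) auto
    also have "\<dots> = p * f True + (1 - p) * f False"
      unfolding distr_A[OF that] using p by simp
    finally show ?thesis .
  qed
  have "indep_vars (\<lambda>_. borel) (\<lambda>e \<omega>. Re (of_bool (A e \<omega>)) - p) (edges n)"
    by (rule indep_vars_compose2[OF indep_A]) auto
  moreover have "Re (of_bool P) = of_bool P" for P by (cases P) auto
  ultimately show "indep_vars (\<lambda>_. borel) (\<lambda>e \<omega>. of_bool (A e \<omega>) - p) (edges n)" by simp
  show "\<bar>of_bool (A e \<omega>) - p\<bar> \<le> 1" for e \<omega> using p by (cases "A e \<omega>") auto
  show "expectation (\<lambda>\<omega>. of_bool (A e \<omega>) - p) = 0" if "e \<in> edges n" for e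
    using E[OF that, of "\<lambda>x. of_bool x - p"] by (simp add: algebra_simps)
  show "expectation (\<lambda>\<omega>. (of_bool (A e \<omega>) - p)\<^sup>2) \<le> p" if "e \<in> edges n" for e
  proof -
    have "expectation (\<lambda>\<omega>. (of_bool (A e \<omega>) - p)\<^sup>2) = p * (1 - p)"
      using E[OF that, of "\<lambda>x. (of_bool x - p)\<^sup>2"] by (simp add: power2_eq_square algebra_simps)
    also have "\<dots> \<le> p * 1" using p by (intro mult_left_mono) auto
    finally show ?thesis by simp
  qed
qed (use p in auto)

lemma graph_event: "{\<omega>\<in>space M. graph \<omega> = Q} \<in> events" if "Q \<subseteq> edges n"
proof -
  have "{\<omega>\<in>space M. graph \<omega> = Q} = {\<omega>\<in>space M. \<forall>e\<in>edges n. A e \<omega> = (e \<in> Q)}"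
    using that by (auto simp: graph_def)
  also have "\<dots> \<in> events"
  proof (rule sets.sets_Collect_finite_All)
    fix e assume e: "e \<in> edges n"
    have "A e -` {e \<in> Q} \<inter> space M \<in> events"
      using measurable_A[OF e] by (rule measurable_sets) simp
    also have "A e -` {e \<in> Q} \<inter> space M = {\<omega>\<in>space M. A e \<omega> = (e \<in> Q)}" by auto
    finally show "{\<omega>\<in>space M. A e \<omega> = (e \<in> Q)} \<in> events" .
  qed (rule finite_edges)
  finally show ?thesis .
qed

lemma graph_pred_event: "{\<omega>\<in>space M. P (graph \<omega>)} \<in> events"
proof -
  have "{\<omega>\<in>space M. P (graph \<omega>)} = (\<Union>Q\<in>{Q\<in>Pow (edges n). P Q}. {\<omega>\<in>space M. graph \<omega> = Q})"
    by (auto simp: graph_def)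
  also have "\<dots> \<in> events"
    by (intro sets.finite_UN graph_event) (auto simp: finite_edges)
  finally show ?thesis .
qed

lemma measurable_noise[measurable]: "noise \<in> measurable M (\<Pi>\<^sub>M e\<in>edges n. borel)"
  unfolding noise_def[abs_def] by (intro measurable_restrict measurable_W)

lemma graph_noise_indep:
  assumes Q: "Q \<subseteq> edges n" and S: "S \<in> sets (\<Pi>\<^sub>M e\<in>edges n. borel)"
  shows "prob ({\<omega>\<in>space M. graph \<omega> = Q} \<inter> {\<omega>\<in>space M. noise \<omega> \<in> S})
    = prob {\<omega>\<in>space M. graph \<omega> = Q} * prob {\<omega>\<in>space M. noise \<omega> \<in> S}"
proof -
  let ?E = "edges n"
  let ?X = "case_sum (\<lambda>e \<omega>. of_bool (A e \<omega>)) W"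
  \<comment> \<open>Graph and noise are the restrictions of one independent family to disjoint index sets.\<close>
  define K where "K b = (if b then Inl ` ?E else Inr ` ?E)" for b
  define R where "R b \<omega> = restrict (\<lambda>i. ?X i \<omega>) (K b)" for b \<omega>
  have ind: "indep_vars (\<lambda>b. \<Pi>\<^sub>M i\<in>K b. borel) R UNIV"
    unfolding R_def by (rule indep_vars_restrict[OF indep_A_W])
      (auto simp: K_def disjoint_family_on_def)
  define T where "T b = (if b then {x \<in> space (\<Pi>\<^sub>M i\<in>K True. borel). \<forall>e\<in>?E. x (Inl e) = of_bool (e \<in> Q)}
     else (\<lambda>x. \<lambda>e\<in>?E. x (Inr e)) -` S \<inter> space (\<Pi>\<^sub>M i\<in>K False. borel))" for b
  have T: "T b \<in> sets (\<Pi>\<^sub>M i\<in>K b. borel)" for b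
  proof (cases b)
    case True
    have "{x \<in> space (\<Pi>\<^sub>M i\<in>K True. borel). x (Inl e) = (of_bool (e \<in> Q) :: complex)} \<in> sets (\<Pi>\<^sub>M i\<in>K True. borel)" if "e \<in> ?E" for e
    proof -
      have "(\<lambda>x. x (Inl e)) \<in> measurable (\<Pi>\<^sub>M i\<in>K True. borel :: complex measure) borel"
        by (rule measurable_component_singleton) (use that in \<open>auto simp: K_def\<close>)
      then have "(\<lambda>x. x (Inl e)) -` {of_bool (e \<in> Q)} \<inter> space (\<Pi>\<^sub>M i\<in>K True. borel :: complex measure) \<in> sets (\<Pi>\<^sub>M i\<in>K True. borel)"
        by (rule measurable_sets) simp
      also have "(\<lambda>x. x (Inl e)) -` {of_bool (e \<in> Q)} \<inter> space (\<Pi>\<^sub>M i\<in>K True. borel :: complex measure) = {x \<in> space (\<Pi>\<^sub>M i\<in>K True. borel). x (Inl e) = (of_bool (e \<in> Q) :: complex)}"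
        by auto
      finally show ?thesis .
    qed
    then show ?thesis using True unfolding T_def
      by (simp only: if_True) (rule sets.sets_Collect_finite_All[OF _ finite_edges])
  next
    case False
    have "(\<lambda>x. \<lambda>e\<in>?E. x (Inr e)) \<in> measurable (\<Pi>\<^sub>M i\<in>K False. borel :: complex measure) (\<Pi>\<^sub>M e\<in>?E. borel)"
      by (intro measurable_restrict measurable_component_singleton) (auto simp: K_def)
    from measurable_sets[OF this S] show ?thesis using False by (simp add: T_def)
  qed
  have eqT: "R True -` T True \<inter> space M = {\<omega>\<in>space M. graph \<omega> = Q}"
    using Q by (auto simp: T_def R_def K_def space_PiM graph_def)
  have eqF: "R False -` T False \<inter> space M = {\<omega>\<in>space M. noise \<omega> \<in> S}"
  proof -
    have "(\<lambda>e\<in>?E. R False \<omega> (Inr e)) = noise \<omega>" for \<omega>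
      by (auto simp: R_def K_def noise_def)
    moreover have "R False \<omega> \<in> space (\<Pi>\<^sub>M i\<in>K False. borel)" for \<omega>
      by (auto simp: R_def space_PiM)
    ultimately show ?thesis by (auto simp: T_def)
  qed
  have "prob (\<Inter>b\<in>UNIV. R b -` T b \<inter> space M) = (\<Prod>b\<in>UNIV. prob (R b -` T b \<inter> space M))"
    by (rule indep_varsD[OF ind]) (auto intro: T)
  then have "prob (R True -` T True \<inter> space M \<inter> (R False -` T False \<inter> space M))
      = prob (R True -` T True \<inter> space M) * prob (R False -` T False \<inter> space M)"
    by (simp add: UNIV_bool Int_commute mult.commute)
  then show ?thesis unfolding eqT eqF .
qed

text \<open>
  Summing over the finitely many good graphs, a bound that holds for each of them carries over to the
  random graph.
\<close>

lemma prob_given_graph: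
  assumes bad_sets: "\<And>Q. Q \<subseteq> edges n \<Longrightarrow> good Q \<Longrightarrow> {w \<in> space (\<Pi>\<^sub>M e\<in>edges n. borel). bad Q w} \<in> sets (\<Pi>\<^sub>M e\<in>edges n. borel)"
    and bad: "\<And>Q. Q \<subseteq> edges n \<Longrightarrow> good Q \<Longrightarrow> prob {\<omega>\<in>space M. bad Q (noise \<omega>)} \<le> \<beta>" and \<beta>: "0 \<le> \<beta>"
  shows "{\<omega>\<in>space M. good (graph \<omega>) \<longrightarrow> bad (graph \<omega>) (noise \<omega>)} \<in> events"
    and "prob {\<omega>\<in>space M. good (graph \<omega>) \<longrightarrow> bad (graph \<omega>) (noise \<omega>)} \<le> prob {\<omega>\<in>space M. \<not> good (graph \<omega>)} + \<beta>"
proof -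
  let ?G = "{Q\<in>Pow (edges n). good Q}"
  define S where "S Q = {w \<in> space (\<Pi>\<^sub>M e\<in>edges n. borel). bad Q w}" for Q
  let ?F = "\<lambda>Q. {\<omega>\<in>space M. graph \<omega> = Q}"
  let ?N = "\<lambda>Q. {\<omega>\<in>space M. noise \<omega> \<in> S Q}"
  have finG: "finite ?G" using finite_edges by simp
  have noise_space: "noise \<omega> \<in> space (\<Pi>\<^sub>M e\<in>edges n. borel)" for \<omega> by (auto simp: noise_def space_PiM)
  have N_ev: "?N Q \<in> events" if "Q \<in> ?G" for Q
    using measurable_sets[OF measurable_noise bad_sets[of Q]] that unfolding S_def vimage_def
    by (auto simp: Int_def conj_commute)
  have N_eq: "?N Q = {\<omega>\<in>space M. bad Q (noise \<omega>)}" for Q using noise_space by (auto simp: S_def)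
  have ev: "?F Q \<inter> ?N Q \<in> events" if "Q \<in> ?G" for Q
    using graph_event[of Q] N_ev[OF that] that by auto
  have eq: "{\<omega>\<in>space M. good (graph \<omega>) \<longrightarrow> bad (graph \<omega>) (noise \<omega>)} = {\<omega>\<in>space M. \<not> good (graph \<omega>)} \<union> (\<Union>Q\<in>?G. ?F Q \<inter> ?N Q)"
    using noise_space by (auto simp: S_def graph_def)
  show "{\<omega>\<in>space M. good (graph \<omega>) \<longrightarrow> bad (graph \<omega>) (noise \<omega>)} \<in> events"
    unfolding eq by (rule sets.Un[OF graph_pred_event sets.finite_UN[OF finG ev]])
  have "prob (\<Union>Q\<in>?G. ?F Q \<inter> ?N Q) \<le> (\<Sum>Q\<in>?G. prob (?F Q \<inter> ?N Q))"
    by (rule measure_UNION_le[OF finG ev])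
  also have "\<dots> \<le> (\<Sum>Q\<in>?G. prob (?F Q) * \<beta>)"
  proof (rule sum_mono)
    fix Q assume Q: "Q \<in> ?G"
    have "prob (?F Q \<inter> ?N Q) = prob (?F Q) * prob (?N Q)"
      unfolding S_def by (rule graph_noise_indep) (use Q bad_sets in auto)
    also have "\<dots> \<le> prob (?F Q) * \<beta>"
      unfolding N_eq using bad[of Q] Q by (intro mult_left_mono) auto
    finally show "prob (?F Q \<inter> ?N Q) \<le> prob (?F Q) * \<beta>" .
  qed
  also have "\<dots> = prob (\<Union>Q\<in>?G. ?F Q) * \<beta>"
    unfolding sum_distrib_right[symmetric]
    by (subst finite_measure_finite_Union[OF finG]) (auto simp: disjoint_family_on_def intro: graph_event)
  finally have le: "prob (\<Union>Q\<in>?G. ?F Q \<inter> ?N Q) \<le> prob (\<Union>Q\<in>?G. ?F Q) * \<beta>" .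
  have "prob (\<Union>Q\<in>?G. ?F Q) * \<beta> \<le> 1 * \<beta>"
    using \<beta> by (intro mult_right_mono prob_le_1)
  moreover have "prob ({\<omega>\<in>space M. \<not> good (graph \<omega>)} \<union> (\<Union>Q\<in>?G. ?F Q \<inter> ?N Q))
      \<le> prob {\<omega>\<in>space M. \<not> good (graph \<omega>)} + prob (\<Union>Q\<in>?G. ?F Q \<inter> ?N Q)"
    by (rule measure_Un_le[OF graph_pred_event sets.finite_UN[OF finG ev]])
  ultimately show "prob {\<omega>\<in>space M. good (graph \<omega>) \<longrightarrow> bad (graph \<omega>) (noise \<omega>)} \<le> prob {\<omega>\<in>space M. \<not> good (graph \<omega>)} + \<beta>"
    unfolding eq using le by linarith
qed

end

section \<open>Noise on a fixed graph\<close>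

definition adj :: "(nat \<times> nat) set \<Rightarrow> nat \<Rightarrow> nat \<Rightarrow> real" where
  "adj Q = sym_matrix (\<lambda>e. of_bool (e \<in> Q))"

definition centered_adj :: "(nat \<times> nat) set \<Rightarrow> real \<Rightarrow> nat \<Rightarrow> nat \<Rightarrow> real" where
  "centered_adj Q p = sym_matrix (\<lambda>e. of_bool (e \<in> Q) - p)"

text \<open>
  The factors \<open>cnj (z' j) * z' k\<close> gauge the signal away: relative to \<open>z'\<close> the true signal is the constant
  vector \<open>1\<close>.
\<close>

definition noise_matrix :: "(nat \<Rightarrow> complex) \<Rightarrow> (nat \<times> nat) set \<Rightarrow> (nat \<times> nat \<Rightarrow> complex) \<Rightarrow> nat \<Rightarrow> nat \<Rightarrow> complex" where
  "noise_matrix z' Q w j k = (if (j, k) \<in> Q then w (j, k) * (cnj (z' j) * z' k)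
     else if (k, j) \<in> Q then cnj (w (k, j)) * (cnj (z' j) * z' k) else 0)"

lemma sum_over_edges:
  fixes F :: "nat \<Rightarrow> nat \<Rightarrow> 'b::comm_monoid_add"
  assumes Q: "Q \<subseteq> edges n" and F: "\<And>j k. (j, k) \<notin> Q \<Longrightarrow> (k, j) \<notin> Q \<Longrightarrow> F j k = 0"
  shows "(\<Sum>j=1..n. \<Sum>k=1..n. F j k) = (\<Sum>e\<in>Q. F (fst e) (snd e) + F (snd e) (fst e))"
proof -
  have fin: "finite Q" using Q finite_edges finite_subset by blast
  let ?R = "(\<lambda>e. (snd e, fst e)) ` Q"
  have "(\<Sum>j=1..n. \<Sum>k=1..n. F j k) = (\<Sum>e\<in>{1..n} \<times> {1..n}. F (fst e) (snd e))"
    by (simp add: sum.cartesian_product case_prod_unfold)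
  also have "\<dots> = (\<Sum>e\<in>Q \<union> ?R. F (fst e) (snd e))"
  proof (rule sum.mono_neutral_right)
    show "Q \<union> ?R \<subseteq> {1..n} \<times> {1..n}" using Q by (auto simp: edges_def)
    show "\<forall>i\<in>{1..n} \<times> {1..n} - (Q \<union> ?R). F (fst i) (snd i) = 0"
    proof (rule ballI)
      fix i assume i: "i \<in> {1..n} \<times> {1..n} - (Q \<union> ?R)"
      have "(snd i, fst i) \<notin> Q"
      proof
        assume "(snd i, fst i) \<in> Q"
        then have "(\<lambda>e. (snd e, fst e)) (snd i, fst i) \<in> ?R" by (rule imageI)
        then show False using i by simp
      qed
      then show "F (fst i) (snd i) = 0" using i by (intro F) auto
    qed
  qed auto
  also have "\<dots> = (\<Sum>e\<in>Q. F (fst e) (snd e)) + (\<Sum>e\<in>?R. F (fst e) (snd e))"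
  proof (rule sum.union_disjoint)
    have lt: "fst e < snd e" if "e \<in> Q" for e using that Q by (auto simp: edges_def)
    show "Q \<inter> ?R = {}"
    proof (rule equals0I)
      fix e assume "e \<in> Q \<inter> ?R"
      then obtain e' where "e \<in> Q" "e' \<in> Q" "e = (snd e', fst e')" by blast
      then show False using lt[of e] lt[of e'] by simp
    qed
  qed (use fin in auto)
  also have "(\<Sum>e\<in>?R. F (fst e) (snd e)) = (\<Sum>e\<in>Q. F (snd e) (fst e))"
    by (subst sum.reindex) (auto simp: inj_on_def prod_eq_iff)
  finally show ?thesis by (simp add: sum.distrib)
qed

lemma adj_eq:
  assumes "Q \<subseteq> edges n"
  shows "adj Q j k = of_bool ((j, k) \<in> Q \<or> (k, j) \<in> Q)"
  using assms by (auto simp: adj_def sym_matrix_def edges_def min_def max_def)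

lemma adj_centered: "adj Q j k = centered_adj Q p j k + p * of_bool (j \<noteq> k)"
  by (simp add: adj_def centered_adj_def sym_matrix_def)

lemma noise_matrix_measurable:
  assumes "Q \<subseteq> edges n"
  shows "(\<lambda>w. noise_matrix z' Q w j k) \<in> borel_measurable (\<Pi>\<^sub>M e\<in>edges n. borel)"
proof -
  have [measurable]: "cnj \<in> borel_measurable borel"
    by (intro borel_measurable_continuous_onI continuous_intros)
  consider "(j, k) \<in> Q" | "(j, k) \<notin> Q" "(k, j) \<in> Q" | "(j, k) \<notin> Q" "(k, j) \<notin> Q" by blast
  then show ?thesis
  proof cases
    case 1
    then have [measurable]: "(\<lambda>w. w (j, k)) \<in> borel_measurable (\<Pi>\<^sub>M e\<in>edges n. borel :: complex measure)"
      using assms by (intro measurable_component_singleton) auto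
    show ?thesis using 1 unfolding noise_matrix_def by simp
  next
    case 2
    then have [measurable]: "(\<lambda>w. w (k, j)) \<in> borel_measurable (\<Pi>\<^sub>M e\<in>edges n. borel :: complex measure)"
      using assms by (intro measurable_component_singleton) auto
    show ?thesis using 2 unfolding noise_matrix_def by simp
  qed (simp add: noise_matrix_def)
qed

lemma inverse_sqrt_bounds:
  fixes y :: real
  assumes "0 \<le> y" "y \<le> 1/2"
  shows "1 / sqrt (1 - y) \<le> exp (y / 2 + y\<^sup>2)" and "1 / sqrt (1 - y) \<le> exp y"
proof -
  have "- y - 2 * y\<^sup>2 \<le> ln (1 - y)" using ln_one_minus_pos_lower_bound assms by blast
  then have "exp (- y - 2 * y\<^sup>2) \<le> 1 - y" using assms by (subst (asm) ln_ge_iff) auto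
  moreover have "exp (- y - 2 * y\<^sup>2) = (exp (- (y / 2 + y\<^sup>2)))\<^sup>2"
    by (simp add: power2_eq_square exp_add[symmetric])
  ultimately have "exp (- (y / 2 + y\<^sup>2)) \<le> sqrt (1 - y)" by (simp add: real_le_rsqrt)
  then have "inverse (sqrt (1 - y)) \<le> inverse (exp (- (y / 2 + y\<^sup>2)))"
    by (rule le_imp_inverse_le) simp
  moreover have "inverse (exp (- (y / 2 + y\<^sup>2))) = exp (y / 2 + y\<^sup>2)"
    by (simp only: exp_minus inverse_inverse_eq)
  ultimately show 1: "1 / sqrt (1 - y) \<le> exp (y / 2 + y\<^sup>2)" by (simp only: inverse_eq_divide)
  have "y\<^sup>2 \<le> y * (1/2)" unfolding power2_eq_square using assms by (intro mult_left_mono) auto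
  then have "exp (y / 2 + y\<^sup>2) \<le> exp y" by simp
  with 1 show "1 / sqrt (1 - y) \<le> exp y" by linarith
qed

context synchronization_model
begin

lemma W_mgf:
  "e \<in> edges n \<Longrightarrow> (\<integral>\<^sup>+\<omega>. ennreal (exp (Re (c * W e \<omega>))) \<partial>M) = ennreal (exp ((cmod c)\<^sup>2 / 4))"
  by (rule complex_normal_mgf[OF distributed_Re_W distributed_Im_W indep_Re_Im_W])

lemma noise_matrix_rv[measurable]:
  assumes "Q \<subseteq> edges n"
  shows "(\<lambda>\<omega>. noise_matrix z' Q (noise \<omega>) j k) \<in> borel_measurable M"
  using measurable_compose[OF measurable_noise noise_matrix_measurable[OF assms]] .

text \<open>
  The coefficient of the variable at edge \<open>e\<close> in the real bilinear form that belongs to \<open>\<theta> * X\<close>. An edge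
  occurs twice, in conjugate positions of the Hermitian matrix \<open>X\<close>.
\<close>

definition edge_coeff :: "complex \<Rightarrow> (nat \<Rightarrow> real) \<Rightarrow> (nat \<Rightarrow> real) \<Rightarrow> nat \<times> nat \<Rightarrow> complex" where
  "edge_coeff \<theta> y x e = \<theta> * (y (fst e) * x (snd e)) + cnj \<theta> * (y (snd e) * x (fst e))"

lemma noise_form_mgf:
  assumes Q: "Q \<subseteq> edges n" and z': "z' \<in> unit_vecs n"
  shows "(\<integral>\<^sup>+\<omega>. ennreal (exp (\<Sum>j=1..n. y j * Re (\<theta> * (\<Sum>k=1..n. noise_matrix z' Q (noise \<omega>) j k * x k)))) \<partial>M)
    = ennreal (exp ((\<Sum>e\<in>Q. (cmod (edge_coeff \<theta> y x e))\<^sup>2) / 4))"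
proof -
  define c where "c e = edge_coeff \<theta> y x e * (cnj (z' (fst e)) * z' (snd e))" for e
  have fin: "finite Q" using Q finite_edges finite_subset by blast
  have z1: "cmod (z' j) = 1" if "1 \<le> j" "j \<le> n" for j using z' that by (auto simp: unit_vecs_def PiE_def Pi_def)
  have eq: "(\<Sum>j=1..n. y j * Re (\<theta> * (\<Sum>k=1..n. noise_matrix z' Q (noise \<omega>) j k * x k))) = (\<Sum>e\<in>Q. Re (c e * W e \<omega>))" for \<omega>
  proof -
    let ?X = "noise_matrix z' Q (noise \<omega>)"
    have "(\<Sum>j=1..n. y j * Re (\<theta> * (\<Sum>k=1..n. ?X j k * x k))) = (\<Sum>j=1..n. \<Sum>k=1..n. Re (\<theta> * ?X j k) * (y j * x k))"
      by (simp add: sum_distrib_left mult_ac del: times_complex.sel) (simp add: algebra_simps)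
    also have "\<dots> = (\<Sum>e\<in>Q. Re (\<theta> * ?X (fst e) (snd e)) * (y (fst e) * x (snd e)) + Re (\<theta> * ?X (snd e) (fst e)) * (y (snd e) * x (fst e)))"
      by (rule sum_over_edges[OF Q]) (simp add: noise_matrix_def)
    also have "\<dots> = (\<Sum>e\<in>Q. Re (c e * W e \<omega>))"
    proof (rule sum.cong[OF refl])
      fix e assume e: "e \<in> Q"
      obtain j k where jk: "e = (j, k)" by (cases e)
      have eE: "e \<in> edges n" using Q e by blast
      then have "(k, j) \<notin> edges n" using jk by (simp add: edges_def)
      then have "(k, j) \<notin> Q" using Q by blast
      then have X: "?X j k = W e \<omega> * (cnj (z' j) * z' k)" "?X k j = cnj (W e \<omega> * (cnj (z' j) * z' k))"
        using e eE jk by (auto simp: noise_matrix_def noise_def)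
      define V where "V = W e \<omega> * (cnj (z' j) * z' k)"
      have "Re (c e * W e \<omega>) = Re (edge_coeff \<theta> y x e * V)"
        by (simp add: c_def V_def jk mult_ac del: times_complex.sel)
      also have "\<dots> = Re (\<theta> * V) * (y j * x k) + Re (\<theta> * cnj V) * (y k * x j)"
        by (simp add: edge_coeff_def jk algebra_simps)
      finally show "Re (\<theta> * ?X (fst e) (snd e)) * (y (fst e) * x (snd e)) + Re (\<theta> * ?X (snd e) (fst e)) * (y (snd e) * x (fst e)) = Re (c e * W e \<omega>)"
        by (simp only: jk fst_conv snd_conv X V_def)
    qed
    finally show ?thesis .
  qed
  have "(\<integral>\<^sup>+\<omega>. ennreal (exp (\<Sum>e\<in>Q. Re (c e * W e \<omega>))) \<partial>M) = ennreal (exp ((\<Sum>e\<in>Q. (cmod (c e))\<^sup>2) / 4))"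
    by (rule complex_gaussian_linear_mgf[OF fin indep_vars_subset[OF indep_W Q] W_mgf]) (use Q in auto)
  also have "(\<Sum>e\<in>Q. (cmod (c e))\<^sup>2) = (\<Sum>e\<in>Q. (cmod (edge_coeff \<theta> y x e))\<^sup>2)"
  proof (rule sum.cong[OF refl])
    fix e assume "e \<in> Q"
    then have "cmod (z' (fst e)) = 1" "cmod (z' (snd e)) = 1" using Q z1 by (auto simp: edges_def)
    then show "(cmod (c e))\<^sup>2 = (cmod (edge_coeff \<theta> y x e))\<^sup>2" by (simp add: c_def norm_mult)
  qed
  finally show ?thesis by (simp only: eq)
qed

text \<open>
  By \<open>|a + b|\<^sup>2 \<le> 2 |a|\<^sup>2 + 2 |b|\<^sup>2\<close> the two occurrences of an edge decouple, and the exponent becomes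
  diagonal in \<open>y\<close>, as \<open>diagonal_subgaussian_square_mgf\<close> requires. The loss of a factor \<open>2\<close> is harmless
  wherever this is used.
\<close>

lemma noise_form_subgaussian:
  assumes Q: "Q \<subseteq> edges n" and z': "z' \<in> unit_vecs n" and \<theta>: "cmod \<theta> = 1"
  shows "(\<integral>\<^sup>+\<omega>. ennreal (exp (\<Sum>j=1..n. y j * Re (\<theta> * (\<Sum>k=1..n. noise_matrix z' Q (noise \<omega>) j k * x k)))) \<partial>M)
    \<le> ennreal (exp ((\<Sum>j=1..n. (y j)\<^sup>2 * (\<Sum>k=1..n. adj Q j k * (x k)\<^sup>2)) / 2))"
proof -
  have "(cmod (edge_coeff \<theta> y x e))\<^sup>2 \<le> 2 * ((y (fst e))\<^sup>2 * (x (snd e))\<^sup>2 + (y (snd e))\<^sup>2 * (x (fst e))\<^sup>2)" for e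
  proof -
    define a b where "a = \<bar>y (fst e) * x (snd e)\<bar>" and "b = \<bar>y (snd e) * x (fst e)\<bar>"
    have "cmod (edge_coeff \<theta> y x e) \<le> cmod (\<theta> * (y (fst e) * x (snd e))) + cmod (cnj \<theta> * (y (snd e) * x (fst e)))"
      unfolding edge_coeff_def by (rule norm_triangle_ineq)
    also have "\<dots> = a + b" using \<theta> by (simp add: norm_mult a_def b_def abs_mult)
    finally have "(cmod (edge_coeff \<theta> y x e))\<^sup>2 \<le> (a + b)\<^sup>2" by (intro power_mono) auto
    also have "\<dots> \<le> 2 * (a\<^sup>2 + b\<^sup>2)" using sum_squares_bound[of a b] by (simp add: power2_sum)
    finally show ?thesis by (simp add: a_def b_def power_mult_distrib)
  qed
  then have "(\<Sum>e\<in>Q. (cmod (edge_coeff \<theta> y x e))\<^sup>2) \<le> (\<Sum>e\<in>Q. 2 * ((y (fst e))\<^sup>2 * (x (snd e))\<^sup>2 + (y (snd e))\<^sup>2 * (x (fst e))\<^sup>2))"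
    by (intro sum_mono) auto
  also have "\<dots> = 2 * (\<Sum>e\<in>Q. adj Q (fst e) (snd e) * ((y (fst e))\<^sup>2 * (x (snd e))\<^sup>2) + adj Q (snd e) (fst e) * ((y (snd e))\<^sup>2 * (x (fst e))\<^sup>2))"
    unfolding sum_distrib_left by (intro sum.cong refl) (auto simp: adj_eq[OF Q])
  also have "\<dots> = 2 * (\<Sum>j=1..n. \<Sum>k=1..n. adj Q j k * ((y j)\<^sup>2 * (x k)\<^sup>2))"
    by (subst sum_over_edges[OF Q]) (auto simp: adj_eq[OF Q])
  also have "\<dots> = 2 * (\<Sum>j=1..n. (y j)\<^sup>2 * (\<Sum>k=1..n. adj Q j k * (x k)\<^sup>2))"
    by (simp add: sum_distrib_left mult_ac)
  finally show ?thesis unfolding noise_form_mgf[OF Q z'] by (intro ennreal_leI) simp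
qed

text \<open>
  The exponential moment is taken at \<open>1 / (4 D)\<close>. The proxy variances are at most \<open>D\<close> and sum to at most
  \<open>D\<close> times the squared norm of \<open>x\<close>.
\<close>

lemma noise_square_tail:
  assumes Q: "Q \<subseteq> edges n" and z': "z' \<in> unit_vecs n" and \<theta>: "cmod \<theta> = 1"
    and D: "0 < D" "\<And>j. j \<in> {1..n} \<Longrightarrow> (\<Sum>k=1..n. adj Q j k) \<le> D"
    and x: "\<And>k. k \<in> {1..n} \<Longrightarrow> (x k)\<^sup>2 \<le> 1"
  shows "prob {\<omega>\<in>space M. T \<le> (\<Sum>j=1..n. (Re (\<theta> * (\<Sum>k=1..n. noise_matrix z' Q (noise \<omega>) j k * x k)))\<^sup>2)}
     \<le> exp ((\<Sum>k=1..n. (x k)\<^sup>2) / 2 - T / (4 * D))"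
proof -
  define g where "g j \<omega> = Re (\<theta> * (\<Sum>k=1..n. noise_matrix z' Q (noise \<omega>) j k * x k))" for j \<omega>
  define v where "v j = (\<Sum>k=1..n. adj Q j k * (x k)\<^sup>2)" for j
  have adj0: "0 \<le> adj Q j k" for j k by (simp add: adj_eq[OF Q])
  have [measurable]: "g j \<in> borel_measurable M" for j
    unfolding g_def[abs_def] using Q by measurable
  have v: "0 \<le> v j" "j \<in> {1..n} \<Longrightarrow> v j \<le> D" for j
  proof -
    show "0 \<le> v j" unfolding v_def by (intro sum_nonneg mult_nonneg_nonneg adj0) auto
    assume j: "j \<in> {1..n}"
    have "v j \<le> (\<Sum>k=1..n. adj Q j k)"
      unfolding v_def by (intro sum_mono mult_left_le x adj0) auto
    then show "v j \<le> D" using D(2)[OF j] by linarith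
  qed
  define lam where "lam = 1 / (4 * D)"
  have lam: "0 < lam" using D by (simp add: lam_def)
  have y: "0 \<le> 2 * lam * v j" "j \<in> {1..n} \<Longrightarrow> 2 * lam * v j \<le> 1/2" for j
    using v[of j] lam D by (auto simp: lam_def field_simps)
  have "(\<integral>\<^sup>+\<omega>. ennreal (exp (lam * (\<Sum>j\<in>{1..n}. (g j \<omega>)\<^sup>2))) \<partial>M) \<le> ennreal (\<Prod>j\<in>{1..n}. 1 / sqrt (1 - 2 * lam * v j))"
  proof (rule diagonal_subgaussian_square_mgf)
    fix yy :: "nat \<Rightarrow> real"
    show "(\<integral>\<^sup>+\<omega>. ennreal (exp (\<Sum>j\<in>{1..n}. yy j * g j \<omega>)) \<partial>M) \<le> ennreal (exp ((\<Sum>j\<in>{1..n}. (yy j)\<^sup>2 * v j) / 2))"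
      unfolding g_def v_def by (rule noise_form_subgaussian[OF Q z' \<theta>])
    show "2 * lam * v j < 1" if "j \<in> {1..n}" for j using y(2)[OF that] by linarith
  qed (use lam in auto)
  also have "\<dots> \<le> ennreal (exp ((\<Sum>k=1..n. (x k)\<^sup>2) / 2))"
  proof (rule ennreal_leI)
    have "(\<Prod>j\<in>{1..n}. 1 / sqrt (1 - 2 * lam * v j)) \<le> (\<Prod>j\<in>{1..n}. exp (2 * lam * v j))"
      by (intro prod_mono conjI inverse_sqrt_bounds y) (use y in \<open>fastforce intro: divide_nonneg_nonneg\<close>)
    also have "\<dots> = exp (2 * lam * (\<Sum>j=1..n. v j))" by (simp add: exp_sum sum_distrib_left)
    also have "(\<Sum>j=1..n. v j) = (\<Sum>k=1..n. (x k)\<^sup>2 * (\<Sum>j=1..n. adj Q k j))"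
      unfolding v_def by (subst sum.swap) (simp add: sum_distrib_left mult_ac adj_def sym_matrix_sym)
    also have "\<dots> \<le> (\<Sum>k=1..n. (x k)\<^sup>2 * D)"
      by (intro sum_mono mult_left_mono D) auto
    also have "\<dots> = D * (\<Sum>k=1..n. (x k)\<^sup>2)" by (simp add: sum_distrib_left mult.commute)
    finally have "(\<Prod>j\<in>{1..n}. 1 / sqrt (1 - 2 * lam * v j)) \<le> exp (2 * lam * (D * (\<Sum>k=1..n. (x k)\<^sup>2)))"
      using lam by (simp add: mult_left_mono)
    then show "(\<Prod>j\<in>{1..n}. 1 / sqrt (1 - 2 * lam * v j)) \<le> exp ((\<Sum>k=1..n. (x k)\<^sup>2) / 2)"
      using D by (simp add: lam_def)
  qed
  finally have "prob {\<omega>\<in>space M. T \<le> (\<Sum>j\<in>{1..n}. (g j \<omega>)\<^sup>2)} \<le> exp (- lam * T) * exp ((\<Sum>k=1..n. (x k)\<^sup>2) / 2)"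
    by (intro chernoff lam) auto
  also have "\<dots> = exp ((\<Sum>k=1..n. (x k)\<^sup>2) / 2 - T / (4 * D))"
    by (simp add: exp_add[symmetric] lam_def)
  finally show ?thesis by (simp add: g_def)
qed

text \<open>
  If a complex number has modulus at least \<open>r\<close>, then one of its products with \<open>1\<close>, \<open>-1\<close>, \<open>\<i>\<close>, \<open>-\<i>\<close> has real
  part at least \<open>r / sqrt 2\<close>.
\<close>

lemma noise_row_tail:
  assumes Q: "Q \<subseteq> edges n" and z': "z' \<in> unit_vecs n" and j: "j \<in> {1..n}" and r: "0 < r"
    and D: "0 < D" "(\<Sum>k=1..n. adj Q j k) \<le> D"
  shows "prob {\<omega>\<in>space M. r \<le> cmod (\<Sum>k=1..n. noise_matrix z' Q (noise \<omega>) j k)} \<le> 4 * exp (- r\<^sup>2 / (4 * D))"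
proof -
  define S where "S \<omega> = (\<Sum>k=1..n. noise_matrix z' Q (noise \<omega>) j k)" for \<omega>
  have [measurable]: "S \<in> borel_measurable M" unfolding S_def[abs_def] using Q by measurable
  define s where "s = r / sqrt 2"
  have s: "0 < s" "s\<^sup>2 = r\<^sup>2 / 2" using r by (auto simp: s_def power_divide)
  have tail: "prob {\<omega>\<in>space M. s \<le> Re (\<theta> * S \<omega>)} \<le> exp (- r\<^sup>2 / (4 * D))" if \<theta>: "cmod \<theta> = 1" for \<theta>
  proof -
    define t where "t = s / D"
    have t: "0 < t" using s D by (simp add: t_def)
    define y where "y i = (if i = j then t else 0)" for i
    have "(\<integral>\<^sup>+\<omega>. ennreal (exp (t * Re (\<theta> * S \<omega>))) \<partial>M) =
        (\<integral>\<^sup>+\<omega>. ennreal (exp (\<Sum>i=1..n. y i * Re (\<theta> * (\<Sum>k=1..n. noise_matrix z' Q (noise \<omega>) i k * (\<lambda>_. 1) k)))) \<partial>M)"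
    proof (rule nn_integral_cong)
      fix \<omega>
      have "(\<Sum>i=1..n. y i * Re (\<theta> * (\<Sum>k=1..n. noise_matrix z' Q (noise \<omega>) i k * (\<lambda>_. 1) k)))
        = (\<Sum>i=1..n. if i = j then t * Re (\<theta> * S \<omega>) else 0)"
        by (intro sum.cong refl) (simp add: y_def S_def)
      then show "ennreal (exp (t * Re (\<theta> * S \<omega>))) = ennreal (exp (\<Sum>i=1..n. y i * Re (\<theta> * (\<Sum>k=1..n. noise_matrix z' Q (noise \<omega>) i k * (\<lambda>_. 1) k))))"
        using j by simp
    qed
    also have "\<dots> \<le> ennreal (exp ((\<Sum>i=1..n. (y i)\<^sup>2 * (\<Sum>k=1..n. adj Q i k * ((\<lambda>_. 1) k)\<^sup>2)) / 2))"
      using noise_form_subgaussian[OF Q z' \<theta>, of y "\<lambda>_. 1"] by simp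
    also have "\<dots> \<le> ennreal (exp (t\<^sup>2 * D / 2))"
    proof (intro ennreal_leI exp_mono divide_right_mono)
      have "(\<Sum>i=1..n. (y i)\<^sup>2 * (\<Sum>k=1..n. adj Q i k * ((\<lambda>_. 1) k)\<^sup>2)) = (\<Sum>i=1..n. if i = j then t\<^sup>2 * (\<Sum>k=1..n. adj Q j k) else 0)"
        by (intro sum.cong refl) (simp add: y_def)
      also have "\<dots> \<le> t\<^sup>2 * D" using j D by (simp add: mult_left_mono)
      finally show "(\<Sum>i=1..n. (y i)\<^sup>2 * (\<Sum>k=1..n. adj Q i k * ((\<lambda>_. 1) k)\<^sup>2)) \<le> t\<^sup>2 * D" .
    qed simp
    finally have "prob {\<omega>\<in>space M. s \<le> Re (\<theta> * S \<omega>)} \<le> exp (- t * s) * exp (t\<^sup>2 * D / 2)"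
      by (intro chernoff t) auto
    also have "\<dots> = exp (- (s\<^sup>2 / (2 * D)))"
      unfolding exp_add[symmetric] t_def using D by (simp add: power2_eq_square field_simps)
    finally show ?thesis by (simp add: s field_simps)
  qed
  let ?A = "\<lambda>\<theta>. {\<omega>\<in>space M. s \<le> Re (\<theta> * S \<omega>)}"
  have ev: "?A \<theta> \<in> events" for \<theta> by measurable
  have "{\<omega>\<in>space M. r \<le> cmod (S \<omega>)} \<subseteq> (\<Union>\<theta>\<in>{1, -1, \<i>, -\<i>}. ?A \<theta>)"
  proof (rule subsetI, rule ccontr)
    fix \<omega> assume a: "\<omega> \<in> {\<omega>\<in>space M. r \<le> cmod (S \<omega>)}" and b: "\<omega> \<notin> (\<Union>\<theta>\<in>{1, -1, \<i>, -\<i>}. ?A \<theta>)"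
    have "\<bar>Re (S \<omega>)\<bar> < s" "\<bar>Im (S \<omega>)\<bar> < s" using a b by auto
    then have "(Re (S \<omega>))\<^sup>2 < s\<^sup>2" "(Im (S \<omega>))\<^sup>2 < s\<^sup>2" using power_strict_mono[of "\<bar>Re (S \<omega>)\<bar>" s 2] power_strict_mono[of "\<bar>Im (S \<omega>)\<bar>" s 2] by auto
    then have "(cmod (S \<omega>))\<^sup>2 < r\<^sup>2" using s by (simp add: cmod_power2)
    moreover have "r\<^sup>2 \<le> (cmod (S \<omega>))\<^sup>2" using a r by (intro power_mono) auto
    ultimately show False by linarith
  qed
  then have "prob {\<omega>\<in>space M. r \<le> cmod (S \<omega>)} \<le> prob (\<Union>\<theta>\<in>{1, -1, \<i>, -\<i>}. ?A \<theta>)"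
    by (rule finite_measure_mono) (intro sets.finite_UN ev; simp)
  also have "\<dots> \<le> (\<Sum>\<theta>\<in>{1, -1, \<i>, -\<i>}. prob (?A \<theta>))"
    by (rule measure_UNION_le) (use ev in auto)
  also have "\<dots> \<le> (\<Sum>\<theta>\<in>{1, -1, \<i>, -\<i>}. exp (- r\<^sup>2 / (4 * D)))"
    by (intro sum_mono tail) auto
  also have "\<dots> \<le> 4 * exp (- r\<^sup>2 / (4 * D))"
    by (simp add: complex_eq_iff)
  finally show ?thesis by (simp add: S_def)
qed

end

section \<open>The Laplacian, and a union bound over sign vectors\<close>

lemma degree_bound:
  assumes reg: "nearly_regular n p (centered_adj Q p)" and p: "0 \<le> p" and j: "j \<in> {1..n}"
  shows "(\<Sum>k=1..n. adj Q j k) \<le> n * p + 4 * sqrt (n * p * ln n)"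
proof -
  have "(\<Sum>k=1..n. adj Q j k) = (\<Sum>k=1..n. centered_adj Q p j k) + (\<Sum>k=1..n. p * of_bool (j \<noteq> k))"
    by (simp add: adj_centered[of Q _ _ p] sum.distrib)
  also have "(\<Sum>k=1..n. p * of_bool (j \<noteq> k)) \<le> (\<Sum>k=1..n. p)"
    using p by (intro sum_mono) auto
  also have "\<dots> = n * p" by simp
  finally have "(\<Sum>k=1..n. adj Q j k) \<le> (\<Sum>k=1..n. centered_adj Q p j k) + n * p" by simp
  moreover have "\<bar>\<Sum>k=1..n. centered_adj Q p j k\<bar> \<le> 4 * sqrt (n * p * ln n)"
    using reg j unfolding nearly_regular_def by blast
  ultimately show ?thesis by linarith
qed

text \<open>
  The Laplacian is \<open>D - A\<close> with \<open>A = B + p (J - I)\<close>, where \<open>D\<close> is the diagonal matrix of degrees and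
  \<open>J\<close> the all-ones matrix. The contribution \<open>-p J\<close> is negative, the degrees are at most \<open>n p\<close> up to lower order, and \<open>B\<close> is bounded by its
  operator norm. Compared with the trivial bound, twice the maximal degree, this gains the factor \<open>2\<close> on
  which the constant of the theorem depends.
\<close>

lemma laplacian_bound:
  assumes Q: "Q \<subseteq> edges n" and reg: "nearly_regular n p (centered_adj Q p)" and p: "0 \<le> p" "p \<le> 1"
  shows "(\<Sum>e\<in>Q. (y (fst e) - y (snd e))\<^sup>2) \<le> (n * p + 25 * sqrt (n * p * ln n) + 1) * (\<Sum>j=1..n. (y j)\<^sup>2)"
proof -
  define s where "s = sqrt (n * p * ln n)"
  define V where "V = (\<Sum>j=1..n. (y j)\<^sup>2)"
  define By where "By j = (\<Sum>k=1..n. centered_adj Q p j k * y k)" for j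
  have s0: "0 \<le> n * p * ln n" using p by (cases n) auto
  have s: "0 \<le> s" "s\<^sup>2 = n * p * ln n" using s0 by (auto simp: s_def)
  have V0: "0 \<le> V" unfolding V_def by (intro sum_nonneg) auto
  have "(\<Sum>e\<in>Q. (y (fst e) - y (snd e))\<^sup>2) =
     (\<Sum>e\<in>Q. adj Q (fst e) (snd e) * ((y (fst e))\<^sup>2 - y (fst e) * y (snd e)) + adj Q (snd e) (fst e) * ((y (snd e))\<^sup>2 - y (snd e) * y (fst e)))"
    by (intro sum.cong refl) (auto simp: adj_eq[OF Q] power2_eq_square algebra_simps)
  also have "\<dots> = (\<Sum>j=1..n. \<Sum>k=1..n. adj Q j k * ((y j)\<^sup>2 - y j * y k))"
    by (rule sum_over_edges[OF Q, symmetric]) (simp add: adj_eq[OF Q])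
  also have "\<dots> = (\<Sum>j=1..n. (y j)\<^sup>2 * (\<Sum>k=1..n. adj Q j k)) - (\<Sum>j=1..n. \<Sum>k=1..n. adj Q j k * (y j * y k))"
    by (simp add: right_diff_distrib sum_subtractf sum_distrib_left mult_ac)
  also have "(\<Sum>j=1..n. \<Sum>k=1..n. adj Q j k * (y j * y k)) = (\<Sum>j=1..n. y j * By j) + (\<Sum>j=1..n. \<Sum>k=1..n. p * of_bool (j \<noteq> k) * (y j * y k))"
    unfolding By_def by (simp add: adj_centered[of Q _ _ p] distrib_right distrib_left sum.distrib sum_distrib_left mult_ac)
  also have "(\<Sum>j=1..n. \<Sum>k=1..n. p * of_bool (j \<noteq> k) * (y j * y k)) = p * ((\<Sum>j=1..n. y j)\<^sup>2 - V)"
  proof -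
    have "(\<Sum>j=1..n. \<Sum>k=1..n. p * of_bool (j \<noteq> k) * (y j * y k)) = (\<Sum>j=1..n. \<Sum>k=1..n. p * (y j * y k) - (if k = j then p * (y j)\<^sup>2 else 0))"
      by (intro sum.cong refl) (auto simp: power2_eq_square)
    also have "\<dots> = p * ((\<Sum>j=1..n. y j)\<^sup>2 - V)"
    proof -
      have "p * (\<Sum>j=1..n. y j)\<^sup>2 = (\<Sum>j=1..n. \<Sum>k=1..n. p * (y j * y k))"
        unfolding power2_eq_square sum_product by (simp add: sum_distrib_left)
      moreover have "p * V = (\<Sum>j=1..n. p * (y j)\<^sup>2)" by (simp only: V_def sum_distrib_left)
      ultimately show ?thesis by (simp add: sum_subtractf right_diff_distrib)
    qed
    finally show ?thesis .
  qed
  finally have eq: "(\<Sum>e\<in>Q. (y (fst e) - y (snd e))\<^sup>2) =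
      (\<Sum>j=1..n. (y j)\<^sup>2 * (\<Sum>k=1..n. adj Q j k)) - ((\<Sum>j=1..n. y j * By j) + p * ((\<Sum>j=1..n. y j)\<^sup>2 - V))" .
  have d: "(\<Sum>j=1..n. (y j)\<^sup>2 * (\<Sum>k=1..n. adj Q j k)) \<le> (n * p + 4 * s) * V"
  proof -
    have "(\<Sum>j=1..n. (y j)\<^sup>2 * (\<Sum>k=1..n. adj Q j k)) \<le> (\<Sum>j=1..n. (y j)\<^sup>2 * (n * p + 4 * s))"
      unfolding s_def by (intro sum_mono mult_left_mono degree_bound[OF reg]) (use p in auto)
    also have "\<dots> = (n * p + 4 * s) * V" unfolding V_def sum_distrib_left by (simp only: mult.commute)
    finally show ?thesis .
  qed
  have "\<bar>\<Sum>j=1..n. y j * By j\<bar> \<le> 21 * s * V"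
  proof -
    have "(\<Sum>j=1..n. y j * By j)\<^sup>2 \<le> V * (\<Sum>j=1..n. (By j)\<^sup>2)"
      unfolding V_def by (rule Cauchy_Schwarz_ineq_sum)
    also have "\<dots> \<le> V * (432 * (n * p * ln n) * V)"
      using reg V0 unfolding By_def V_def nearly_regular_def by (intro mult_left_mono) auto
    also have "\<dots> = 432 * (s * V)\<^sup>2"
      by (simp only: power_mult_distrib s) (simp add: power2_eq_square)
    also have "\<dots> \<le> (21 * (s * V))\<^sup>2"
      unfolding power_mult_distrib[of 21] by (rule mult_right_mono) auto
    finally have "\<bar>\<Sum>j=1..n. y j * By j\<bar> \<le> \<bar>21 * (s * V)\<bar>" by (simp only: abs_le_square_iff)
    moreover have "0 \<le> 21 * (s * V)" using s V0 by simp
    ultimately show ?thesis by simp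
  qed
  moreover have "0 \<le> p * (\<Sum>j=1..n. y j)\<^sup>2" using p by simp
  moreover have "p * V \<le> 1 * V" using p V0 by (intro mult_right_mono)
  ultimately have "(\<Sum>e\<in>Q. (y (fst e) - y (snd e))\<^sup>2) \<le> (n * p + 4 * s) * V + 21 * s * V + V"
    unfolding eq right_diff_distrib using d by linarith
  also have "\<dots> = (n * p + 25 * s + 1) * V" by (simp add: algebra_simps)
  finally show ?thesis by (simp add: s_def V_def)
qed

text \<open>
  With \<open>r = s\<^bsup>-1/3\<^esup>\<close> this is \<open>ln r \<le> r - 1\<close>. It replaces the logarithm in the entropy of a subset of
  density \<open>s\<close> by a power.
\<close>

lemma sign_entropy:
  fixes s :: real
  assumes "0 < s" "s \<le> 1"
  shows "s * (2 - ln s) \<le> 3 * s powr (2/3)"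
proof -
  define r where "r = s powr (-1/3)"
  have r: "0 < r" using assms by (simp add: r_def)
  have "ln r = - ln s / 3" using assms by (simp add: r_def ln_powr)
  then have "2 - ln s = 2 + 3 * ln r" by simp
  also have "\<dots> \<le> 3 * r" using ln_le_minus_one[OF r] by simp
  finally have "s * (2 - ln s) \<le> s * (3 * r)" using assms by (intro mult_left_mono) auto
  also have "s * (3 * r) = 3 * (s powr 1 * s powr (-1/3))" using assms by (simp add: r_def)
  also have "s powr 1 * s powr (-1/3) = s powr (2/3)" by (simp only: powr_add[symmetric]) simp
  finally show ?thesis .
qed

definition sign_vectors :: "nat \<Rightarrow> (nat \<Rightarrow> real) set" where
  "sign_vectors n = {1..n} \<rightarrow>\<^sub>E {-1, 0, 1}"

definition supp_size :: "nat \<Rightarrow> (nat \<Rightarrow> real) \<Rightarrow> nat" where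
  "supp_size n x = card {k \<in> {1..n}. x k \<noteq> 0}"

lemma finite_sign_vectors: "finite (sign_vectors n)"
  unfolding sign_vectors_def by (intro finite_PiE) auto

lemma sum_sign_vectors_power:
  fixes t :: real
  shows "(\<Sum>x\<in>sign_vectors n. t ^ supp_size n x) = (1 + 2 * t) ^ n"
proof -
  have "(\<Sum>x\<in>sign_vectors n. t ^ supp_size n x) = (\<Sum>x\<in>sign_vectors n. \<Prod>k\<in>{1..n}. if x k = 0 then 1 else t)"
  proof (rule sum.cong[OF refl])
    fix x :: "nat \<Rightarrow> real"
    have "(\<Prod>k\<in>{1..n}. if x k = 0 then 1 else t) = (\<Prod>k\<in>{k\<in>{1..n}. x k \<noteq> 0}. t)"
      by (rule prod.mono_neutral_cong_right) auto
    then show "t ^ supp_size n x = (\<Prod>k\<in>{1..n}. if x k = 0 then 1 else t)"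
      by (simp add: supp_size_def)
  qed
  also have "\<dots> = (\<Prod>k\<in>{1..n}. \<Sum>e\<in>{-1, 0, 1 :: real}. if e = 0 then 1 else t)"
    unfolding sign_vectors_def by (rule prod_sum_PiE[symmetric]) auto
  finally show ?thesis by (simp add: add.commute)
qed

text \<open>
  Let \<open>h m\<close> be the bound for one vector of support size \<open>m\<close>. Vectors of a given support size need not be
  counted: \<open>h (supp_size n x)\<close> is one of the terms in the sum over \<open>m\<close> of \<open>h m s\<^bsup>-m\<^esup> s\<^bsup>supp_size n x\<^esup>\<close> with
  \<open>s = m/n\<close>, and summing the last power over all \<open>x\<close> gives \<open>(1 + 2 s)\<^sup>n\<close>.
\<close>

lemma sign_vector_union_bound:
  assumes n: "1 \<le> n"
  shows "(\<Sum>x\<in>{x\<in>sign_vectors n. supp_size n x \<noteq> 0}. exp (supp_size n x / 2 - 6 * (n * (supp_size n x / n) powr (2/3))))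
    \<le> n * exp (- (real n powr (1/3)))"
proof -
  define h where "h m = exp (real m / 2 - 6 * (n * (real m / n) powr (2/3)))" for m :: nat
  have bound: "h (supp_size n x) \<le> (\<Sum>m=1..n. h m / (real m / n) ^ m * (real m / n) ^ supp_size n x)"
    if "supp_size n x \<noteq> 0" for x
  proof -
    have "supp_size n x \<le> card {1..n}"
      unfolding supp_size_def by (rule card_mono) auto
    then have m: "supp_size n x \<in> {1..n}" using that by simp
    have "h (supp_size n x) = h (supp_size n x) / (real (supp_size n x) / n) ^ supp_size n x * (real (supp_size n x) / n) ^ supp_size n x"
      using that n by simp
    also have "\<dots> \<le> (\<Sum>m=1..n. h m / (real m / n) ^ m * (real m / n) ^ supp_size n x)"
      using member_le_sum[OF m, of "\<lambda>m. h m / (real m / n) ^ m * (real m / n) ^ supp_size n x"] by (simp add: h_def)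
    finally show ?thesis .
  qed
  have "(\<Sum>x\<in>{x\<in>sign_vectors n. supp_size n x \<noteq> 0}. h (supp_size n x))
     \<le> (\<Sum>x\<in>{x\<in>sign_vectors n. supp_size n x \<noteq> 0}. \<Sum>m=1..n. h m / (real m / n) ^ m * (real m / n) ^ supp_size n x)"
    by (intro sum_mono bound) auto
  also have "\<dots> \<le> (\<Sum>x\<in>sign_vectors n. \<Sum>m=1..n. h m / (real m / n) ^ m * (real m / n) ^ supp_size n x)"
    by (rule sum_mono2[OF finite_sign_vectors]) (auto intro!: sum_nonneg simp: h_def)
  also have "\<dots> = (\<Sum>m=1..n. h m / (real m / n) ^ m * (1 + 2 * (real m / n)) ^ n)"
    unfolding sum_sign_vectors_power[symmetric] sum_distrib_left by (rule sum.swap)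
  also have "\<dots> \<le> (\<Sum>m=1..n. exp (- (real n powr (1/3))))"
  proof (rule sum_mono)
    fix m assume m: "m \<in> {1..n}"
    define s where "s = real m / n"
    have s: "0 < s" "s \<le> 1" "real m = n * s" using m n by (auto simp: s_def)
    have ps: "s \<le> s powr (2/3)" using powr_mono'[of "2/3" 1 s] s by simp
    have "(1 + 2 * s) ^ n \<le> exp (2 * s) ^ n" using s by (intro power_mono exp_ge_add_one_self) auto
    also have "\<dots> = exp (n * (2 * s))" by (simp add: exp_of_nat_mult)
    finally have 1: "(1 + 2 * s) ^ n \<le> exp (n * (2 * s))" .
    have "s ^ m = exp (ln s) ^ m" using s by simp
    also have "\<dots> = exp (n * s * ln s)" using s(3) by (simp add: exp_of_nat_mult[symmetric])
    finally have 2: "s ^ m = exp (n * s * ln s)" .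
    have "h m / s ^ m * (1 + 2 * s) ^ n \<le> h m / s ^ m * exp (n * (2 * s))"
      using 1 s by (intro mult_left_mono) (auto simp: h_def)
    also have "\<dots> = exp (n * s / 2 - 6 * (n * s powr (2/3)) - n * s * ln s + n * (2 * s))"
      unfolding 2 h_def s(3)[symmetric] s_def[symmetric] exp_diff exp_add by simp
    also have "\<dots> \<le> exp (- (real n powr (1/3)))"
    proof (rule exp_mono)
      have "n * s / 2 - 6 * (n * s powr (2/3)) - n * s * ln s + n * (2 * s) = n * (s / 2 - 6 * s powr (2/3) + s * (2 - ln s))"
        by (simp add: algebra_simps)
      also have "\<dots> \<le> n * (- (s powr (2/3)))"
        using sign_entropy[OF s(1,2)] ps s by (intro mult_left_mono) auto
      also have "\<dots> \<le> n * (- ((1 / n) powr (2/3)))"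
        using m n by (intro mult_left_mono) (auto simp: s_def intro!: powr_mono2 divide_right_mono)
      also have "\<dots> = - (real n powr 1 * real n powr (- (2/3)))"
        using n by (simp add: powr_divide powr_minus_divide)
      also have "\<dots> = - (real n powr (1/3))" by (simp only: powr_add[symmetric]) simp
      finally show "n * s / 2 - 6 * (n * s powr (2/3)) - n * s * ln s + n * (2 * s) \<le> - (real n powr (1/3))" .
    qed
    finally show "h m / (real m / n) ^ m * (1 + 2 * (real m / n)) ^ n \<le> exp (- (real n powr (1/3)))"
      by (simp only: s_def)
  qed
  also have "\<dots> = n * exp (- (real n powr (1/3)))" by simp
  finally show ?thesis by (simp only: h_def)
qed

context synchronization_model
begin

text \<open>
  The moment parameter is of order \<open>\<delta>/d\<close>, small enough for the second-order term \<open>\<delta>\<^sup>2/16\<close> of the logarithm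
  to be dominated by the gain \<open>\<delta>\<^sup>2/8\<close> from the threshold.
\<close>

lemma noise_main_term_tail:
  fixes d \<delta> :: real
  assumes Q: "Q \<subseteq> edges n" and z': "z' \<in> unit_vecs n"
    and reg: "nearly_regular n p (centered_adj Q p)" and p: "0 < p" "p \<le> 1" and \<delta>: "0 < \<delta>" "\<delta> \<le> 1"
    and d: "d = n * p + 25 * sqrt (n * p * ln n) + 1"
  shows "prob {\<omega>\<in>space M. (1 + \<delta>) * n * d / 2 \<le> (\<Sum>j=1..n. (Im (\<Sum>k=1..n. noise_matrix z' Q (noise \<omega>) j k))\<^sup>2)} \<le> exp (- (n * \<delta>\<^sup>2 / 16))"
proof -
  define g where "g j \<omega> = Re (- \<i> * (\<Sum>k=1..n. noise_matrix z' Q (noise \<omega>) j k * (\<lambda>_. 1) k))" for j \<omega>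
  have [measurable]: "g j \<in> borel_measurable M" for j
    unfolding g_def[abs_def] using Q by measurable
  have "0 \<le> n * p * ln n" using p by (cases n) auto
  then have d1: "1 \<le> d" using p unfolding d by simp
  define lam where "lam = \<delta> / (4 * d)"
  have lam: "0 < lam" using d1 \<delta> by (simp add: lam_def)
  have lamd: "2 * lam * (d / 2) = \<delta> / 4" using d1 by (simp add: lam_def)
  have "(\<integral>\<^sup>+\<omega>. ennreal (exp (lam * (\<Sum>j\<in>{1..n}. (g j \<omega>)\<^sup>2))) \<partial>M) \<le> ennreal (\<Prod>j\<in>{1..n}. 1 / sqrt (1 - 2 * lam * (d / 2)))"
  proof (rule diagonal_subgaussian_square_mgf)
    fix y :: "nat \<Rightarrow> real"
    have "(\<integral>\<^sup>+\<omega>. ennreal (exp (\<Sum>j\<in>{1..n}. y j * g j \<omega>)) \<partial>M) = ennreal (exp ((\<Sum>e\<in>Q. (cmod (edge_coeff (- \<i>) y (\<lambda>_. 1) e))\<^sup>2) / 4))"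
      unfolding g_def using noise_form_mgf[OF Q z', of y "- \<i>" "\<lambda>_. 1"] by simp
    also have "(\<Sum>e\<in>Q. (cmod (edge_coeff (- \<i>) y (\<lambda>_. 1) e))\<^sup>2) = (\<Sum>e\<in>Q. (y (fst e) - y (snd e))\<^sup>2)"
      by (intro sum.cong refl) (simp add: edge_coeff_def cmod_power2 power2_commute)
    also have "ennreal (exp ((\<Sum>e\<in>Q. (y (fst e) - y (snd e))\<^sup>2) / 4)) \<le> ennreal (exp ((\<Sum>j\<in>{1..n}. (y j)\<^sup>2 * (d / 2)) / 2))"
    proof (intro ennreal_leI exp_mono)
      have "(\<Sum>e\<in>Q. (y (fst e) - y (snd e))\<^sup>2) \<le> d * (\<Sum>j\<in>{1..n}. (y j)\<^sup>2)"
        unfolding d by (rule laplacian_bound[OF Q reg]) (use p in auto)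
      then show "(\<Sum>e\<in>Q. (y (fst e) - y (snd e))\<^sup>2) / 4 \<le> (\<Sum>j\<in>{1..n}. (y j)\<^sup>2 * (d / 2)) / 2"
        unfolding sum_distrib_right[symmetric] by (simp add: mult.commute)
    qed
    finally show "(\<integral>\<^sup>+\<omega>. ennreal (exp (\<Sum>j\<in>{1..n}. y j * g j \<omega>)) \<partial>M) \<le> ennreal (exp ((\<Sum>j\<in>{1..n}. (y j)\<^sup>2 * (d / 2)) / 2))" .
  qed (use lam lamd \<delta> in auto)
  also have "\<dots> \<le> ennreal (exp (\<delta> / 8 + \<delta>\<^sup>2 / 16) ^ n)"
  proof (rule ennreal_leI)
    have "1 / sqrt (1 - \<delta> / 4) \<le> exp ((\<delta> / 4) / 2 + (\<delta> / 4)\<^sup>2)"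
      by (rule inverse_sqrt_bounds) (use \<delta> in auto)
    then have "(1 / sqrt (1 - \<delta> / 4)) ^ n \<le> exp (\<delta> / 8 + \<delta>\<^sup>2 / 16) ^ n"
      using \<delta> by (intro power_mono) (auto simp: power_divide)
    then show "(\<Prod>j\<in>{1..n}. 1 / sqrt (1 - 2 * lam * (d / 2))) \<le> exp (\<delta> / 8 + \<delta>\<^sup>2 / 16) ^ n"
      unfolding lamd by simp
  qed
  finally have "prob {\<omega>\<in>space M. (1 + \<delta>) * n * d / 2 \<le> (\<Sum>j\<in>{1..n}. (g j \<omega>)\<^sup>2)} \<le> exp (- lam * ((1 + \<delta>) * n * d / 2)) * exp (\<delta> / 8 + \<delta>\<^sup>2 / 16) ^ n"
    by (intro chernoff lam) auto
  also have "\<dots> = exp (- (n * (\<delta> * (1 + \<delta>) / 8)) + n * (\<delta> / 8 + \<delta>\<^sup>2 / 16))"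
    unfolding exp_of_nat_mult[symmetric] exp_add[symmetric] using d1 by (simp add: lam_def field_simps)
  also have "\<dots> = exp (- (n * \<delta>\<^sup>2 / 16))"
    by (simp add: power2_eq_square algebra_simps)
  finally show ?thesis by (simp add: g_def)
qed

end

section \<open>Simultaneous control of the noise\<close>

text \<open>
  The value \<open>\<theta> = 1\<close> selects real parts and \<open>\<theta> = -\<i>\<close> imaginary parts. The last conjunct counts the rows whose
  noise is too large for a first-order expansion of the normalization.
\<close>

definition noise_good :: "nat \<Rightarrow> real \<Rightarrow> real \<Rightarrow> real \<Rightarrow> real \<Rightarrow> (nat \<Rightarrow> nat \<Rightarrow> complex) \<Rightarrow> bool" where
  "noise_good n K V R c X \<longleftrightarrow>
     (\<forall>x\<in>sign_vectors n. \<forall>\<theta>\<in>{1, -\<i>}.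
        (\<Sum>j=1..n. (Re (\<theta> * (\<Sum>k=1..n. X j k * complex_of_real (x k))))\<^sup>2) \<le> K * (supp_size n x / n) powr (2/3)) \<and>
     (\<Sum>j=1..n. (Im (\<Sum>k=1..n. X j k))\<^sup>2) \<le> V \<and>
     (\<Sum>j=1..n. of_bool (R \<le> cmod (\<Sum>k=1..n. X j k))) \<le> c"

lemma noise_good_sets:
  assumes [measurable]: "\<And>j k. (\<lambda>\<omega>. X \<omega> j k) \<in> borel_measurable N"
  shows "{\<omega> \<in> space N. \<not> noise_good n K V R c (X \<omega>)} \<in> sets N"
proof -
  have A: "{\<omega> \<in> space N. (\<Sum>j=1..n. (Re (\<theta> * (\<Sum>k=1..n. X \<omega> j k * complex_of_real (x k))))\<^sup>2) \<le> K * (supp_size n x / n) powr (2/3)} \<in> sets N"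
    for x \<theta> by measurable
  have B: "{\<omega> \<in> space N. (\<Sum>j=1..n. (Im (\<Sum>k=1..n. X \<omega> j k))\<^sup>2) \<le> V} \<in> sets N"
    by measurable
  have C: "{\<omega> \<in> space N. (\<Sum>j=1..n. of_bool (R \<le> cmod (\<Sum>k=1..n. X \<omega> j k))) \<le> c} \<in> sets N"
    by measurable
  have "{\<omega> \<in> space N. noise_good n K V R c (X \<omega>)} \<in> sets N"
    unfolding noise_good_def
    by (intro sets.sets_Collect_conj sets.sets_Collect_finite_All finite_sign_vectors A B C finite.intros)
  then have "space N - {\<omega> \<in> space N. noise_good n K V R c (X \<omega>)} \<in> sets N" by (rule sets.compl_sets)
  also have "space N - {\<omega> \<in> space N. noise_good n K V R c (X \<omega>)} = {\<omega> \<in> space N. \<not> noise_good n K V R c (X \<omega>)}" by auto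
  finally show ?thesis .
qed

context synchronization_model
begin

text \<open>
  With \<open>D = 2 n p\<close> as a bound on the degrees, the threshold \<open>48 n\<^sup>2 p (m/n)\<^bsup>2/3\<^esup>\<close> makes the exponent of
  \<open>noise_square_tail\<close> equal to the one in \<open>sign_vector_union_bound\<close>.
\<close>

lemma noise_good_whp:
  fixes \<delta> R c :: real
  assumes Q: "Q \<subseteq> edges n" and z': "z' \<in> unit_vecs n"
    and reg: "nearly_regular n p (centered_adj Q p)" and p: "0 < p" "p \<le> 1" and \<delta>: "0 < \<delta>" "\<delta> \<le> 1"
    and n: "1 \<le> n" "16 * ln n \<le> n * p" and R: "0 < R" and c: "0 < c"
  shows "prob {\<omega>\<in>space M. \<not> noise_good n (48 * (n * p) * n) ((1 + \<delta>) * n * (n * p + 25 * sqrt (n * p * ln n) + 1) / 2) R c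
             (noise_matrix z' Q (noise \<omega>))}
     \<le> 2 * n * exp (- (real n powr (1/3))) + exp (- (n * \<delta>\<^sup>2 / 16)) + 4 * n * exp (- (R\<^sup>2 / (8 * (n * p)))) / c"
proof -
  let ?X = "\<lambda>\<omega>. noise_matrix z' Q (noise \<omega>)"
  define K where "K = 48 * (real n * p) * n"
  define V where "V = (1 + \<delta>) * n * (n * p + 25 * sqrt (n * p * ln n) + 1) / 2"
  define D where "D = 2 * (real n * p)"
  have np: "0 < real n * p" using n p by simp
  then have D0: "0 < D" by (simp add: D_def)
  have deg: "(\<Sum>k=1..n. adj Q j k) \<le> D" if "j \<in> {1..n}" for j
  proof -
    have "4 * sqrt (n * p * ln n) = sqrt (n * p * (16 * ln n))" by (simp add: real_sqrt_mult)
    also have "\<dots> \<le> sqrt ((n * p) * (n * p))" using n np by (intro real_sqrt_le_mono mult_left_mono) auto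
    also have "\<dots> = n * p" using np by simp
    finally show ?thesis using degree_bound[OF reg _ that] p unfolding D_def by linarith
  qed
  let ?SV = "{x\<in>sign_vectors n. supp_size n x \<noteq> 0}"
  define T where "T x = K * (supp_size n x / n) powr (2/3)" for x
  define B1 where "B1 i = {\<omega>\<in>space M. T (fst i) \<le> (\<Sum>j=1..n. (Re (snd i * (\<Sum>k=1..n. ?X \<omega> j k * fst i k)))\<^sup>2)}" for i
  define B2 where "B2 = {\<omega>\<in>space M. V \<le> (\<Sum>j=1..n. (Im (\<Sum>k=1..n. ?X \<omega> j k))\<^sup>2)}"
  define cnt where "cnt \<omega> = (\<Sum>j=1..n. of_bool (R \<le> cmod (\<Sum>k=1..n. ?X \<omega> j k)) :: real)" for \<omega>
  define B3 where "B3 = {\<omega>\<in>space M. c \<le> cnt \<omega>}"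
  note [measurable] = noise_matrix_rv[OF Q]
  have ev: "B1 i \<in> events" "B2 \<in> events" "B3 \<in> events" for i
    unfolding B1_def B2_def B3_def cnt_def by measurable
  let ?I = "?SV \<times> {1, -\<i>}"
  have finI: "finite ?I" using finite_sign_vectors by auto
  have sub: "{\<omega>\<in>space M. \<not> noise_good n K V R c (?X \<omega>)} \<subseteq> (\<Union>i\<in>?I. B1 i) \<union> B2 \<union> B3"
  proof (rule subsetI, rule ccontr)
    fix \<omega> assume a: "\<omega> \<in> {\<omega>\<in>space M. \<not> noise_good n K V R c (?X \<omega>)}" and b: "\<omega> \<notin> (\<Union>i\<in>?I. B1 i) \<union> B2 \<union> B3"
    have "(\<Sum>j=1..n. (Re (\<theta> * (\<Sum>k=1..n. ?X \<omega> j k * x k)))\<^sup>2) \<le> K * (supp_size n x / n) powr (2/3)"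
      if x: "x \<in> sign_vectors n" and \<theta>: "\<theta> \<in> {1, -\<i>}" for x \<theta>
    proof (cases "supp_size n x = 0")
      case True
      then have "x k = 0" if "k \<in> {1..n}" for k using that by (auto simp: supp_size_def)
      then have "(\<Sum>k=1..n. ?X \<omega> j k * x k) = 0" for j by (intro sum.neutral) auto
      then show ?thesis by (simp add: True)
    next
      case False
      then have "\<omega> \<notin> B1 (x, \<theta>)" using x \<theta> b by blast
      then show ?thesis using a unfolding B1_def T_def by auto
    qed
    then have "noise_good n K V R c (?X \<omega>)"
      using a b unfolding noise_good_def B2_def B3_def cnt_def by auto
    then show False using a by simp
  qed
  have P1: "prob (\<Union>i\<in>?I. B1 i) \<le> 2 * n * exp (- (real n powr (1/3)))"
  proof -
    have "prob (\<Union>i\<in>?I. B1 i) \<le> (\<Sum>i\<in>?I. prob (B1 i))"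
      by (rule measure_UNION_le[OF finI ev(1)])
    also have "\<dots> \<le> (\<Sum>i\<in>?I. exp (supp_size n (fst i) / 2 - 6 * (n * (supp_size n (fst i) / n) powr (2/3))))"
    proof (rule sum_mono)
      fix i assume i: "i \<in> ?I"
      let ?x = "fst i"
      have x: "?x k \<in> {-1, 0, 1}" if "k \<in> {1..n}" for k using i that by (auto simp: sign_vectors_def PiE_def Pi_def)
      have "(\<Sum>k=1..n. (?x k)\<^sup>2) = (\<Sum>k\<in>{k\<in>{1..n}. ?x k \<noteq> 0}. 1)"
        by (rule sum.mono_neutral_cong_right) (use x in fastforce)+
      then have sq: "(\<Sum>k=1..n. (?x k)\<^sup>2) = supp_size n ?x" by (simp add: supp_size_def)
      have "prob (B1 i) \<le> exp ((\<Sum>k=1..n. (?x k)\<^sup>2) / 2 - T ?x / (4 * D))"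
        unfolding B1_def
      proof (rule noise_square_tail[OF Q z' _ D0 deg])
        show "(?x k)\<^sup>2 \<le> 1" if "k \<in> {1..n}" for k using x[OF that] by auto
        show "cmod (snd i) = 1" using i by auto
      qed
      also have "T ?x / (4 * D) = 6 * (n * (supp_size n ?x / n) powr (2/3))"
        using np p by (simp add: T_def K_def D_def)
      finally show "prob (B1 i) \<le> exp (supp_size n ?x / 2 - 6 * (n * (supp_size n ?x / n) powr (2/3)))"
        by (simp only: sq)
    qed
    also have "\<dots> = (\<Sum>x\<in>?SV. \<Sum>\<theta>\<in>{1::complex, -\<i>}. exp (supp_size n x / 2 - 6 * (n * (supp_size n x / n) powr (2/3))))"
      by (simp only: sum.cartesian_product case_prod_unfold)
    also have "\<dots> = 2 * (\<Sum>x\<in>?SV. exp (supp_size n x / 2 - 6 * (n * (supp_size n x / n) powr (2/3))))"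
    proof -
      have "(1::complex) \<noteq> -\<i>" by (simp add: complex_eq_iff)
      then show ?thesis by (simp add: sum_distrib_left)
    qed
    also have "\<dots> \<le> 2 * (n * exp (- (real n powr (1/3))))"
      using sign_vector_union_bound[OF n(1)] by (rule mult_left_mono) simp
    finally show ?thesis by simp
  qed
  have P2: "prob B2 \<le> exp (- (n * \<delta>\<^sup>2 / 16))"
    unfolding B2_def V_def by (rule noise_main_term_tail[OF Q z' reg p \<delta> refl])
  have P3: "prob B3 \<le> 4 * n * exp (- (R\<^sup>2 / (8 * (n * p)))) / c"
  proof -
    have ev3: "{\<omega>\<in>space M. R \<le> cmod (\<Sum>k=1..n. ?X \<omega> j k)} \<in> events" for j by measurable
    have cnt_eq: "cnt \<omega> = (\<Sum>j=1..n. indicator {\<omega>\<in>space M. R \<le> cmod (\<Sum>k=1..n. ?X \<omega> j k)} \<omega>)" if "\<omega> \<in> space M" for \<omega>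
      unfolding cnt_def using that by (intro sum.cong refl) (auto simp: indicator_def)
    have int: "integrable M cnt"
      by (subst Bochner_Integration.integrable_cong[OF refl cnt_eq])
         (auto intro!: Bochner_Integration.integrable_sum integrable_real_indicator ev3 simp: emeasure_eq_measure)
    have "prob B3 \<le> expectation cnt / c"
      unfolding B3_def by (rule integral_Markov_inequality_measure[OF int sets.empty_sets])
        (use c in \<open>auto simp: cnt_def intro!: sum_nonneg\<close>)
    also have "expectation cnt = (\<Sum>j=1..n. prob {\<omega>\<in>space M. R \<le> cmod (\<Sum>k=1..n. ?X \<omega> j k)})"
      by (subst Bochner_Integration.integral_cong[OF refl cnt_eq])
         (auto intro!: Bochner_Integration.integral_sum[THEN trans] integrable_real_indicator ev3 simp: emeasure_eq_measure)
    also have "\<dots> \<le> (\<Sum>j=1..n. 4 * exp (- R\<^sup>2 / (4 * D)))"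
      by (intro sum_mono noise_row_tail[OF Q z' _ R D0 deg])
    also have "\<dots> = 4 * n * exp (- (R\<^sup>2 / (8 * (n * p))))" by (simp add: D_def)
    finally show ?thesis using c by (simp add: divide_right_mono)
  qed
  have "prob {\<omega>\<in>space M. \<not> noise_good n K V R c (?X \<omega>)} \<le> prob ((\<Union>i\<in>?I. B1 i) \<union> B2 \<union> B3)"
    by (rule finite_measure_mono[OF sub]) (intro sets.Un sets.finite_UN finI ev)
  moreover have "prob ((\<Union>i\<in>?I. B1 i) \<union> B2 \<union> B3) \<le> prob ((\<Union>i\<in>?I. B1 i) \<union> B2) + prob B3"
    by (rule measure_Un_le) (intro sets.Un sets.finite_UN finI ev)+
  moreover have "prob ((\<Union>i\<in>?I. B1 i) \<union> B2) \<le> prob (\<Union>i\<in>?I. B1 i) + prob B2"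
    by (rule measure_Un_le) (intro sets.Un sets.finite_UN finI ev)+
  ultimately have "prob {\<omega>\<in>space M. \<not> noise_good n K V R c (?X \<omega>)}
      \<le> 2 * n * exp (- (real n powr (1/3))) + exp (- (n * \<delta>\<^sup>2 / 16)) + 4 * n * exp (- (R\<^sup>2 / (8 * (n * p)))) / c"
    using P1 P2 P3 by linarith
  then show ?thesis unfolding K_def V_def .
qed

end

section \<open>From sign vectors to bounded vectors\<close>

lemma binary_digits_sum:
  fixes u :: real
  assumes "0 \<le> u" "u < 1"
  shows "(\<Sum>i=1..m. real_of_int (\<lfloor>2 ^ i * u\<rfloor> mod 2) / 2 ^ i) = \<lfloor>2 ^ m * u\<rfloor> / 2 ^ m"
proof (induction m)
  case 0
  then show ?case using assms by (simp add: floor_eq_iff)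
next
  case (Suc m)
  have "\<lfloor>2 ^ Suc m * u\<rfloor> div 2 = \<lfloor>2 ^ m * u\<rfloor>"
    using floor_divide_real_eq_div[of 2 "2 ^ Suc m * u"] by simp
  then have "\<lfloor>2 ^ Suc m * u\<rfloor> = 2 * \<lfloor>2 ^ m * u\<rfloor> + \<lfloor>2 ^ Suc m * u\<rfloor> mod 2"
    using div_mult_mod_eq[of "\<lfloor>2 ^ Suc m * u\<rfloor>" 2] by simp
  then have "real_of_int \<lfloor>2 ^ Suc m * u\<rfloor> = 2 * real_of_int \<lfloor>2 ^ m * u\<rfloor> + real_of_int (\<lfloor>2 ^ Suc m * u\<rfloor> mod 2)"
    by linarith
  then show ?case using Suc.IH by (simp add: field_simps)
qed

lemma L2_set_sum_le:
  assumes "finite A"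
  shows "L2_set (\<lambda>j. \<Sum>i\<in>A. f i j) J \<le> (\<Sum>i\<in>A. L2_set (f i) J)"
  using assms
proof (induction A rule: finite_induct)
  case (insert a A)
  have "L2_set (\<lambda>j. \<Sum>i\<in>insert a A. f i j) J = L2_set (\<lambda>j. f a j + (\<Sum>i\<in>A. f i j)) J"
    using insert by simp
  also have "\<dots> \<le> L2_set (f a) J + L2_set (\<lambda>j. \<Sum>i\<in>A. f i j) J" by (rule L2_set_triangle_ineq)
  finally show ?case using insert by simp
qed (simp add: L2_set_def)

lemma geometric_cube_root: "(\<Sum>i=1..m. (1/2) ^ i * (4 ^ i) powr (1/3)) \<le> (4::real)"
proof -
  define r :: real where "r = 2 powr (-1/3)"
  have r: "0 < r" by (simp add: r_def)
  have "(1/2) ^ i * (4 ^ i) powr (1/3) = r ^ i" for i :: nat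
  proof -
    have "(1/2 :: real) ^ i = 2 powr (- real i)" by (simp add: powr_minus powr_realpow power_divide inverse_eq_divide)
    moreover have "((4::real) ^ i) powr (1/3) = 2 powr (real i * (2/3))"
    proof -
      have "(4::real) ^ i = 2 powr (2 * real i)" using powr_realpow[of 2 "2 * i"] by (simp add: power_mult)
      then show ?thesis by (simp add: powr_powr mult.commute)
    qed
    moreover have "r ^ i = 2 powr (- real i / 3)" by (simp add: r_def powr_realpow[symmetric] powr_powr)
    ultimately show ?thesis by (simp add: powr_add[symmetric])
  qed
  then have "(\<Sum>i=1..m. (1/2) ^ i * (4 ^ i) powr (1/3)) = (\<Sum>i=1..m. r ^ i)" by simp
  also have "\<dots> = (r - r ^ Suc m) / (1 - r)"
    by (subst sum_gp) (use r in \<open>auto simp: r_def\<close>)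
  also have "\<dots> \<le> 4"
  proof -
    have "r ^ 3 = r powr 3" using powr_realpow[OF r, of 3] by simp
    also have "\<dots> = 2 powr (- 1)" unfolding r_def powr_powr by simp
    also have "\<dots> = 1 / 2" by (simp add: powr_minus_divide)
    finally have "r ^ 3 = 1 / 2" .
    then have "r ^ 3 \<le> (4/5) ^ 3" by (simp add: power3_eq_cube)
    then have "r \<le> 4/5" by (rule power_le_imp_le_base[of r 2, simplified numeral_3_eq_3[symmetric], simplified]) auto
    moreover have "0 \<le> r * r ^ m" using r by simp
    ultimately show ?thesis by (simp add: divide_le_eq)
  qed
  finally show ?thesis .
qed

text \<open>
  The digits of weight \<open>2\<^bsup>-i\<^esup>\<close> of \<open>|w|/4\<close>, with the signs of \<open>w\<close>, form a sign vector whose support consists of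
  entries of size at least \<open>2\<^bsup>2-i\<^esup>\<close> in \<open>w\<close>; so its size is at most \<open>4\<^sup>i\<close> times the squared norm of \<open>w\<close>. As
  the exponent \<open>2/3\<close> is below \<open>1\<close>, the triangle inequality over all digits produces the convergent
  geometric series \<open>2\<^bsup>-i\<^esup> 4\<^bsup>i/3\<^esup>\<close>.
\<close>

lemma sign_vectors_control_bounded_vectors:
  fixes Y :: "nat \<Rightarrow> nat \<Rightarrow> real"
  assumes n: "1 \<le> n" and K: "0 \<le> K"
    and sgn: "\<And>x. x \<in> sign_vectors n \<Longrightarrow> (\<Sum>j=1..n. (\<Sum>k=1..n. Y j k * x k)\<^sup>2) \<le> K * (supp_size n x / n) powr (2/3)"
    and w: "\<And>k. k \<in> {1..n} \<Longrightarrow> \<bar>w k\<bar> \<le> 2"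
  shows "(\<Sum>j=1..n. (\<Sum>k=1..n. Y j k * w k)\<^sup>2) \<le> 256 * K * ((\<Sum>k=1..n. (w k)\<^sup>2) / n) powr (2/3)"
proof -
  define u where "u k = \<bar>w k\<bar> / 4" for k
  have u: "0 \<le> u k" "k \<in> {1..n} \<Longrightarrow> u k < 1" for k using w[of k] by (auto simp: u_def)
  define S where "S = (\<Sum>k=1..n. (w k)\<^sup>2)"
  have S0: "0 \<le> S" unfolding S_def by (intro sum_nonneg) auto
  define x where "x i = (\<lambda>k\<in>{1..n}. sgn (w k) * real_of_int (\<lfloor>2 ^ i * u k\<rfloor> mod 2))" for i :: nat
  have bit: "b mod 2 = 0 \<or> b mod 2 = 1" for b :: int by presburger
  have x_sgn: "x i \<in> sign_vectors n" for i
  proof -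
    have "sgn (w k) * real_of_int (\<lfloor>2 ^ i * u k\<rfloor> mod 2) \<in> {-1, 0, 1}" for k
      using bit[of "\<lfloor>2 ^ i * u k\<rfloor>"] by (auto simp: sgn_if)
    then show ?thesis by (auto simp: sign_vectors_def x_def)
  qed
  have supp: "real (supp_size n (x i)) \<le> 4 ^ i * S" for i
  proof -
    have "real (supp_size n (x i)) = (\<Sum>k\<in>{k\<in>{1..n}. x i k \<noteq> 0}. 1)" by (simp add: supp_size_def)
    also have "\<dots> \<le> (\<Sum>k\<in>{k\<in>{1..n}. x i k \<noteq> 0}. 4 ^ i * (w k)\<^sup>2)"
    proof (rule sum_mono)
      fix k assume k: "k \<in> {k\<in>{1..n}. x i k \<noteq> 0}"
      then have "\<lfloor>2 ^ i * u k\<rfloor> \<noteq> 0" by (auto simp: x_def)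
      moreover have "0 \<le> 2 ^ i * u k" using u by simp
      ultimately have "1 \<le> 2 ^ i * u k" by linarith
      then have "1 \<le> 2 ^ i * \<bar>w k\<bar>" using u(1)[of k] unfolding u_def by (simp add: field_simps)
      then have "1\<^sup>2 \<le> (2 ^ i * \<bar>w k\<bar>)\<^sup>2" by (intro power_mono) auto
      moreover have "(2 ^ i * \<bar>w k\<bar>)\<^sup>2 = 4 ^ i * (w k)\<^sup>2"
        by (simp add: power_mult_distrib power_mult[symmetric] mult.commute[of i]) (simp add: power_mult)
      ultimately show "1 \<le> 4 ^ i * (w k)\<^sup>2" by simp
    qed
    also have "\<dots> \<le> (\<Sum>k=1..n. 4 ^ i * (w k)\<^sup>2)" by (intro sum_mono2) auto
    also have "\<dots> = 4 ^ i * S" by (simp add: S_def sum_distrib_left)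
    finally show ?thesis .
  qed
  define a where "a = sqrt K * (S / n) powr (1/3)"
  have a0: "0 \<le> a" using K by (simp add: a_def)
  have level: "L2_set (\<lambda>j. \<Sum>k=1..n. Y j k * x i k) {1..n} \<le> a * (4 ^ i) powr (1/3)" for i
  proof -
    have "L2_set (\<lambda>j. \<Sum>k=1..n. Y j k * x i k) {1..n} \<le> sqrt (K * (supp_size n (x i) / n) powr (2/3))"
      unfolding L2_set_def by (intro real_sqrt_le_mono sgn x_sgn)
    also have "\<dots> \<le> sqrt (K * (4 ^ i * S / n) powr (2/3))"
      using supp[of i] K by (intro real_sqrt_le_mono mult_left_mono powr_mono2 divide_right_mono) auto
    also have "(4 ^ i * S / n) powr (2/3) = ((4 ^ i * S / n) powr (1/3))\<^sup>2"
      by (simp add: power2_eq_square powr_add[symmetric])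
    also have "sqrt (K * ((4 ^ i * S / n) powr (1/3))\<^sup>2) = sqrt K * (4 ^ i * S / n) powr (1/3)"
      by (simp add: real_sqrt_mult)
    also have "4 ^ i * S / n = 4 ^ i * (S / n)" by simp
    also have "(4 ^ i * (S / n)) powr (1/3) = (4 ^ i) powr (1/3) * (S / n) powr (1/3)"
      using S0 by (intro powr_mult)
    finally show ?thesis by (simp add: a_def mult_ac)
  qed
  define wm where "wm m k = sgn (w k) * (\<lfloor>2 ^ m * u k\<rfloor> / 2 ^ m)" for m :: nat and k
  have wm_eq: "wm m k = (\<Sum>i=1..m. (1/2) ^ i * x i k)" if "k \<in> {1..n}" for m k
    unfolding wm_def binary_digits_sum[OF u(1) u(2)[OF that], symmetric] using that
    by (simp add: x_def sum_distrib_left power_divide mult_ac)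
  \<comment> \<open>The bound is uniform in the number of digits, so it passes to the limit.\<close>
  have partial: "L2_set (\<lambda>j. \<Sum>k=1..n. Y j k * wm m k) {1..n} \<le> 4 * a" for m
  proof -
    have "(\<Sum>k=1..n. Y j k * wm m k) = (\<Sum>i=1..m. (1/2) ^ i * (\<Sum>k=1..n. Y j k * x i k))" for j
    proof -
      have "(\<Sum>k=1..n. Y j k * wm m k) = (\<Sum>k=1..n. \<Sum>i=1..m. (1/2) ^ i * (Y j k * x i k))"
        by (intro sum.cong refl) (simp add: wm_eq sum_distrib_left mult_ac)
      also have "\<dots> = (\<Sum>i=1..m. (1/2) ^ i * (\<Sum>k=1..n. Y j k * x i k))"
        by (subst sum.swap) (simp add: sum_distrib_left)
      finally show ?thesis .
    qed
    then have "L2_set (\<lambda>j. \<Sum>k=1..n. Y j k * wm m k) {1..n} \<le> (\<Sum>i=1..m. L2_set (\<lambda>j. (1/2) ^ i * (\<Sum>k=1..n. Y j k * x i k)) {1..n})"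
      using L2_set_sum_le[of "{1..m}" "\<lambda>i j. (1/2) ^ i * (\<Sum>k=1..n. Y j k * x i k)" "{1..n}"] by simp
    also have "\<dots> = (\<Sum>i=1..m. (1/2) ^ i * L2_set (\<lambda>j. \<Sum>k=1..n. Y j k * x i k) {1..n})"
      by (intro sum.cong refl L2_set_right_distrib[symmetric]) auto
    also have "\<dots> \<le> (\<Sum>i=1..m. (1/2) ^ i * (a * (4 ^ i) powr (1/3)))"
      by (intro sum_mono mult_left_mono level) auto
    also have "\<dots> = a * (\<Sum>i=1..m. (1/2) ^ i * (4 ^ i) powr (1/3))"
      by (simp add: sum_distrib_left mult_ac)
    also have "\<dots> \<le> a * 4" by (intro mult_left_mono geometric_cube_root a0)
    finally show ?thesis by simp
  qed
  have lim_wm: "(\<lambda>m. wm m k) \<longlonglongrightarrow> w k / 4" for k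
  proof -
    have "(\<lambda>m. \<lfloor>2 ^ m * u k\<rfloor> / 2 ^ m) \<longlonglongrightarrow> u k"
    proof (rule real_tendsto_sandwich[where f="\<lambda>m. u k - (1/2) ^ m" and h="\<lambda>m. u k"])
      have "(\<lambda>m. u k - (1/2) ^ m) \<longlonglongrightarrow> u k - 0" by (intro tendsto_intros LIMSEQ_power_zero) auto
      then show "(\<lambda>m. u k - (1/2) ^ m) \<longlonglongrightarrow> u k" by simp
      have "u k - (1/2) ^ m \<le> \<lfloor>2 ^ m * u k\<rfloor> / 2 ^ m" for m
      proof -
        have "2 ^ m * u k - 1 \<le> \<lfloor>2 ^ m * u k\<rfloor>" by linarith
        then have "(2 ^ m * u k - 1) / 2 ^ m \<le> \<lfloor>2 ^ m * u k\<rfloor> / 2 ^ m" by (intro divide_right_mono) auto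
        then show ?thesis by (simp add: diff_divide_distrib power_divide)
      qed
      then show "\<forall>\<^sub>F m in sequentially. u k - (1/2) ^ m \<le> \<lfloor>2 ^ m * u k\<rfloor> / 2 ^ m" by simp
      have "\<lfloor>2 ^ m * u k\<rfloor> / 2 ^ m \<le> u k" for m
      proof -
        have "\<lfloor>2 ^ m * u k\<rfloor> / 2 ^ m \<le> 2 ^ m * u k / 2 ^ m" by (intro divide_right_mono) auto
        then show ?thesis by simp
      qed
      then show "\<forall>\<^sub>F m in sequentially. \<lfloor>2 ^ m * u k\<rfloor> / 2 ^ m \<le> u k" by simp
    qed auto
    then have "(\<lambda>m. wm m k) \<longlonglongrightarrow> sgn (w k) * u k" unfolding wm_def by (intro tendsto_intros)
    also have "sgn (w k) * u k = w k / 4" by (simp add: u_def sgn_mult_abs abs_sgn mult.commute)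
    finally show ?thesis .
  qed
  have "(\<lambda>m. L2_set (\<lambda>j. \<Sum>k=1..n. Y j k * wm m k) {1..n}) \<longlonglongrightarrow> L2_set (\<lambda>j. \<Sum>k=1..n. Y j k * (w k / 4)) {1..n}"
    unfolding L2_set_def by (intro tendsto_intros lim_wm)
  then have "L2_set (\<lambda>j. \<Sum>k=1..n. Y j k * (w k / 4)) {1..n} \<le> 4 * a"
    by (rule LIMSEQ_le_const2) (use partial in auto)
  moreover have "L2_set (\<lambda>j. \<Sum>k=1..n. Y j k * (w k / 4)) {1..n} = (1/4) * L2_set (\<lambda>j. \<Sum>k=1..n. Y j k * w k) {1..n}"
    by (subst L2_set_right_distrib) (auto simp: sum_divide_distrib)
  ultimately have "L2_set (\<lambda>j. \<Sum>k=1..n. Y j k * w k) {1..n} \<le> 16 * a" by linarith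
  then have "(L2_set (\<lambda>j. \<Sum>k=1..n. Y j k * w k) {1..n})\<^sup>2 \<le> (16 * a)\<^sup>2"
    by (intro power_mono L2_set_nonneg)
  also have "(16 * a)\<^sup>2 = 256 * K * (((S / n) powr (1/3))\<^sup>2)" using K by (simp add: a_def power_mult_distrib)
  also have "((S / n) powr (1/3))\<^sup>2 = (S / n) powr (2/3)" by (simp add: power2_eq_square powr_add[symmetric])
  also have "(L2_set (\<lambda>j. \<Sum>k=1..n. Y j k * w k) {1..n})\<^sup>2 = (\<Sum>j=1..n. (\<Sum>k=1..n. Y j k * w k)\<^sup>2)"
    unfolding L2_set_def by (intro real_sqrt_pow2 sum_nonneg) auto
  finally show ?thesis by (simp only: S_def)
qed

section \<open>Alignment, and measurability of the contraction event\<close>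

lemma unit_vecs_norm: "z \<in> unit_vecs n \<Longrightarrow> j \<in> {1..n} \<Longrightarrow> cmod (z j) = 1"
  by (auto simp: unit_vecs_def PiE_def Pi_def)

lemma alignment_cost:
  assumes "z \<in> unit_vecs n" "z' \<in> unit_vecs n" "cmod a = 1"
  shows "(\<Sum>j=1..n. (cmod (z j * a - z' j))\<^sup>2) = 2 * n - 2 * Re (a * (\<Sum>j=1..n. z j * cnj (z' j)))"
proof -
  have "(cmod (z j * a - z' j))\<^sup>2 = 2 - 2 * Re (a * (z j * cnj (z' j)))" if "j \<in> {1..n}" for j
  proof -
    have "(cmod (x - y))\<^sup>2 = (cmod x)\<^sup>2 + (cmod y)\<^sup>2 - 2 * Re (x * cnj y)" for x y
      by (simp only: cmod_power2) (simp add: power2_eq_square algebra_simps)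
    from this[of "z j * a" "z' j"] show ?thesis
      using unit_vecs_norm[OF assms(1) that] unit_vecs_norm[OF assms(2) that] assms(3)
      by (simp add: norm_mult mult_ac del: times_complex.sel)
  qed
  then have "(\<Sum>j=1..n. (cmod (z j * a - z' j))\<^sup>2) = (\<Sum>j=1..n. 2 - 2 * Re (a * (z j * cnj (z' j))))"
    by (intro sum.cong) auto
  also have "\<dots> = 2 * n - 2 * Re (a * (\<Sum>j=1..n. z j * cnj (z' j)))"
    by (simp add: sum_subtractf sum_distrib_left del: times_complex.sel)
  finally show ?thesis by simp
qed

text \<open>
  The best phase rotates the inner product of \<open>z\<close> and \<open>z'\<close> onto the nonnegative real axis.
\<close>

lemma optimal_alignment:
  assumes "z \<in> unit_vecs n" "z' \<in> unit_vecs n"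
  obtains a where "cmod a = 1" "a * (\<Sum>j=1..n. z j * cnj (z' j)) = of_real (cmod (\<Sum>j=1..n. z j * cnj (z' j)))"
    "loss n z z' = (\<Sum>j=1..n. (cmod (z j * a - z' j))\<^sup>2)"
    "loss n z z' = 2 * n - 2 * cmod (\<Sum>j=1..n. z j * cnj (z' j))"
proof -
  define S where "S = (\<Sum>j=1..n. z j * cnj (z' j))"
  define a where "a = (if S = 0 then 1 else cnj S / of_real (cmod S))"
  have a: "cmod a = 1" by (simp add: a_def norm_divide)
  have aS: "a * S = of_real (cmod S)"
  proof (cases "S = 0")
    case False
    have "cnj S * S = of_real ((cmod S)\<^sup>2)" using complex_norm_square[of S] by (simp only: mult.commute)
    then show ?thesis using False by (simp add: a_def power2_eq_square)
  qed simp
  have cost: "(\<Sum>j=1..n. (cmod (z j * b - z' j))\<^sup>2) = 2 * n - 2 * Re (b * S)" if "cmod b = 1" for b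
    using alignment_cost[OF assms that] by (simp add: S_def)
  have min: "(\<Sum>j=1..n. (cmod (z j * a - z' j))\<^sup>2) \<le> (\<Sum>j=1..n. (cmod (z j * b - z' j))\<^sup>2)" if "cmod b = 1" for b
  proof -
    have "Re (b * S) \<le> cmod S" using complex_Re_le_cmod[of "b * S"] that by (simp add: norm_mult)
    then show ?thesis by (simp only: cost[OF that] cost[OF a] aS Re_complex_of_real)
  qed
  have "loss n z z' = (\<Sum>j=1..n. (cmod (z j * a - z' j))\<^sup>2)"
    unfolding loss_def by (rule cInf_eq_minimum) (use a min in auto)
  moreover have "loss n z z' = 2 * n - 2 * cmod S"
    unfolding \<open>loss n z z' = _\<close> cost[OF a] aS by simp
  ultimately show thesis using that a aS by (simp add: S_def)
qed

lemma loss_eq: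
  assumes "z \<in> unit_vecs n" "z' \<in> unit_vecs n"
  shows "loss n z z' = 2 * n - 2 * cmod (\<Sum>j=1..n. z j * cnj (z' j))"
  using optimal_alignment[OF assms] by metis

lemma power_iteration_unit_vecs: "power_iteration n A Y z \<in> unit_vecs n"
  by (auto simp: unit_vecs_def power_iteration_def Let_def norm_divide)

lemma compact_unit_vecs: "compact (unit_vecs n)"
proof -
  have "unit_vecs n = PiE UNIV (\<lambda>j. if j \<in> {1..n} then sphere 0 1 else {undefined})"
    by (auto simp: unit_vecs_def PiE_def Pi_def extensional_def split: if_splits)
  also have "compactin (product_topology (\<lambda>_. euclidean) UNIV) \<dots>"
    unfolding compactin_PiE by auto
  finally show ?thesis by (simp add: euclidean_product_topology)
qed

lemma closed_projection_of_compact: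
  fixes C :: "('x::topological_space \<times> 'y::topological_space) set"
  assumes "compact Z" "closed C"
  shows "closed {x. \<exists>z\<in>Z. (x, z) \<in> C}"
proof -
  have "closed_map (prod_topology euclidean (top_of_set Z)) (euclidean :: 'x topology) fst"
    by (rule Abstract_Topological_Spaces.closed_map_fst) (use assms(1) compactin_subspace compactin_euclidean_iff in metis)
  moreover have "prod_topology (euclidean :: 'x topology) (top_of_set Z) = top_of_set (UNIV \<times> Z)"
    using prod_topology_subtopology_eu[of "UNIV :: 'x set" Z] by simp
  moreover have "closedin (top_of_set (UNIV \<times> Z)) (C \<inter> (UNIV \<times> Z))"
    using assms(2) by (metis closed_closedin closedin_subtopology)
  ultimately have "closed (fst ` (C \<inter> (UNIV \<times> Z)))"
    by (auto simp: closed_map_def)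
  also have "fst ` (C \<inter> (UNIV \<times> Z)) = {x. \<exists>z\<in>Z. (x, z) \<in> C}" by force
  finally show ?thesis .
qed

text \<open>
  The power iteration as a function of the entrywise product of the adjacency and observation matrices.
\<close>

definition normalized_image :: "nat \<Rightarrow> (nat \<times> nat \<Rightarrow> complex) \<Rightarrow> (nat \<Rightarrow> complex) \<Rightarrow> nat \<Rightarrow> complex" where
  "normalized_image n m z = (\<lambda>j\<in>{1..n}.
     let s = (\<Sum>k\<in>{1..n} - {j}. m (j, k) * z k) in if s \<noteq> 0 then s / of_real (cmod s) else 1)"

text \<open>
  The set is split according to the set \<open>J\<close> of vanishing coordinates of the matrix-vector product and a
  lower bound \<open>1/(N+1)\<close> both for the moduli of the other coordinates and for the gap in the strict
  inequality. On each piece the image can be replaced by \<open>\<phi> J N\<close>, which is continuous everywhere, so the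
  piece is the projection of a closed set along the compact set of all \<open>z\<close>.
\<close>

lemma borel_exceptional_matrices:
  assumes z': "z' \<in> unit_vecs n"
  shows "{m. \<exists>z\<in>unit_vecs n. loss n z z' \<le> c0 \<and> d * loss n z z' + c1 < loss n (normalized_image n m z) z'} \<in> sets borel"
proof -
  define s where "s m z j = (\<Sum>k\<in>{1..n} - {j}. m (j, k) * z k)" for m :: "nat \<times> nat \<Rightarrow> complex" and z :: "nat \<Rightarrow> complex" and j
  define L where "L z = 2 * n - 2 * cmod (\<Sum>j=1..n. z j * cnj (z' j))" for z :: "nat \<Rightarrow> complex"
  define \<epsilon> where "\<epsilon> N = 1 / real (Suc N)" for N
  define \<phi> where "\<phi> J N m z j = (if j \<in> J then 1 else s m z j / of_real (max (cmod (s m z j)) (\<epsilon> N)))" for J N m z j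
  define C where "C J N = {q :: (nat \<times> nat \<Rightarrow> complex) \<times> (nat \<Rightarrow> complex).
      L (snd q) \<le> c0 \<and> (\<forall>j\<in>J. s (fst q) (snd q) j = 0) \<and> (\<forall>j\<in>{1..n}-J. \<epsilon> N \<le> cmod (s (fst q) (snd q) j))
      \<and> d * L (snd q) + c1 + \<epsilon> N \<le> L (\<phi> J N (fst q) (snd q))}" for J N
  have \<epsilon>: "0 < \<epsilon> N" for N by (simp add: \<epsilon>_def)
  have cm: "continuous_on UNIV (\<lambda>q :: (nat \<times> nat \<Rightarrow> complex) \<times> (nat \<Rightarrow> complex). fst q e)" for e
    by (rule continuous_on_product_then_coordinatewise[OF continuous_on_fst[OF continuous_on_id]])
  have cz: "continuous_on UNIV (\<lambda>q :: (nat \<times> nat \<Rightarrow> complex) \<times> (nat \<Rightarrow> complex). snd q k)" for k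
    by (rule continuous_on_product_then_coordinatewise[OF continuous_on_snd[OF continuous_on_id]])
  have cs: "continuous_on UNIV (\<lambda>q. s (fst q) (snd q) j)" for j
    unfolding s_def by (intro continuous_intros cm cz)
  have c\<phi>: "continuous_on UNIV (\<lambda>q. \<phi> J N (fst q) (snd q) j)" for J N j
  proof (cases "j \<in> J")
    case False
    have "max (cmod (s (fst q) (snd q) j)) (\<epsilon> N) \<noteq> 0" for q using \<epsilon>[of N] by (auto simp: max_def)
    then show ?thesis using False unfolding \<phi>_def by (auto intro!: continuous_intros cs)
  qed (simp add: \<phi>_def)
  have cL: "continuous_on UNIV (\<lambda>q :: (nat \<times> nat \<Rightarrow> complex) \<times> (nat \<Rightarrow> complex). L (snd q))" "continuous_on UNIV (\<lambda>q. L (\<phi> J N (fst q) (snd q)))" for J N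
    unfolding L_def by (intro continuous_intros c\<phi> cz)+
  have closedC: "closed (C J N)" for J N
    unfolding C_def Ball_def
    by (intro closed_Collect_conj closed_Collect_all closed_Collect_imp closed_Collect_le closed_Collect_eq open_Collect_const continuous_intros cs cL)
  have "{m. \<exists>z\<in>unit_vecs n. loss n z z' \<le> c0 \<and> d * loss n z z' + c1 < loss n (normalized_image n m z) z'}
      = (\<Union>J\<in>Pow {1..n}. \<Union>N. {m. \<exists>z\<in>unit_vecs n. (m, z) \<in> C J N})" (is "?L = ?R")
  proof (intro equalityI subsetI)
    fix m assume "m \<in> ?L"
    then obtain z where z: "z \<in> unit_vecs n" "loss n z z' \<le> c0" "d * loss n z z' + c1 < loss n (normalized_image n m z) z'" by blast
    define J where "J = {j\<in>{1..n}. s m z j = 0}"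
    have Lz: "loss n z z' = L z" using loss_eq[OF z(1) z'] by (simp add: L_def)
    have img: "normalized_image n m z \<in> unit_vecs n"
      by (auto simp: unit_vecs_def normalized_image_def Let_def norm_divide)
    have Li: "loss n (normalized_image n m z) z' = L (normalized_image n m z)" using loss_eq[OF img z'] by (simp add: L_def)
    define gap where "gap = Min (insert (L (normalized_image n m z) - (d * L z + c1)) ((\<lambda>j. cmod (s m z j)) ` ({1..n} - J)))"
    have gap: "0 < gap" unfolding gap_def using z(3) by (subst Min_gr_iff) (auto simp: Lz Li J_def)
    obtain N where N: "\<epsilon> N < gap" unfolding \<epsilon>_def using nat_approx_posE[OF gap] by blast
    have le: "\<epsilon> N \<le> L (normalized_image n m z) - (d * L z + c1)" "j \<in> {1..n} - J \<Longrightarrow> \<epsilon> N \<le> cmod (s m z j)" for j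
      using N unfolding gap_def by (auto simp: Min_gr_iff less_imp_le)
    have "L (\<phi> J N m z) = L (normalized_image n m z)"
    proof -
      have "\<phi> J N m z j = normalized_image n m z j" if "j \<in> {1..n}" for j
        using that le(2)[of j] by (auto simp: \<phi>_def normalized_image_def J_def s_def max_def Let_def)
      then have "(\<Sum>j=1..n. \<phi> J N m z j * cnj (z' j)) = (\<Sum>j=1..n. normalized_image n m z j * cnj (z' j))"
        by (intro sum.cong) auto
      then show ?thesis unfolding L_def by simp
    qed
    then have "(m, z) \<in> C J N" using z le unfolding C_def by (auto simp: Lz J_def)
    moreover have "J \<in> Pow {1..n}" by (auto simp: J_def)
    ultimately show "m \<in> ?R" using z(1) by blast
  next
    fix m assume "m \<in> ?R"
    then obtain J N z where J: "J \<subseteq> {1..n}" and z: "z \<in> unit_vecs n" and C: "(m, z) \<in> C J N" by auto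
    have Lz: "loss n z z' = L z" using loss_eq[OF z z'] by (simp add: L_def)
    have img: "normalized_image n m z \<in> unit_vecs n"
      by (auto simp: unit_vecs_def normalized_image_def Let_def norm_divide)
    have Li: "loss n (normalized_image n m z) z' = L (normalized_image n m z)" using loss_eq[OF img z'] by (simp add: L_def)
    have "L (\<phi> J N m z) = L (normalized_image n m z)"
    proof -
      have "\<phi> J N m z j = normalized_image n m z j" if "j \<in> {1..n}" for j
      proof (cases "j \<in> J")
        case True
        then have "s m z j = 0" using C by (auto simp: C_def)
        then show ?thesis using True that by (simp add: \<phi>_def normalized_image_def s_def)
      next
        case False
        then have "\<epsilon> N \<le> cmod (s m z j)" using C that by (auto simp: C_def)
        moreover from this have "s m z j \<noteq> 0" using \<epsilon>[of N] by auto
        ultimately show ?thesis using False that by (auto simp: \<phi>_def normalized_image_def s_def max_def Let_def)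
      qed
      then have "(\<Sum>j=1..n. \<phi> J N m z j * cnj (z' j)) = (\<Sum>j=1..n. normalized_image n m z j * cnj (z' j))"
        by (intro sum.cong) auto
      then show ?thesis unfolding L_def by simp
    qed
    then show "m \<in> ?L" using C z \<epsilon>[of N] by (auto simp: C_def Lz Li intro!: bexI[of _ z])
  qed
  also have "\<dots> \<in> sets borel"
    by (intro sets.finite_UN sets.countable_UN'' borel_closed closed_projection_of_compact compact_unit_vecs closedC) auto
  finally show ?thesis .
qed

lemma (in synchronization_model) contraction_event:
  assumes z': "z' \<in> unit_vecs n"
  shows "{\<omega> \<in> space M. \<forall>z \<in> unit_vecs n. loss n z z' \<le> c0 \<longrightarrow>
           loss n (power_iteration n (adjacency (\<lambda>e. A e \<omega>)) (observation \<sigma> z' (\<lambda>e. W e \<omega>)) z) z'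
             \<le> d * loss n z z' + c1} \<in> events"
proof -
  define m where "m \<omega> = (\<lambda>(j, k). if j \<in> {1..n} \<and> k \<in> {1..n} then adjacency (\<lambda>e. A e \<omega>) j k * observation \<sigma> z' (\<lambda>e. W e \<omega>) j k else 0)" for \<omega>
  have m_meas: "m \<in> borel_measurable M"
  proof (rule measurable_coordinatewise_then_product)
    fix e :: "nat \<times> nat"
    obtain j k where e: "e = (j, k)" by (cases e)
    have Am: "(\<lambda>\<omega>. of_bool (A e \<omega>) :: complex) \<in> borel_measurable M" if "e \<in> edges n" for e
      using measurable_compose[OF measurable_A[OF that], of "of_bool :: bool \<Rightarrow> complex" borel] by simp
    have [measurable]: "cnj \<in> borel_measurable borel"
      by (intro borel_measurable_continuous_onI continuous_intros)
    consider "j \<in> {1..n} \<and> k \<in> {1..n} \<and> j < k" | "j \<in> {1..n} \<and> k \<in> {1..n} \<and> k < j" | "j = k \<or> \<not> (j \<in> {1..n} \<and> k \<in> {1..n})" by linarith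
    then show "(\<lambda>\<omega>. m \<omega> e) \<in> borel_measurable M"
    proof cases
      case 1
      then have E: "(j, k) \<in> edges n" by (auto simp: edges_def)
      note [measurable] = Am[OF E] measurable_W[OF E]
      have "(\<lambda>\<omega>. of_bool (A (j, k) \<omega>) * (z' j * cnj (z' k) + of_real \<sigma> * W (j, k) \<omega>)) \<in> borel_measurable M" by measurable
      then show ?thesis using 1 by (simp add: m_def e adjacency_def observation_def)
    next
      case 2
      then have E: "(k, j) \<in> edges n" by (auto simp: edges_def)
      note [measurable] = Am[OF E] measurable_W[OF E]
      have "(\<lambda>\<omega>. of_bool (A (k, j) \<omega>) * cnj (z' k * cnj (z' j) + of_real \<sigma> * W (k, j) \<omega>)) \<in> borel_measurable M" by measurable
      then show ?thesis using 2 by (simp add: m_def e adjacency_def observation_def)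
    next
      case 3
      then have "m \<omega> e = 0" for \<omega> by (auto simp: m_def e adjacency_def)
      then show ?thesis by simp
    qed
  qed
  have pi_eq: "power_iteration n (adjacency (\<lambda>e. A e \<omega>)) (observation \<sigma> z' (\<lambda>e. W e \<omega>)) z = normalized_image n (m \<omega>) z" for z \<omega>
  proof -
    have "(\<Sum>k\<in>{1..n} - {j}. adjacency (\<lambda>e. A e \<omega>) j k * observation \<sigma> z' (\<lambda>e. W e \<omega>) j k * z k) = (\<Sum>k\<in>{1..n} - {j}. m \<omega> (j, k) * z k)"
      if "j \<in> {1..n}" for j
      using that by (intro sum.cong refl) (auto simp: m_def)
    then show ?thesis unfolding power_iteration_def normalized_image_def by (intro restrict_ext) simp
  qed
  let ?B = "{m. \<exists>z\<in>unit_vecs n. loss n z z' \<le> c0 \<and> d * loss n z z' + c1 < loss n (normalized_image n m z) z'}"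
  have "space M - (m -` ?B \<inter> space M) \<in> events"
    by (intro sets.compl_sets measurable_sets[OF m_meas] borel_exceptional_matrices[OF z'])
  also have "space M - (m -` ?B \<inter> space M) = {\<omega> \<in> space M. \<forall>z \<in> unit_vecs n. loss n z z' \<le> c0 \<longrightarrow>
           loss n (power_iteration n (adjacency (\<lambda>e. A e \<omega>)) (observation \<sigma> z' (\<lambda>e. W e \<omega>)) z) z'
             \<le> d * loss n z z' + c1}"
    unfolding pi_eq by (auto simp: not_less)
  finally show ?thesis .
qed

section \<open>One step of the power iteration\<close>

lemma normalize_distance:
  assumes "0 < Re s"
  shows "cmod (s / of_real (cmod s) - 1) \<le> \<bar>Im s\<bar> / Re s"
proof -
  define r where "r = cmod s"
  have r: "0 < r" "Re s \<le> r" using assms complex_Re_le_cmod[of s] by (auto simp: r_def)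
  have r2: "r\<^sup>2 = (Re s)\<^sup>2 + (Im s)\<^sup>2" by (simp add: r_def cmod_power2)
  have "(cmod (s / of_real r - 1))\<^sup>2 = (Re s / r - 1)\<^sup>2 + (Im s / r)\<^sup>2"
    by (simp add: cmod_power2)
  also have "\<dots> = ((Re s - r)\<^sup>2 + (Im s)\<^sup>2) / r\<^sup>2"
  proof -
    have "Re s / r - 1 = (Re s - r) / r" using r by (simp add: diff_divide_distrib)
    then show ?thesis by (simp add: power_divide add_divide_distrib)
  qed
  also have "(Re s - r)\<^sup>2 + (Im s)\<^sup>2 = 2 * (r - Re s) * r"
    using r2 by (simp add: power2_eq_square algebra_simps)
  also have "2 * (r - Re s) * r / r\<^sup>2 = 2 * (r - Re s) / r"
    using r by (simp add: power2_eq_square)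
  also have "\<dots> \<le> (r - Re s) * (r + Re s) / (Re s)\<^sup>2"
  proof -
    have "2 * (Re s)\<^sup>2 \<le> r * (r + Re s)"
    proof -
      have "(Re s)\<^sup>2 \<le> r * r" "(Re s)\<^sup>2 \<le> r * Re s"
        unfolding power2_eq_square using r assms by (auto intro!: mult_mono)
      then show ?thesis by (simp add: distrib_left)
    qed
    then have le: "2 / r \<le> (r + Re s) / (Re s)\<^sup>2"
      using r assms by (simp add: field_simps)
    have "2 * (r - Re s) / r = (r - Re s) * (2 / r)" by simp
    also have "\<dots> \<le> (r - Re s) * ((r + Re s) / (Re s)\<^sup>2)"
      using r by (intro mult_left_mono le) auto
    also have "\<dots> = (r - Re s) * (r + Re s) / (Re s)\<^sup>2" by simp
    finally show ?thesis .
  qed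
  also have "(r - Re s) * (r + Re s) = (Im s)\<^sup>2"
    using r2 by (simp add: power2_eq_square algebra_simps)
  also have "(Im s)\<^sup>2 / (Re s)\<^sup>2 = (\<bar>Im s\<bar> / Re s)\<^sup>2" by (simp add: power_divide)
  finally show ?thesis unfolding r_def by (rule power2_le_imp_le) (use assms in simp)
qed

lemma weighted_square_sum:
  fixes x y \<eta> :: real
  assumes "0 < \<eta>"
  shows "(x + y)\<^sup>2 \<le> (1 + \<eta>) * x\<^sup>2 + (1 + 1 / \<eta>) * y\<^sup>2"
proof -
  have "0 \<le> (\<eta> * x - y)\<^sup>2 / \<eta>" using assms by simp
  also have "\<dots> = \<eta> * x\<^sup>2 - 2 * x * y + y\<^sup>2 / \<eta>" using assms by (simp add: power2_diff field_simps power2_eq_square)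
  finally show ?thesis by (simp add: power2_sum algebra_simps)
qed

text \<open>
  If \<open>E\<close> is not small the trivial bound \<open>2\<close> suffices. Otherwise the distance is at most the ratio of
  imaginary to real part; there \<open>E\<close> in the denominator multiplies \<open>Im H\<close>, which is itself bounded, so that
  all effects of \<open>E\<close> are linear in \<open>|E|\<close>.
\<close>

lemma normalize_perturbation:
  fixes s \<phi> H E :: complex and t \<theta> \<eta> :: real
  assumes s: "s = of_real (1 - t) + H + E" and t: "\<bar>t\<bar> + cmod H \<le> \<theta>" "\<theta> \<le> 1/4" and \<eta>: "0 < \<eta>"
    and \<phi>: "cmod \<phi> = 1" "s \<noteq> 0 \<Longrightarrow> \<phi> = s / of_real (cmod s)"
  shows "(cmod (\<phi> - 1))\<^sup>2 \<le> (1 + \<eta>) * ((Im H)\<^sup>2 / (1 - \<theta>)\<^sup>2) + (1 + 1 / \<eta>) * (64 * (cmod E)\<^sup>2)"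
proof (cases "cmod E \<le> 1/4")
  case True
  define e where "e = cmod E"
  have e: "0 \<le> e" "e \<le> 1/4" using True by (auto simp: e_def)
  have \<theta>0: "0 \<le> \<theta>" using t(1) norm_ge_zero[of H] by linarith
  have "\<bar>Re H\<bar> \<le> cmod H" "\<bar>Re E\<bar> \<le> e" "\<bar>Im E\<bar> \<le> e" "\<bar>Im H\<bar> \<le> cmod H"
    by (simp_all add: abs_Re_le_cmod abs_Im_le_cmod e_def)
  then have Re: "1 - \<theta> - e \<le> Re s" and Im: "\<bar>Im s\<bar> \<le> \<bar>Im H\<bar> + e" and h: "\<bar>Im H\<bar> \<le> 1/4"
    using t by (auto simp: s)
  have pos: "1/2 \<le> 1 - \<theta> - e" using t e by linarith
  then have Re0: "0 < Re s" using Re by linarith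
  then have "s \<noteq> 0" by auto
  then have "cmod (\<phi> - 1) \<le> \<bar>Im s\<bar> / Re s" using \<phi> normalize_distance[OF Re0] by simp
  also have "\<dots> \<le> (\<bar>Im H\<bar> + e) / (1 - \<theta> - e)"
    using Im Re pos by (intro frac_le) auto
  also have "\<dots> = \<bar>Im H\<bar> / (1 - \<theta>) + e * (\<bar>Im H\<bar> / (1 - \<theta>) + 1) / (1 - \<theta> - e)"
  proof -
    define c h where "c = 1 - \<theta>" and "h = \<bar>Im H\<bar>"
    have c: "0 < c" "0 < c - e" using pos e by (auto simp: c_def)
    have "h + e = h / c * (c - e) + e * (h / c + 1)" using c by (simp add: field_simps)
    then have "(h + e) / (c - e) = h / c * (c - e) / (c - e) + e * (h / c + 1) / (c - e)"
      by (simp only: add_divide_distrib)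
    then show ?thesis using c by (simp add: c_def h_def)
  qed
  also have "\<dots> \<le> \<bar>Im H\<bar> / (1 - \<theta>) + 8 * e"
  proof -
    have "\<bar>Im H\<bar> / (1 - \<theta>) \<le> (1/4) / (3/4)" using h t \<theta>0 by (intro frac_le) auto
    then have "e * (\<bar>Im H\<bar> / (1 - \<theta>) + 1) / (1 - \<theta> - e) \<le> e * 2 / (1/2)"
      using e pos t by (intro frac_le mult_left_mono mult_nonneg_nonneg) auto
    then show ?thesis using e by simp
  qed
  finally have "cmod (\<phi> - 1) \<le> \<bar>Im H\<bar> / (1 - \<theta>) + 8 * e" .
  then have "(cmod (\<phi> - 1))\<^sup>2 \<le> (\<bar>Im H\<bar> / (1 - \<theta>) + 8 * e)\<^sup>2" by (intro power_mono) auto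
  also have "\<dots> \<le> (1 + \<eta>) * (\<bar>Im H\<bar> / (1 - \<theta>))\<^sup>2 + (1 + 1 / \<eta>) * (8 * e)\<^sup>2"
    by (rule weighted_square_sum[OF \<eta>])
  also have "\<dots> = (1 + \<eta>) * ((Im H)\<^sup>2 / (1 - \<theta>)\<^sup>2) + (1 + 1 / \<eta>) * (64 * (cmod E)\<^sup>2)"
    by (simp add: power_divide power_mult_distrib e_def)
  finally show ?thesis .
next
  case False
  have "cmod (\<phi> - 1) \<le> 2" using norm_triangle_ineq4[of \<phi> 1] \<phi> by simp
  then have "(cmod (\<phi> - 1))\<^sup>2 \<le> 2\<^sup>2" by (intro power_mono) auto
  also have "2\<^sup>2 \<le> 1 * (64 * (cmod E)\<^sup>2)"
  proof -
    have "(1/4)\<^sup>2 \<le> (cmod E)\<^sup>2" using False by (intro power_mono) auto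
    then show ?thesis by (simp add: power2_eq_square)
  qed
  also have "\<dots> \<le> (1 + 1 / \<eta>) * (64 * (cmod E)\<^sup>2)" using \<eta> by (intro mult_right_mono) auto
  also have "\<dots> \<le> (1 + \<eta>) * ((Im H)\<^sup>2 / (1 - \<theta>)\<^sup>2) + (1 + 1 / \<eta>) * (64 * (cmod E)\<^sup>2)" using \<eta> by simp
  finally show ?thesis .
qed

text \<open>
  Real and imaginary parts of \<open>v\<close> and of the image are treated one by one; this multiplies the constant
  \<open>256\<close> of \<open>sign_vectors_control_bounded_vectors\<close> by \<open>8\<close>.
\<close>

lemma noise_on_bounded_vectors:
  assumes n: "1 \<le> n" and K: "0 \<le> K" and good: "noise_good n K V R c X"
    and v: "\<And>k. k \<in> {1..n} \<Longrightarrow> cmod (v k) \<le> 2"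
  shows "(\<Sum>j=1..n. (cmod (\<Sum>k=1..n. X j k * v k))\<^sup>2) \<le> 2048 * K * ((\<Sum>k=1..n. (cmod (v k))\<^sup>2) / n) powr (2/3)"
proof -
  define P where "P = ((\<Sum>k=1..n. (cmod (v k))\<^sup>2) / n) powr (2/3)"
  have comp: "(\<Sum>j=1..n. (Re (\<theta> * (\<Sum>k=1..n. X j k * complex_of_real (w k))))\<^sup>2) \<le> 256 * K * P"
    if \<theta>: "\<theta> \<in> {1, -\<i>}" and w: "\<And>k. \<bar>w k\<bar> \<le> cmod (v k)" for \<theta> w
  proof -
    have eq: "Re (\<theta> * (\<Sum>k=1..n. X j k * complex_of_real (x k))) = (\<Sum>k=1..n. Re (\<theta> * X j k) * x k)" for j x
      by (simp add: sum_distrib_left mult.assoc[symmetric] del: times_complex.sel) (simp add: algebra_simps)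
    have "(\<Sum>j=1..n. (\<Sum>k=1..n. Re (\<theta> * X j k) * w k)\<^sup>2) \<le> 256 * K * ((\<Sum>k=1..n. (w k)\<^sup>2) / n) powr (2/3)"
    proof (rule sign_vectors_control_bounded_vectors[OF n K])
      fix x assume "x \<in> sign_vectors n"
      then have "(\<Sum>j=1..n. (Re (\<theta> * (\<Sum>k=1..n. X j k * complex_of_real (x k))))\<^sup>2) \<le> K * (supp_size n x / n) powr (2/3)"
        using good \<theta> unfolding noise_good_def by blast
      then show "(\<Sum>j=1..n. (\<Sum>k=1..n. Re (\<theta> * X j k) * x k)\<^sup>2) \<le> K * (supp_size n x / n) powr (2/3)"
        by (simp only: eq)
    next
      fix k assume "k \<in> {1..n}"
      then show "\<bar>w k\<bar> \<le> 2" using v[of k] w[of k] by linarith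
    qed
    also have "\<dots> \<le> 256 * K * P"
    proof -
      have "(w k)\<^sup>2 \<le> (cmod (v k))\<^sup>2" for k using power_mono[OF w[of k], of 2] by simp
      then show ?thesis unfolding P_def using K
        by (intro mult_left_mono powr_mono2 divide_right_mono sum_mono divide_nonneg_nonneg sum_nonneg) auto
    qed
    finally show ?thesis by (simp only: eq)
  qed
  define a b where "a j = (\<Sum>k=1..n. X j k * complex_of_real (Re (v k)))" and "b j = (\<Sum>k=1..n. X j k * complex_of_real (Im (v k)))" for j
  have split: "(\<Sum>k=1..n. X j k * v k) = a j + \<i> * b j" for j
  proof -
    have "X j k * v k = X j k * complex_of_real (Re (v k)) + \<i> * (X j k * complex_of_real (Im (v k)))" for k
      by (subst complex_eq[of "v k"]) (simp add: algebra_simps)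
    then show ?thesis by (simp add: a_def b_def sum.distrib sum_distrib_left)
  qed
  have cm: "(cmod y)\<^sup>2 = (Re (1 * y))\<^sup>2 + (Re (- \<i> * y))\<^sup>2" for y by (simp add: cmod_power2)
  have pt: "(cmod (\<Sum>k=1..n. X j k * v k))\<^sup>2 \<le> 2 * (cmod (a j))\<^sup>2 + 2 * (cmod (b j))\<^sup>2" for j
  proof -
    have "cmod (a j + \<i> * b j) \<le> cmod (a j) + cmod (b j)" using norm_triangle_ineq[of "a j" "\<i> * b j"] by (simp add: norm_mult)
    then have "(cmod (a j + \<i> * b j))\<^sup>2 \<le> (cmod (a j) + cmod (b j))\<^sup>2" by (intro power_mono) auto
    also have "\<dots> \<le> 2 * (cmod (a j))\<^sup>2 + 2 * (cmod (b j))\<^sup>2"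
      using sum_squares_bound[of "cmod (a j)" "cmod (b j)"] by (simp add: power2_sum)
    finally show ?thesis by (simp only: split)
  qed
  have "(\<Sum>j=1..n. (cmod (\<Sum>k=1..n. X j k * v k))\<^sup>2) \<le> (\<Sum>j=1..n. 2 * (cmod (a j))\<^sup>2 + 2 * (cmod (b j))\<^sup>2)"
    by (intro sum_mono pt)
  also have "\<dots> = 2 * (\<Sum>j=1..n. (Re (1 * a j))\<^sup>2) + 2 * (\<Sum>j=1..n. (Re (- \<i> * a j))\<^sup>2)
      + 2 * (\<Sum>j=1..n. (Re (1 * b j))\<^sup>2) + 2 * (\<Sum>j=1..n. (Re (- \<i> * b j))\<^sup>2)"
    unfolding cm sum.distrib distrib_left sum_distrib_left by simp
  also have "\<dots> \<le> 2 * (256 * K * P) + 2 * (256 * K * P) + 2 * (256 * K * P) + 2 * (256 * K * P)"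
    unfolding a_def b_def
    by (intro add_mono mult_left_mono comp) (auto simp: abs_Re_le_cmod abs_Im_le_cmod)
  finally show ?thesis by (simp add: P_def)
qed

lemma real_sum_bound_complex:
  fixes B :: "nat \<Rightarrow> nat \<Rightarrow> real" and v :: "nat \<Rightarrow> complex"
  assumes B: "\<And>w. (\<Sum>j=1..n. (\<Sum>k=1..n. B j k * w k)\<^sup>2) \<le> C * (\<Sum>k=1..n. (w k)\<^sup>2)"
  shows "(\<Sum>j=1..n. (cmod (\<Sum>k=1..n. of_real (B j k) * v k))\<^sup>2) \<le> C * (\<Sum>k=1..n. (cmod (v k))\<^sup>2)"
proof -
  have "(\<Sum>j=1..n. (cmod (\<Sum>k=1..n. of_real (B j k) * v k))\<^sup>2)
     = (\<Sum>j=1..n. (\<Sum>k=1..n. B j k * Re (v k))\<^sup>2) + (\<Sum>j=1..n. (\<Sum>k=1..n. B j k * Im (v k))\<^sup>2)"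
    by (simp add: cmod_power2 sum.distrib)
  also have "\<dots> \<le> C * (\<Sum>k=1..n. (Re (v k))\<^sup>2) + C * (\<Sum>k=1..n. (Im (v k))\<^sup>2)"
    by (intro add_mono B)
  also have "\<dots> = C * (\<Sum>k=1..n. (cmod (v k))\<^sup>2)" by (simp add: cmod_power2 sum.distrib distrib_left)
  finally show ?thesis .
qed

text \<open>
  The deterministic heart of the proof: on the good event the loss after one step is bounded for all \<open>z\<close>
  at once.
\<close>

lemma power_iteration_loss_bound:
  fixes \<sigma> p \<theta> \<eta> \<rho> \<gamma> :: real
  assumes n: "1 \<le> n" and p: "0 < p" "p \<le> 1" and \<sigma>: "0 < \<sigma>" and z: "z \<in> unit_vecs n" and z': "z' \<in> unit_vecs n"
    and Q: "Q = {e \<in> edges n. a e}" and X: "X = noise_matrix z' Q w"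
    and reg: "nearly_regular n p (centered_adj Q p)"
    and good: "noise_good n K V R c X" and K: "0 \<le> K"
    and R: "\<sigma> * R = \<rho> * (n * p)"
    and l: "loss n z z' \<le> \<gamma> * n"
    and \<theta>: "\<gamma> / 2 + 1 / n + 4 * sqrt (n * p * ln n) / (n * p) + \<rho> \<le> \<theta>" "\<theta> \<le> 1/4" and \<eta>: "0 < \<eta>"
  shows "loss n (power_iteration n (adjacency a) (observation \<sigma> z' w) z) z'
     \<le> (1 + \<eta>) * ((\<sigma> / (n * p))\<^sup>2 * V / (1 - \<theta>)\<^sup>2)
       + (1 + 1 / \<eta>) * (192 / (n * p)\<^sup>2 * ((p\<^sup>2 + 432 * (n * p * ln n)) * loss n z z' + \<sigma>\<^sup>2 * (2048 * K * (loss n z z' / n) powr (2/3))))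
       + 4 * c"
proof -
  define f where "f = power_iteration n (adjacency a) (observation \<sigma> z' w) z"
  have f: "f \<in> unit_vecs n" unfolding f_def by (rule power_iteration_unit_vecs)
  define N where "N = real n * p"
  have N: "0 < N" using n p by (simp add: N_def)
  have QE: "Q \<subseteq> edges n" by (auto simp: Q)
  define lo where "lo = loss n z z'"
  obtain b where b: "cmod b = 1" and bS: "b * (\<Sum>j=1..n. z j * cnj (z' j)) = of_real (cmod (\<Sum>j=1..n. z j * cnj (z' j)))"
    and lb0: "loss n z z' = (\<Sum>j=1..n. (cmod (z j * b - z' j))\<^sup>2)" and l20: "loss n z z' = 2 * real n - 2 * cmod (\<Sum>j=1..n. z j * cnj (z' j))"
    by (rule optimal_alignment[OF z z'])
  note lb = lb0[folded lo_def] and l2 = l20[folded lo_def]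
  note zn = unit_vecs_norm[OF z] and zn' = unit_vecs_norm[OF z'] and fn = unit_vecs_norm[OF f]
  have cc: "z' k * cnj (z' k) = 1" "cnj (z' k) * z' k = 1" if "k \<in> {1..n}" for k
    using complex_norm_square[of "z' k"] zn'[OF that] by (auto simp: mult.commute)
  define u where "u k = z k * b * cnj (z' k)" for k
  define v where "v k = u k - 1" for k
  have zu: "z k * b = u k * z' k" if "k \<in> {1..n}" for k using cc[OF that] by (simp add: u_def mult.assoc)
  have vn: "cmod (v k) = cmod (z k * b - z' k)" if "k \<in> {1..n}" for k
  proof -
    have "z k * b - z' k = v k * z' k" using zu[OF that] by (simp add: v_def algebra_simps)
    then show ?thesis using zn'[OF that] by (simp add: norm_mult)
  qed
  have l_v: "lo = (\<Sum>k=1..n. (cmod (v k))\<^sup>2)" unfolding lb using vn by (intro sum.cong) auto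
  have l0: "0 \<le> lo" unfolding l_v by (intro sum_nonneg) auto
  have v2: "cmod (v k) \<le> 2" if "k \<in> {1..n}" for k
    using norm_triangle_ineq4[of "u k" 1] zn[OF that] zn'[OF that] b by (simp add: v_def u_def norm_mult)
  have sum_u: "(\<Sum>k=1..n. u k) = of_real (n - lo / 2)"
  proof -
    have "(\<Sum>k=1..n. u k) = b * (\<Sum>k=1..n. z k * cnj (z' k))" by (simp add: u_def sum_distrib_left mult_ac)
    also have "\<dots> = of_real (cmod (\<Sum>j=1..n. z j * cnj (z' j)))" by (rule bS)
    also have "cmod (\<Sum>j=1..n. z j * cnj (z' j)) = n - lo / 2" using l2 by linarith
    finally show ?thesis .
  qed
  define B where "B = centered_adj Q p"
  define deg where "deg j = (\<Sum>k=1..n. B j k)" for j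
  define X1 where "X1 j = (\<Sum>k=1..n. X j k)" for j
  define H where "H j = of_real (\<sigma> / N) * X1 j" for j
  define E where "E j = (- of_real p * v j + (\<Sum>k=1..n. of_real (B j k) * v k) + of_real \<sigma> * (\<Sum>k=1..n. X j k * v k)) / of_real N" for j
  define t where "t j = lo / (2 * n) + 1 / n - deg j / N" for j
  define S where "S j = (\<Sum>k\<in>{1..n} - {j}. adjacency a j k * observation \<sigma> z' w j k * z k)" for j
  have S: "S j * b * cnj (z' j) = of_real N * (of_real (1 - t j) + H j + E j)" if j: "j \<in> {1..n}" for j
  proof -
    have "S j * b * cnj (z' j) = (\<Sum>k\<in>{1..n} - {j}. (of_real (adj Q j k) + of_real \<sigma> * X j k) * u k)"
      unfolding S_def sum_distrib_right
    proof (rule sum.cong[OF refl])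
      fix k assume k: "k \<in> {1..n} - {j}"
      then have k1: "k \<in> {1..n}" by simp
      have M: "adjacency a j k * observation \<sigma> z' w j k = (of_real (adj Q j k) + of_real \<sigma> * X j k) * (z' j * cnj (z' k))"
      proof (cases "j < k")
        case True
        then have e: "(j, k) \<in> edges n" "(k, j) \<notin> edges n" using j k by (auto simp: edges_def)
        have "X j k * (z' j * cnj (z' k)) = of_bool (a (j, k)) * w (j, k) * ((cnj (z' j) * z' j) * (z' k * cnj (z' k)))"
          using e by (simp add: X noise_matrix_def Q)
        then have "X j k * (z' j * cnj (z' k)) = of_bool (a (j, k)) * w (j, k)"
          by (simp only: cc(2)[OF j] cc(1)[OF k1] mult_1_right)
        moreover have "adj Q j k = of_bool (a (j, k))" unfolding adj_eq[OF QE] using e by (simp add: Q)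
        ultimately show ?thesis using True by (simp add: adjacency_def observation_def algebra_simps)
      next
        case False
        then have e: "(k, j) \<in> edges n" "(j, k) \<notin> edges n" "k < j" using j k by (auto simp: edges_def)
        have "X j k * (z' j * cnj (z' k)) = of_bool (a (k, j)) * cnj (w (k, j)) * ((cnj (z' j) * z' j) * (z' k * cnj (z' k)))"
          using e by (simp add: X noise_matrix_def Q)
        then have "X j k * (z' j * cnj (z' k)) = of_bool (a (k, j)) * cnj (w (k, j))"
          by (simp only: cc(2)[OF j] cc(1)[OF k1] mult_1_right)
        moreover have "adj Q j k = of_bool (a (k, j))" unfolding adj_eq[OF QE] using e by (simp add: Q)
        ultimately show ?thesis using False e(3) by (simp add: adjacency_def observation_def algebra_simps)
      qed
      have "adjacency a j k * observation \<sigma> z' w j k * z k * b * cnj (z' j)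
         = (of_real (adj Q j k) + of_real \<sigma> * X j k) * (z' j * cnj (z' k)) * (z k * b) * cnj (z' j)"
        by (simp add: M mult.assoc)
      also have "\<dots> = (of_real (adj Q j k) + of_real \<sigma> * X j k) * u k * ((z' j * cnj (z' j)) * (z' k * cnj (z' k)))"
        using zu[of k] k by (simp add: mult_ac)
      finally show "adjacency a j k * observation \<sigma> z' w j k * z k * b * cnj (z' j) = (of_real (adj Q j k) + of_real \<sigma> * X j k) * u k"
        using cc(1)[OF j] cc(1)[of k] k by simp
    qed
    also have "\<dots> = (\<Sum>k=1..n. (of_real (adj Q j k) + of_real \<sigma> * X j k) * u k)"
    proof (rule sum.mono_neutral_left)
      have "(j, j) \<notin> Q" using QE by (auto simp: edges_def)
      then show "\<forall>i\<in>{1..n} - ({1..n} - {j}). (of_real (adj Q j i) + of_real \<sigma> * X j i) * u i = 0"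
        by (auto simp: adj_eq[OF QE] X noise_matrix_def)
    qed auto
    also have "\<dots> = (\<Sum>k=1..n. of_real (B j k) + of_real (B j k) * v k + of_real \<sigma> * X j k + of_real \<sigma> * (X j k * v k) + (of_real p * u k - (if k = j then of_real p * u k else 0)))"
    proof (rule sum.cong[OF refl])
      fix k assume "k \<in> {1..n}"
      have "u k = 1 + v k" by (simp add: v_def)
      then show "(of_real (adj Q j k) + of_real \<sigma> * X j k) * u k = of_real (B j k) + of_real (B j k) * v k + of_real \<sigma> * X j k + of_real \<sigma> * (X j k * v k) + (of_real p * u k - (if k = j then of_real p * u k else 0))"
        by (auto simp: adj_centered[of Q _ _ p] B_def algebra_simps)
    qed
    also have "\<dots> = of_real (deg j) + (\<Sum>k=1..n. of_real (B j k) * v k) + of_real \<sigma> * X1 j + of_real \<sigma> * (\<Sum>k=1..n. X j k * v k) + (of_real p * (\<Sum>k=1..n. u k) - of_real p * u j)"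
      using j by (simp add: sum.distrib sum_subtractf deg_def X1_def sum_distrib_left)
    also have "\<dots> = of_real N * (of_real (1 - t j) + H j + E j)"
    proof -
      have NH: "of_real N * H j = of_real \<sigma> * X1 j" using N by (simp add: H_def)
      have NE: "of_real N * E j = - of_real p * v j + (\<Sum>k=1..n. of_real (B j k) * v k) + of_real \<sigma> * (\<Sum>k=1..n. X j k * v k)"
        using N by (simp add: E_def)
      have "N * (1 - t j) = deg j + p * (n - lo / 2) - p"
        using N n p by (simp add: t_def N_def field_simps)
      then have Nt: "(of_real N * of_real (1 - t j) :: complex) = of_real (deg j) + of_real p * of_real (n - lo / 2) - of_real p"
        by (metis of_real_add of_real_diff of_real_mult)
      have uj: "u j = 1 + v j" by (simp add: v_def)
      show ?thesis unfolding distrib_left NH NE Nt sum_u uj by simp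
    qed
    finally show ?thesis .
  qed
  define g where "g j = (\<sigma> / N)\<^sup>2 * (Im (X1 j))\<^sup>2" for j
  have ImH: "(Im (H j))\<^sup>2 = g j" for j by (simp add: H_def g_def power_mult_distrib power_divide)
  have point: "(cmod (f j * b - z' j))\<^sup>2 \<le> (1 + \<eta>) * (g j / (1 - \<theta>)\<^sup>2) + (1 + 1 / \<eta>) * (64 * (cmod (E j))\<^sup>2) + 4 * of_bool (R \<le> cmod (X1 j))"
    if j: "j \<in> {1..n}" for j
  proof -
    define \<phi> where "\<phi> = f j * b * cnj (z' j)"
    have \<phi>1: "cmod \<phi> = 1" using fn[OF j] zn'[OF j] b by (simp add: \<phi>_def norm_mult)
    have eq: "cmod (f j * b - z' j) = cmod (\<phi> - 1)"
    proof -
      have "f j * b - z' j = (\<phi> - 1) * z' j" using cc[OF j] by (simp add: \<phi>_def algebra_simps)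
      then show ?thesis using zn'[OF j] by (simp add: norm_mult)
    qed
    show ?thesis
    \<comment> \<open>Exceptional rows pay the maximal squared distance 4; the others fall under the perturbation bound.\<close>
    proof (cases "R \<le> cmod (X1 j)")
      case True
      have "cmod (\<phi> - 1) \<le> 2" using norm_triangle_ineq4[of \<phi> 1] \<phi>1 by simp
      then have "(cmod (\<phi> - 1))\<^sup>2 \<le> 2\<^sup>2" by (intro power_mono) auto
      moreover have "0 \<le> (1 + \<eta>) * (g j / (1 - \<theta>)\<^sup>2)" "0 \<le> (1 + 1 / \<eta>) * (64 * (cmod (E j))\<^sup>2)"
        using \<eta> by (auto simp: g_def)
      ultimately show ?thesis using True eq by simp
    next
      case False
      have "cmod (H j) \<le> \<rho>"
      proof -
        have "cmod (H j) = \<sigma> / N * cmod (X1 j)" using \<sigma> N by (simp add: H_def norm_mult norm_divide)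
        also have "\<dots> \<le> \<sigma> / N * R" using False \<sigma> N by (intro mult_left_mono) auto
        also have "\<dots> = \<rho>" using R N by (simp add: N_def[symmetric])
        finally show ?thesis .
      qed
      moreover have "\<bar>t j\<bar> \<le> \<gamma> / 2 + 1 / n + 4 * sqrt (n * p * ln n) / N"
      proof -
        have "\<bar>deg j\<bar> \<le> 4 * sqrt (n * p * ln n)"
          using reg j unfolding nearly_regular_def deg_def B_def by blast
        then have "\<bar>deg j / N\<bar> \<le> 4 * sqrt (n * p * ln n) / N" using N by (simp add: divide_right_mono)
        moreover have "lo / (2 * n) \<le> \<gamma> / 2" using l n by (simp add: lo_def field_simps)
        moreover have "0 \<le> lo / (2 * n)" "0 \<le> 1 / real n" using l0 by auto
        ultimately show ?thesis unfolding t_def by linarith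
      qed
      ultimately have th: "\<bar>t j\<bar> + cmod (H j) \<le> \<theta>" using \<theta>(1) by (simp add: N_def)
      define s where "s = of_real (1 - t j) + H j + E j"
      have "\<phi> = s / of_real (cmod s)" if "s \<noteq> 0"
      proof -
        have Ss: "S j * b * cnj (z' j) = of_real N * s" using S[OF j] by (simp add: s_def)
        then have "S j \<noteq> 0" using that N by auto
        then have "f j = S j / of_real (cmod (S j))" using j by (simp add: f_def power_iteration_def S_def Let_def)
        then have "\<phi> = (S j * b * cnj (z' j)) / of_real (cmod (S j))" by (simp add: \<phi>_def)
        moreover have "cmod (S j) = cmod (S j * b * cnj (z' j))" using b zn'[OF j] by (simp add: norm_mult)
        ultimately have "\<phi> = (of_real N * s) / of_real (cmod (of_real N * s))" by (simp only: Ss)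
        then show ?thesis using N by (simp add: norm_mult)
      qed
      from normalize_perturbation[OF s_def th \<theta>(2) \<eta> \<phi>1 this]
      show ?thesis using False by (simp add: eq ImH)
    qed
  qed
  \<comment> \<open>The factor 3 is the price for splitting the square of a sum of three terms.\<close>
  have sumE: "(\<Sum>j=1..n. (cmod (E j))\<^sup>2) \<le> 3 / N\<^sup>2 * ((p\<^sup>2 + 432 * (n * p * ln n)) * lo + \<sigma>\<^sup>2 * (2048 * K * (lo / n) powr (2/3)))"
  proof -
    have ptE: "(cmod (E j))\<^sup>2 \<le> 3 / N\<^sup>2 * (p\<^sup>2 * (cmod (v j))\<^sup>2 + (cmod (\<Sum>k=1..n. of_real (B j k) * v k))\<^sup>2 + \<sigma>\<^sup>2 * (cmod (\<Sum>k=1..n. X j k * v k))\<^sup>2)" for j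
    proof -
      define x y r where "x = p * cmod (v j)" and "y = cmod (\<Sum>k=1..n. of_real (B j k) * v k)" and "r = \<sigma> * cmod (\<Sum>k=1..n. X j k * v k)"
      have "cmod (E j) * N \<le> x + y + r"
      proof -
        have "cmod (E j) * N = cmod (- of_real p * v j + (\<Sum>k=1..n. of_real (B j k) * v k) + of_real \<sigma> * (\<Sum>k=1..n. X j k * v k))"
          using N by (simp add: E_def norm_divide)
        also have "\<dots> \<le> cmod (- of_real p * v j) + cmod (\<Sum>k=1..n. of_real (B j k) * v k) + cmod (of_real \<sigma> * (\<Sum>k=1..n. X j k * v k))"
          by (intro order_trans[OF norm_triangle_ineq] add_mono order_refl norm_triangle_ineq)
        also have "\<dots> = x + y + r" using p \<sigma> by (simp add: x_def y_def r_def norm_mult)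
        finally show ?thesis .
      qed
      then have "(cmod (E j) * N)\<^sup>2 \<le> (x + y + r)\<^sup>2" using N by (intro power_mono) auto
      also have "\<dots> \<le> 3 * (x\<^sup>2 + y\<^sup>2 + r\<^sup>2)"
        using sum_squares_bound[of x y] sum_squares_bound[of x r] sum_squares_bound[of y r]
        by (simp add: power2_sum algebra_simps)
      finally have "(cmod (E j))\<^sup>2 * N\<^sup>2 \<le> 3 * (x\<^sup>2 + y\<^sup>2 + r\<^sup>2)" by (simp add: power_mult_distrib)
      then have "(cmod (E j))\<^sup>2 \<le> 3 / N\<^sup>2 * (x\<^sup>2 + y\<^sup>2 + r\<^sup>2)" using N by (simp add: field_simps)
      then show ?thesis by (simp add: x_def y_def r_def power_mult_distrib)
    qed
    have "(\<Sum>j=1..n. (cmod (E j))\<^sup>2) \<le> (\<Sum>j=1..n. 3 / N\<^sup>2 * (p\<^sup>2 * (cmod (v j))\<^sup>2 + (cmod (\<Sum>k=1..n. of_real (B j k) * v k))\<^sup>2 + \<sigma>\<^sup>2 * (cmod (\<Sum>k=1..n. X j k * v k))\<^sup>2))"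
      by (intro sum_mono ptE)
    also have "\<dots> = 3 / N\<^sup>2 * (p\<^sup>2 * lo + (\<Sum>j=1..n. (cmod (\<Sum>k=1..n. of_real (B j k) * v k))\<^sup>2) + \<sigma>\<^sup>2 * (\<Sum>j=1..n. (cmod (\<Sum>k=1..n. X j k * v k))\<^sup>2))"
      unfolding l_v by (simp add: sum.distrib sum_distrib_left distrib_left)
    also have "\<dots> \<le> 3 / N\<^sup>2 * (p\<^sup>2 * lo + 432 * (n * p * ln n) * lo + \<sigma>\<^sup>2 * (2048 * K * (lo / n) powr (2/3)))"
    proof (intro mult_left_mono add_mono order_refl)
      show "(\<Sum>j=1..n. (cmod (\<Sum>k=1..n. of_real (B j k) * v k))\<^sup>2) \<le> 432 * (n * p * ln n) * lo"
        unfolding l_v by (rule real_sum_bound_complex) (use reg in \<open>simp add: nearly_regular_def B_def\<close>)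
      show "(\<Sum>j=1..n. (cmod (\<Sum>k=1..n. X j k * v k))\<^sup>2) \<le> 2048 * K * (lo / n) powr (2/3)"
        unfolding l_v by (rule noise_on_bounded_vectors[OF n K good v2])
    qed auto
    finally show ?thesis by (simp add: distrib_right)
  qed
  have sumg: "(\<Sum>j=1..n. g j) \<le> (\<sigma> / N)\<^sup>2 * V"
    using good unfolding g_def sum_distrib_left[symmetric] noise_good_def X1_def by (intro mult_left_mono) auto
  have cnt: "(\<Sum>j=1..n. of_bool (R \<le> cmod (X1 j))) \<le> c"
    using good unfolding noise_good_def X1_def by blast
  have "loss n f z' \<le> (\<Sum>j=1..n. (cmod (f j * b - z' j))\<^sup>2)"
    using loss_attained[of n f z'] b by auto
  also have "\<dots> \<le> (\<Sum>j=1..n. (1 + \<eta>) * (g j / (1 - \<theta>)\<^sup>2) + (1 + 1 / \<eta>) * (64 * (cmod (E j))\<^sup>2) + 4 * of_bool (R \<le> cmod (X1 j)))"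
    by (intro sum_mono point) auto
  also have "\<dots> = (1 + \<eta>) * ((\<Sum>j=1..n. g j) / (1 - \<theta>)\<^sup>2) + (1 + 1 / \<eta>) * (64 * (\<Sum>j=1..n. (cmod (E j))\<^sup>2)) + 4 * (\<Sum>j=1..n. of_bool (R \<le> cmod (X1 j)))"
    unfolding sum.distrib sum_divide_distrib sum_distrib_left ..
  also have "\<dots> \<le> (1 + \<eta>) * ((\<sigma> / N)\<^sup>2 * V / (1 - \<theta>)\<^sup>2) + (1 + 1 / \<eta>) * (64 * (3 / N\<^sup>2 * ((p\<^sup>2 + 432 * (n * p * ln n)) * lo + \<sigma>\<^sup>2 * (2048 * K * (lo / n) powr (2/3))))) + 4 * c"
    using \<eta> sumE sumg cnt by (intro add_mono mult_left_mono divide_right_mono) auto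
  finally show ?thesis by (simp add: f_def lo_def N_def)
qed

section \<open>Choice of the error terms\<close>

text \<open>
  Young's inequality for exponents \<open>3/2\<close> and \<open>3\<close>, as \<open>y\<^bsup>2/3\<^esup> = (y/r)\<^bsup>2/3\<^esup> (r\<^sup>2)\<^bsup>1/3\<^esup>\<close>.
\<close>

lemma two_thirds_power_le:
  fixes y r :: real
  assumes y: "0 \<le> y" and r: "0 < r"
  shows "y powr (2/3) \<le> y / r + r\<^sup>2"
proof (cases "y \<le> r ^ 3")
  case True
  have "y powr (2/3) \<le> (r ^ 3) powr (2/3)" using True y by (intro powr_mono2) auto
  also have "\<dots> = r\<^sup>2"
  proof -
    have "r ^ 3 = r powr 3" using powr_realpow[OF r, of 3] by simp
    then have "(r ^ 3) powr (2/3) = r powr 2" by (simp only: powr_powr) simp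
    also have "\<dots> = r\<^sup>2" using powr_realpow[OF r, of 2] by simp
    finally show ?thesis .
  qed
  also have "r\<^sup>2 \<le> y / r + r\<^sup>2" using y r by simp
  finally show ?thesis .
next
  case False
  then have yr: "r ^ 3 < y" by simp
  have y0: "0 < y" using yr r by (meson less_trans zero_less_power)
  have "(r ^ 3) powr (1/3) \<le> y powr (1/3)" using yr r by (intro powr_mono2) auto
  moreover have "(r ^ 3) powr (1/3) = r"
  proof -
    have "r ^ 3 = r powr 3" using powr_realpow[OF r, of 3] by simp
    then have "(r ^ 3) powr (1/3) = r powr 1" by (simp only: powr_powr) simp
    then show ?thesis using r by simp
  qed
  ultimately have "r \<le> y powr (1/3)" by simp
  moreover have "y powr (2/3) * y powr (1/3) = y" using y0 by (simp add: powr_add[symmetric])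
  ultimately have "y powr (2/3) * r \<le> y" by (metis mult_left_mono powr_ge_zero)
  then have "y powr (2/3) \<le> y / r" using r by (simp add: pos_le_divide_eq)
  then show ?thesis by (simp add: add_increasing2)
qed

lemma main_coefficient_le:
  fixes d \<delta> :: real
  assumes d: "0 < d" "d \<le> 1/32" and \<delta>: "0 < \<delta>" "\<delta> \<le> d"
  shows "(1 + d) * ((1 + \<delta>) * (1 + 25 * \<delta>\<^sup>2 + \<delta> ^ 4) / (1 - 8 * d)\<^sup>2) \<le> 1 + 84 * d"
proof -
  have "\<delta>\<^sup>2 \<le> \<delta> * 1" unfolding power2_eq_square using d \<delta> by (intro mult_left_mono) auto
  then have d2: "\<delta>\<^sup>2 \<le> d" using \<delta> by simp
  have "\<delta> ^ 4 \<le> \<delta> ^ 1" using d \<delta> by (intro power_decreasing) auto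
  then have d4: "\<delta> ^ 4 \<le> d" using \<delta> by simp
  have inv: "1 / (1 - 8 * d)\<^sup>2 \<le> 1 + 26 * d"
  proof -
    have "(1 + 26 * d) * (1 - 8 * d)\<^sup>2 = 1 + d * (10 - 352 * d + 1664 * d\<^sup>2)"
      by (simp add: power2_eq_square algebra_simps)
    moreover have "0 \<le> 10 - 352 * d + 1664 * d\<^sup>2"
    proof -
      have "0 \<le> (d - 1/32)\<^sup>2" by simp
      also have "\<dots> = d\<^sup>2 - d / 16 + 1 / 1024" by (simp add: power2_eq_square field_simps)
      finally show ?thesis using d by linarith
    qed
    ultimately have "1 \<le> (1 + 26 * d) * (1 - 8 * d)\<^sup>2" using d by simp
    then show ?thesis using d by (simp add: pos_divide_le_eq)
  qed
  have "(1 + d) * ((1 + \<delta>) * (1 + 25 * \<delta>\<^sup>2 + \<delta> ^ 4) / (1 - 8 * d)\<^sup>2) = (1 + d) * (1 + \<delta>) * (1 + 25 * \<delta>\<^sup>2 + \<delta> ^ 4) * (1 / (1 - 8 * d)\<^sup>2)"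
    by simp
  also have "\<dots> \<le> (1 + d) * (1 + d) * (1 + 26 * d) * (1 + 26 * d)"
    using d \<delta> d2 d4 inv by (intro mult_mono) auto
  also have "\<dots> \<le> 1 + 84 * d"
  proof -
    have "(1 + d) * (1 + d) \<le> 1 + 3 * d"
      using mult_left_mono[OF d(2), of d] d by (simp add: algebra_simps)
    moreover have "(1 + 26 * d) * (1 + 26 * d) \<le> 1 + 74 * d"
      using mult_left_mono[OF d(2), of d] d by (simp add: algebra_simps)
    ultimately have "((1 + d) * (1 + d)) * ((1 + 26 * d) * (1 + 26 * d)) \<le> (1 + 3 * d) * (1 + 74 * d)"
      using d by (intro mult_mono) auto
    also have "\<dots> \<le> 1 + 84 * d"
      using mult_left_mono[OF d(2), of d] d by (simp add: algebra_simps)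
    finally show ?thesis by (simp add: mult.assoc)
  qed
  finally show ?thesis .
qed

text \<open>
  In terms of the fourth roots \<open>r\<close> of \<open>\<sigma>\<^sup>2/(n p)\<close> and \<open>\<delta>\<close> of \<open>log n/(n p)\<close> all error terms are monomials. The
  slack in the weighted square and the threshold for \<open>H\<close> are \<open>\<eta> = d\<close> and \<open>\<rho> = r\<close>, which gives the cutoff
  \<open>\<theta> = 8 d\<close>; the number of exceptional rows is allowed to be \<open>n r\<^sup>5\<close>, which is \<open>r\<close> times twice the main
  term \<open>\<sigma>\<^sup>2/(2p)\<close>.
\<close>

lemma loss_bound_arithmetic:
  fixes p \<sigma> r \<delta> d t l :: real and n :: nat
  assumes n: "1 \<le> n" and p: "0 < p" "p \<le> 1" and r: "0 < r" "r \<le> d" "r\<^sup>2 \<le> t" and \<delta>: "0 < \<delta>" "\<delta> \<le> d" "\<delta>\<^sup>2 \<le> t"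
    and \<sigma>: "\<sigma>\<^sup>2 = r ^ 4 * (n * p)" and ln: "ln n = \<delta> ^ 4 * (n * p)" "1 \<le> ln n" and d: "d \<le> 1/32" and l: "0 \<le> l"
  shows "(1 + d) * ((\<sigma> / (n * p))\<^sup>2 * ((1 + \<delta>) * n * (n * p + 25 * sqrt (n * p * ln n) + 1) / 2) / (1 - 8 * d)\<^sup>2)
       + (1 + 1 / d) * (192 / (n * p)\<^sup>2 * ((p\<^sup>2 + 432 * (n * p * ln n)) * l + \<sigma>\<^sup>2 * (2048 * (48 * (n * p) * n) * (l / n) powr (2/3))))
       + 4 * (n * r ^ 5)
     \<le> 40000000 * t * l + (1 + 80000000 * d) * (\<sigma>\<^sup>2 / (2 * p))"
proof -
  define N where "N = real n * p"
  have N: "0 < N" using n p by (simp add: N_def)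
  have d0: "0 < d" using r by linarith
  define s where "s = \<sigma>\<^sup>2 / (2 * p)"
  have s0: "0 \<le> s" using p by (simp add: s_def)
  have s2: "2 * s = n * r ^ 4" using \<sigma> p by (simp add: s_def)
  have N1: "1 / N \<le> \<delta> ^ 4" using ln N by (simp add: N_def field_simps)
  have sq: "sqrt (N * ln n) = \<delta>\<^sup>2 * N"
  proof -
    have "N * ln n = (\<delta>\<^sup>2 * N)\<^sup>2" unfolding ln(1) N_def[symmetric] by (simp add: power2_eq_square power4_eq_xxxx)
    then show ?thesis using N by simp
  qed
  \<comment> \<open>Main noise term, whose coefficient tends to 1.\<close>
  have main: "(1 + d) * ((\<sigma> / N)\<^sup>2 * ((1 + \<delta>) * n * (N + 25 * sqrt (N * ln n) + 1) / 2) / (1 - 8 * d)\<^sup>2) \<le> (1 + 84 * d) * s"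
  proof -
    have "(\<sigma> / N)\<^sup>2 * ((1 + \<delta>) * n * (N + 25 * sqrt (N * ln n) + 1) / 2) = s * ((1 + \<delta>) * (1 + 25 * \<delta>\<^sup>2 + 1 / N))"
      unfolding sq s_def using N p n by (simp add: N_def power_divide power2_eq_square field_simps)
    also have "\<dots> \<le> s * ((1 + \<delta>) * (1 + 25 * \<delta>\<^sup>2 + \<delta> ^ 4))"
      using s0 \<delta> N1 by (intro mult_left_mono) auto
    finally have "(1 + d) * ((\<sigma> / N)\<^sup>2 * ((1 + \<delta>) * n * (N + 25 * sqrt (N * ln n) + 1) / 2) / (1 - 8 * d)\<^sup>2)
       \<le> (1 + d) * (s * ((1 + \<delta>) * (1 + 25 * \<delta>\<^sup>2 + \<delta> ^ 4)) / (1 - 8 * d)\<^sup>2)"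
      using d0 by (intro mult_left_mono divide_right_mono) auto
    also have "\<dots> = s * ((1 + d) * ((1 + \<delta>) * (1 + 25 * \<delta>\<^sup>2 + \<delta> ^ 4) / (1 - 8 * d)\<^sup>2))" by simp
    also have "\<dots> \<le> s * (1 + 84 * d)"
      by (intro mult_left_mono main_coefficient_le d0 d \<delta> s0)
    finally show ?thesis by (simp add: mult.commute)
  qed
  have inv_d: "1 + 1 / d \<le> 2 / d" using d0 d by (simp add: field_simps)
  \<comment> \<open>Graph fluctuations: a multiple of the loss only.\<close>
  have A: "2 / d * (192 / N\<^sup>2 * ((p\<^sup>2 + 432 * (N * ln n)) * l)) \<le> 166272 * t * l"
  proof -
    have "p\<^sup>2 / N\<^sup>2 = 1 / real n ^ 2" using p n by (simp add: N_def power_mult_distrib)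
    also have "\<dots> \<le> 1 / n" using n by (simp add: field_simps power2_eq_square)
    also have "\<dots> \<le> 1 / N" using p n by (simp add: N_def field_simps)
    also have "\<dots> \<le> \<delta> ^ 4" by (rule N1)
    finally have 1: "p\<^sup>2 / N\<^sup>2 \<le> \<delta> ^ 4" .
    have 2: "N * ln n / N\<^sup>2 = \<delta> ^ 4" unfolding ln(1) N_def[symmetric] using N by (simp add: power2_eq_square)
    have "192 / N\<^sup>2 * ((p\<^sup>2 + 432 * (N * ln n)) * l) = 192 * (p\<^sup>2 / N\<^sup>2 + 432 * (N * ln n / N\<^sup>2)) * l"
      by (simp add: add_divide_distrib algebra_simps)
    also have "\<dots> \<le> 192 * (\<delta> ^ 4 + 432 * \<delta> ^ 4) * l"
      unfolding 2 using 1 l by (intro mult_right_mono mult_left_mono add_mono) auto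
    finally have "2 / d * (192 / N\<^sup>2 * ((p\<^sup>2 + 432 * (N * ln n)) * l)) \<le> 2 / d * (192 * (\<delta> ^ 4 + 432 * \<delta> ^ 4) * l)"
      using d0 by (intro mult_left_mono) auto
    also have "\<dots> = 166272 * (\<delta> ^ 4 / d) * l" by simp
    also have "\<dots> \<le> 166272 * t * l"
    proof -
      have "\<delta> ^ 4 / d \<le> \<delta> ^ 4 / \<delta>" using \<delta> d0 by (intro divide_left_mono) auto
      also have "\<dots> = \<delta> * \<delta>\<^sup>2" using \<delta> by (simp add: power4_eq_xxxx power2_eq_square)
      also have "\<dots> \<le> 1 * t" using \<delta> d by (intro mult_mono) auto
      finally show ?thesis using l by (intro mult_right_mono mult_left_mono) auto
    qed
    finally show ?thesis .
  qed
  \<comment> \<open>Noise acting on the error vector: part goes to the loss, part to the main noise term.\<close>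
  have B: "2 / d * (192 / N\<^sup>2 * (\<sigma>\<^sup>2 * (2048 * (48 * N * n) * (l / n) powr (2/3)))) \<le> 37748736 * t * l + 75497472 * d * s"
  proof -
    have "2 / d * (192 / N\<^sup>2 * (\<sigma>\<^sup>2 * (2048 * (48 * N * n) * (l / n) powr (2/3)))) = 37748736 * (n * r ^ 4 / d) * (l / n) powr (2/3)"
      unfolding \<sigma> N_def[symmetric] using N by (simp add: power2_eq_square)
    also have "\<dots> \<le> 37748736 * (n * r ^ 4 / d) * ((l / n) / r + r\<^sup>2)"
      using r d0 l by (intro mult_left_mono two_thirds_power_le) auto
    also have "\<dots> = 37748736 * ((r ^ 3 / d) * l + n * r ^ 4 * (r\<^sup>2 / d))"
      using r n d0 by (simp add: field_simps power2_eq_square power3_eq_cube power4_eq_xxxx)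
    also have "\<dots> \<le> 37748736 * (t * l + n * r ^ 4 * d)"
    proof -
      have "r ^ 3 / d \<le> r ^ 3 / r" using r d0 by (intro divide_left_mono) auto
      also have "\<dots> = r\<^sup>2" using r by (simp add: power3_eq_cube power2_eq_square)
      finally have 1: "r ^ 3 / d \<le> t" using r by linarith
      have "r\<^sup>2 / d \<le> d\<^sup>2 / d" using r d0 by (intro divide_right_mono power_mono) auto
      then have 2: "r\<^sup>2 / d \<le> d" using d0 by (simp add: power2_eq_square)
      show ?thesis using 1 2 l r by (intro mult_left_mono add_mono mult_right_mono) auto
    qed
    also have "\<dots> = 37748736 * t * l + 75497472 * d * s" unfolding s2[symmetric] by simp
    finally show ?thesis .
  qed
  have C: "4 * (n * r ^ 5) \<le> 8 * d * s"
  proof -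
    have "n * r ^ 5 = (n * r ^ 4) * r" by (simp add: eval_nat_numeral)
    also have "\<dots> \<le> (n * r ^ 4) * d" using r by (intro mult_left_mono) auto
    also have "\<dots> = 2 * d * s" unfolding s2[symmetric] by simp
    finally show ?thesis by simp
  qed
  have "(1 + 1 / d) * (192 / N\<^sup>2 * ((p\<^sup>2 + 432 * (N * ln n)) * l + \<sigma>\<^sup>2 * (2048 * (48 * N * n) * (l / n) powr (2/3))))
     \<le> 2 / d * (192 / N\<^sup>2 * ((p\<^sup>2 + 432 * (N * ln n)) * l + \<sigma>\<^sup>2 * (2048 * (48 * N * n) * (l / n) powr (2/3))))"
    using inv_d N ln l by (intro mult_right_mono mult_nonneg_nonneg add_nonneg_nonneg) auto
  also have "\<dots> = 2 / d * (192 / N\<^sup>2 * ((p\<^sup>2 + 432 * (N * ln n)) * l)) + 2 / d * (192 / N\<^sup>2 * (\<sigma>\<^sup>2 * (2048 * (48 * N * n) * (l / n) powr (2/3))))"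
    by (simp only: distrib_left)
  also have "\<dots> \<le> 166272 * t * l + (37748736 * t * l + 75497472 * d * s)" by (rule add_mono[OF A B])
  finally have E: "(1 + 1 / d) * (192 / N\<^sup>2 * ((p\<^sup>2 + 432 * (N * ln n)) * l + \<sigma>\<^sup>2 * (2048 * (48 * N * n) * (l / n) powr (2/3))))
     \<le> 166272 * t * l + (37748736 * t * l + 75497472 * d * s)" .
  have "0 \<le> t" using r by (meson order_trans zero_le_power2)
  then have "0 \<le> t * l" "0 \<le> d * s" using l d0 s0 by auto
  with main E C show ?thesis unfolding N_def[symmetric] s_def[symmetric] by (simp add: algebra_simps)
qed

lemma nearly_regular_cong:
  assumes "\<And>j k. j \<in> {1..n} \<Longrightarrow> k \<in> {1..n} \<Longrightarrow> B j k = B' j k"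
  shows "nearly_regular n p B \<longleftrightarrow> nearly_regular n p B'"
proof -
  have 1: "(\<Sum>k=1..n. B j k) = (\<Sum>k=1..n. B' j k)" if "j \<in> {1..n}" for j
    using assms that by (intro sum.cong) auto
  have 2: "(\<Sum>j=1..n. (\<Sum>k=1..n. B j k * v k)\<^sup>2) = (\<Sum>j=1..n. (\<Sum>k=1..n. B' j k * v k)\<^sup>2)" for v
    using assms by (intro sum.cong arg_cong[where f="\<lambda>x. x\<^sup>2"]) auto
  show ?thesis unfolding nearly_regular_def 2 using 1 by simp
qed

text \<open>
  The finite-\<open>n\<close> form of the theorem. The conditions \<open>fail1\<close> and \<open>fail2\<close> hold for large \<open>n\<close>: the former because
  \<open>n \<delta>\<^sup>2 \<ge> sqrt (n log n)\<close>, the latter because \<open>r\<close> tends to \<open>0\<close>.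
\<close>

lemma (in synchronization_model) contraction_whp:
  fixes \<sigma> \<gamma> r \<delta> d t :: real
  assumes p: "0 < p" "p \<le> 1" and \<sigma>0: "0 < \<sigma>" and z': "z' \<in> unit_vecs n"
    and n: "3 \<le> n" "16 * ln n \<le> n * p" and \<gamma>: "\<gamma> \<le> d\<^sup>2"
    and r: "0 < r" "r \<le> d" "r\<^sup>2 \<le> t" and \<delta>: "0 < \<delta>" "\<delta> \<le> d" "\<delta>\<^sup>2 \<le> t"
    and \<sigma>: "\<sigma>\<^sup>2 = r ^ 4 * (n * p)" and ln: "ln n = \<delta> ^ 4 * (n * p)" and d: "d \<le> 1/32"
    and fail1: "3 / real n ^ 2 + 2 * n * exp (- (real n powr (1/3))) + exp (- (n * \<delta>\<^sup>2 / 16)) \<le> 1 / (2 * real n)"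
    and fail2: "4 * exp (- 1 / (8 * r\<^sup>2)) / r ^ 5 \<le> exp (- 1 / r)"
  shows "prob {\<omega> \<in> space M. \<forall>z \<in> unit_vecs n. loss n z z' \<le> \<gamma> * n \<longrightarrow>
           loss n (power_iteration n (adjacency (\<lambda>e. A e \<omega>)) (observation \<sigma> z' (\<lambda>e. W e \<omega>)) z) z'
             \<le> 40000000 * t * loss n z z' + (1 + 80000000 * d) * (\<sigma>\<^sup>2 / (2 * p))}
     \<ge> 1 - 1 / (2 * real n) - exp (- 1 / r)" (is "prob ?S \<ge> _")
proof -
  let ?new = "\<lambda>z \<omega>. loss n (power_iteration n (adjacency (\<lambda>e. A e \<omega>)) (observation \<sigma> z' (\<lambda>e. W e \<omega>)) z) z'"
  let ?target = "\<lambda>z. 40000000 * t * loss n z z' + (1 + 80000000 * d) * (\<sigma>\<^sup>2 / (2 * p))"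
  define K V R c where "K = 48 * (real n * p) * n" and "V = (1 + \<delta>) * n * (n * p + 25 * sqrt (n * p * ln n) + 1) / 2"
    and "R = r * (n * p) / \<sigma>" and "c = real n * r ^ 5"
  have n1: "1 \<le> n" using n by simp
  have np: "0 < real n * p" using n p by simp
  have d0: "0 < d" using r by linarith
  have "exp 1 \<le> real n" using exp_le n by linarith
  then have ln1: "1 \<le> ln n" using n by (subst ln_ge_iff) auto
  define good where "good Q \<longleftrightarrow> nearly_regular n p (centered_adj Q p)" for Q
  define bad where "bad Q w \<longleftrightarrow> \<not> noise_good n K V R c (noise_matrix z' Q w)" for Q w
  let ?F = "{\<omega>\<in>space M. good (graph \<omega>) \<longrightarrow> bad (graph \<omega>) (noise \<omega>)}"
  define \<beta> where "\<beta> = 2 * n * exp (- (real n powr (1/3))) + exp (- (n * \<delta>\<^sup>2 / 16)) + 4 * n * exp (- (R\<^sup>2 / (8 * (n * p)))) / c"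
  have R0: "0 < R" using r np \<sigma>0 by (simp add: R_def)
  have c0: "0 < c" using n r by (simp add: c_def)
  have bad_sets: "{w \<in> space (\<Pi>\<^sub>M e\<in>edges n. borel). bad Q w} \<in> sets (\<Pi>\<^sub>M e\<in>edges n. borel)" if "Q \<subseteq> edges n" for Q
    unfolding bad_def by (rule noise_good_sets[OF noise_matrix_measurable[OF that]])
  have bad_prob: "prob {\<omega>\<in>space M. bad Q (noise \<omega>)} \<le> \<beta>" if "Q \<subseteq> edges n" "good Q" for Q
    unfolding bad_def K_def V_def \<beta>_def
    by (rule noise_good_whp[OF that(1) z' that(2)[unfolded good_def] p _ _ n1 n(2) R0 c0]) (use \<delta> d in auto)
  have \<beta>0: "0 \<le> \<beta>" using c0 unfolding \<beta>_def by (intro add_nonneg_nonneg) auto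
  note F = prob_given_graph[where good=good and bad=bad and \<beta>=\<beta>, OF bad_sets bad_prob \<beta>0]
  have graph_reg: "good (graph \<omega>) \<longleftrightarrow> nearly_regular n p (sym_matrix (\<lambda>e. of_bool (A e \<omega>) - p))" for \<omega>
  proof -
    have "centered_adj (graph \<omega>) p j k = sym_matrix (\<lambda>e. of_bool (A e \<omega>) - p) j k" if "j \<in> {1..n}" "k \<in> {1..n}" for j k
      using that by (auto simp: centered_adj_def sym_matrix_def graph_def edges_def min_def max_def)
    then show ?thesis unfolding good_def by (rule nearly_regular_cong)
  qed
  have "prob {\<omega>\<in>space M. \<not> good (graph \<omega>)} \<le> 3 / real n ^ 2"
  proof -
    interpret B: bounded_edge_weights M n "\<lambda>e \<omega>. of_bool (A e \<omega>) - p" p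
      by (rule centered_adjacency_weights[OF p])
    show ?thesis unfolding graph_reg
    proof (rule B.nearly_regular_whp[OF n(1)])
      show "4 * ln n \<le> n * p" using n ln1 by linarith
      show "{\<omega> \<in> space M. \<not> nearly_regular n p (sym_matrix (\<lambda>e. of_bool (A e \<omega>) - p))} \<in> events"
        using graph_pred_event[of "\<lambda>Q. \<not> good Q"] unfolding graph_reg .
    qed
  qed
  with F(2) have "prob ?F \<le> 3 / real n ^ 2 + \<beta>" by linarith
  also have "\<dots> \<le> 1 / (2 * real n) + exp (- 1 / r)"
  proof -
    have "R\<^sup>2 / (8 * (n * p)) = 1 / (8 * r\<^sup>2)"
    proof -
      have "R\<^sup>2 = r\<^sup>2 * (n * p)\<^sup>2 / (r ^ 4 * (n * p))" by (simp add: R_def power_divide power_mult_distrib \<sigma>)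
      then show ?thesis using r n p by (simp add: power2_eq_square power4_eq_xxxx field_simps)
    qed
    then have "4 * n * exp (- (R\<^sup>2 / (8 * (n * p)))) / c = 4 * exp (- 1 / (8 * r\<^sup>2)) / r ^ 5"
      using n1 by (simp add: c_def)
    then show ?thesis using fail1 fail2 unfolding \<beta>_def by linarith
  qed
  finally have Fp: "prob ?F \<le> 1 / (2 * real n) + exp (- 1 / r)" .
  have sub: "space M - ?F \<subseteq> ?S"
  proof
    fix \<omega> assume \<omega>: "\<omega> \<in> space M - ?F"
    then have reg: "nearly_regular n p (centered_adj (graph \<omega>) p)" and ng: "noise_good n K V R c (noise_matrix z' (graph \<omega>) (noise \<omega>))"
      by (auto simp: good_def bad_def)
    have "?new z \<omega>
             \<le> ?target z"
      if z: "z \<in> unit_vecs n" and l: "loss n z z' \<le> \<gamma> * n" for z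
    proof -
      have X: "noise_matrix z' (graph \<omega>) (noise \<omega>) = noise_matrix z' (graph \<omega>) (\<lambda>e. W e \<omega>)"
        by (auto simp: fun_eq_iff noise_matrix_def noise_def graph_def)
      have \<theta>: "\<gamma> / 2 + 1 / n + 4 * sqrt (n * p * ln n) / (n * p) + r \<le> 8 * d"
      proof -
        have "n * p * ln n = (\<delta>\<^sup>2 * (n * p))\<^sup>2" unfolding ln by (simp add: power2_eq_square power4_eq_xxxx)
        then have sq: "4 * sqrt (n * p * ln n) / (n * p) = 4 * \<delta>\<^sup>2" using np p n1 by simp
        have "1 / n \<le> 1 / (n * p)" using n1 p by (simp add: field_simps)
        also have "\<dots> \<le> \<delta> ^ 4" using ln ln1 np by (simp add: field_simps)
        also have "\<dots> \<le> \<delta>" using power_decreasing[of 1 4 \<delta>] \<delta> d by simp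
        finally have 1: "1 / n \<le> d" using \<delta> by linarith
        have "d\<^sup>2 \<le> d" "\<delta>\<^sup>2 \<le> \<delta>" using power_decreasing[of 1 2 d] power_decreasing[of 1 2 \<delta>] \<delta> d d0 by auto
        then show ?thesis using 1 \<gamma> \<delta> r unfolding sq by linarith
      qed
      have l0: "0 \<le> loss n z z'"
        using loss_attained[of n z z'] by (auto intro!: sum_nonneg)
      have "?new z \<omega>
        \<le> (1 + d) * ((\<sigma> / (n * p))\<^sup>2 * V / (1 - 8 * d)\<^sup>2)
       + (1 + 1 / d) * (192 / (n * p)\<^sup>2 * ((p\<^sup>2 + 432 * (n * p * ln n)) * loss n z z' + \<sigma>\<^sup>2 * (2048 * K * (loss n z z' / n) powr (2/3))))
       + 4 * c"
      proof (rule power_iteration_loss_bound[OF n1 p \<sigma>0 z z' graph_def refl])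
        show "nearly_regular n p (centered_adj (graph \<omega>) p)" by (rule reg)
        show "noise_good n K V R c (noise_matrix z' (graph \<omega>) (\<lambda>e. W e \<omega>))" using ng X by simp
      qed (use l \<theta> d d0 np \<sigma>0 in \<open>auto simp: K_def R_def\<close>)
      also have "\<dots> \<le> ?target z"
        unfolding K_def V_def c_def by (rule loss_bound_arithmetic[OF n1 p r \<delta> \<sigma> ln ln1 d l0])
      finally show ?thesis .
    qed
    then show "\<omega> \<in> ?S" using \<omega> by auto
  qed
  have "1 - prob ?F = prob (space M - ?F)" by (rule prob_compl[OF F(1), symmetric])
  also have "\<dots> \<le> prob ?S" by (rule finite_measure_mono[OF sub contraction_event[OF z']])
  finally show ?thesis using Fp by linarith
qed

theorem lemma2p1:
  fixes p \<sigma> \<gamma> :: "nat \<Rightarrow> real"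
  assumes p: "\<And>n. 0 < p n \<and> p n \<le> 1"
    and \<sigma>: "\<And>n. 0 < \<sigma> n"
    and \<gamma>: "\<And>n. 0 \<le> \<gamma> n"
    and \<sigma>_small: "(\<lambda>n. (\<sigma> n)\<^sup>2) \<in> o(\<lambda>n. real n * p n)"
    and np_large: "filterlim (\<lambda>n. real n * p n / ln (real n)) at_top sequentially"
    and \<gamma>_small: "\<gamma> \<in> o(\<lambda>_. 1)"
  shows "\<exists>\<delta>1 \<delta>2 :: nat \<Rightarrow> real.
    \<delta>1 \<in> o(\<lambda>_. 1) \<and> \<delta>2 \<in> o(\<lambda>_. 1) \<and>
    \<delta>1 \<in> O(\<lambda>n. sqrt ((ln (real n) + (\<sigma> n)\<^sup>2) / (real n * p n))) \<and>
    \<delta>2 \<in> O(\<lambda>n. ((\<gamma> n)\<^sup>2 + (ln (real n) + (\<sigma> n)\<^sup>2) / (real n * p n)) powr (1/4)) \<and>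
    (\<forall>\<^sub>F n in sequentially. \<forall>z' \<in> unit_vecs n. \<forall>(M :: 'a measure) A W.
       synchronization_model M n (p n) A W \<longrightarrow>
       measure M {\<omega> \<in> space M. \<forall>z \<in> unit_vecs n. loss n z z' \<le> \<gamma> n * real n \<longrightarrow>
           loss n (power_iteration n (adjacency (\<lambda>e. A e \<omega>))
                     (observation (\<sigma> n) z' (\<lambda>e. W e \<omega>)) z) z'
             \<le> \<delta>1 n * loss n z z' + (1 + \<delta>2 n) * ((\<sigma> n)\<^sup>2 / (2 * p n))}
         \<ge> 1 - 1 / (2 * real n) - exp (- ((real n * p n / (\<sigma> n)\<^sup>2) powr (1/4))))"
proof -
  define N where "N n = real n * p n" for n
  define \<kappa> where "\<kappa> n = (ln (real n) + (\<sigma> n)\<^sup>2) / (real n * p n)" for n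
  define t where "t n = sqrt (\<kappa> n)" for n
  define d where "d n = ((\<gamma> n)\<^sup>2 + \<kappa> n) powr (1/4)" for n
  define r where "r n = ((\<sigma> n)\<^sup>2 / N n) powr (1/4)" for n
  define \<delta> where "\<delta> n = (ln (real n) / N n) powr (1/4)" for n
  let ?contracts = "\<lambda>n z' (M :: 'a measure) A W. {\<omega> \<in> space M. \<forall>z \<in> unit_vecs n. loss n z z' \<le> \<gamma> n * real n \<longrightarrow>
      loss n (power_iteration n (adjacency (\<lambda>e. A e \<omega>)) (observation (\<sigma> n) z' (\<lambda>e. W e \<omega>)) z) z'
        \<le> 40000000 * t n * loss n z z' + (1 + 80000000 * d n) * ((\<sigma> n)\<^sup>2 / (2 * p n))}"
  have Npos: "\<forall>\<^sub>F n in sequentially. 0 < N n"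
    using eventually_gt_at_top[of 0] by eventually_elim (use p in \<open>auto simp: N_def\<close>)
  have lim_\<sigma>: "(\<lambda>n. (\<sigma> n)\<^sup>2 / N n) \<longlonglongrightarrow> 0"
    using smalloD_tendsto[OF \<sigma>_small] by (simp add: N_def)
  have lim_ln: "(\<lambda>n. ln (real n) / N n) \<longlonglongrightarrow> 0"
    using tendsto_inverse_0_at_top[OF np_large] by (simp add: N_def)
  have lim_\<gamma>: "\<gamma> \<longlonglongrightarrow> 0" using smalloD_tendsto[OF \<gamma>_small] by simp
  have lim_\<kappa>: "\<kappa> \<longlonglongrightarrow> 0"
    using tendsto_add[OF lim_ln lim_\<sigma>] by (simp add: \<kappa>_def[abs_def] N_def add_divide_distrib)
  have lim_t: "t \<longlonglongrightarrow> 0" using tendsto_real_sqrt[OF lim_\<kappa>] by (simp add: t_def[abs_def])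
  have powr0: "(\<lambda>n. f n powr (1/4)) \<longlonglongrightarrow> 0" if "f \<longlonglongrightarrow> 0" "\<forall>\<^sub>F n in sequentially. 0 \<le> f n" for f :: "nat \<Rightarrow> real"
    using tendsto_powr2[OF that(1) tendsto_const[of "1/4"] that(2)] by simp
  have \<kappa>0: "\<forall>\<^sub>F n in sequentially. 0 \<le> \<kappa> n"
    using eventually_ge_at_top[of 1]
  proof eventually_elim
    case (elim n)
    then have "0 \<le> ln (real n) + (\<sigma> n)\<^sup>2" "0 \<le> real n * p n" using p[of n] by auto
    then show ?case unfolding \<kappa>_def by (rule divide_nonneg_nonneg)
  qed
  have lim_d: "d \<longlonglongrightarrow> 0"
    unfolding d_def
  proof (rule powr0)
    show "(\<lambda>n. (\<gamma> n)\<^sup>2 + \<kappa> n) \<longlonglongrightarrow> 0" using tendsto_add[OF tendsto_power[OF lim_\<gamma>, of 2] lim_\<kappa>] by simp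
    show "\<forall>\<^sub>F n in sequentially. 0 \<le> (\<gamma> n)\<^sup>2 + \<kappa> n" using \<kappa>0 by eventually_elim auto
  qed
  have r_pos: "\<forall>\<^sub>F n in sequentially. 0 < r n"
    using Npos by eventually_elim (use \<sigma> in \<open>auto simp: r_def less_imp_neq[symmetric]\<close>)
  have lim_r: "r \<longlonglongrightarrow> 0"
    unfolding r_def by (rule powr0[OF lim_\<sigma>]) (use Npos in \<open>eventually_elim; simp\<close>)
  have small_r: "\<forall>\<^sub>F n in sequentially. 4 * exp (- 1 / (8 * (r n)\<^sup>2)) / r n ^ 5 \<le> exp (- 1 / r n)"
  proof -
    have "\<forall>\<^sub>F x in at_right (0::real). 4 * exp (- 1 / (8 * x\<^sup>2)) / x ^ 5 \<le> exp (- 1 / x)"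
      by real_asymp
    moreover have "filterlim r (at_right 0) sequentially"
      using lim_r r_pos by (auto simp: filterlim_at elim: eventually_mono)
    ultimately show ?thesis by (rule eventually_compose_filterlim)
  qed
  have fail: "\<forall>\<^sub>F n in sequentially. 3 / real n ^ 2 + 2 * real n * exp (- (real n powr (1/3))) + exp (- (sqrt (real n * ln (real n)) / 16)) \<le> 1 / (2 * real n)"
    by real_asymp
  have d_le: "\<forall>\<^sub>F n in sequentially. d n \<le> 1/32"
    using order_tendstoD(2)[OF lim_d, of "1/32"] by (auto elim: eventually_mono)
  have ln_le: "\<forall>\<^sub>F n in sequentially. ln (real n) / N n \<le> 1/16"
    using order_tendstoD(2)[OF lim_ln, of "1/16"] by (auto elim: eventually_mono)
  have main: "\<forall>\<^sub>F n in sequentially. \<forall>z' \<in> unit_vecs n. \<forall>M A W. synchronization_model M n (p n) A W \<longrightarrow>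
       measure M (?contracts n z' M A W) \<ge> 1 - 1 / (2 * real n) - exp (- ((real n * p n / (\<sigma> n)\<^sup>2) powr (1/4)))"
    using small_r fail d_le ln_le eventually_ge_at_top[of 3]
  proof eventually_elim
    case (elim n)
    have N0: "0 < N n" using elim p[of n] by (auto simp: N_def)
    have s0: "0 < (\<sigma> n)\<^sup>2 / N n" using \<sigma>[of n] N0 by simp
    have l0: "0 < ln (real n) / N n" using elim N0 by simp
    have \<kappa>_eq: "\<kappa> n = ln (real n) / N n + (\<sigma> n)\<^sup>2 / N n" by (simp add: \<kappa>_def N_def add_divide_distrib)
    have pow4: "(x powr (1/4)) ^ 4 = x" if "0 < x" for x :: real
      using powr_realpow[of "x powr (1/4)" 4] that by (simp add: powr_powr)
    have pow2: "(x powr (1/4))\<^sup>2 = sqrt x" if "0 < x" for x :: real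
      using powr_realpow[of "x powr (1/4)" 2] that by (simp add: powr_powr powr_half_sqrt)
    have r_inv: "(real n * p n / (\<sigma> n)\<^sup>2) powr (1/4) = 1 / r n"
      by (simp add: r_def N_def powr_divide)
    show ?case
    proof (intro ballI allI impI)
      fix z' M A W
      assume z': "z' \<in> unit_vecs n" and "synchronization_model (M :: 'a measure) n (p n) A W"
      then interpret synchronization_model M n "p n" A W by simp
      have "prob (?contracts n z' M A W) \<ge> 1 - 1 / (2 * real n) - exp (- 1 / r n)"
      proof (rule contraction_whp[OF _ _ \<sigma> z'])
        show "0 < p n" "p n \<le> 1" using p by auto
        show "3 \<le> n" using elim by simp
        show "16 * ln (real n) \<le> real n * p n" using elim(4) N0 by (simp add: N_def field_simps)
        have "(\<gamma> n)\<^sup>2 \<le> (\<gamma> n)\<^sup>2 + \<kappa> n" using s0 l0 by (simp add: \<kappa>_eq)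
        then have "sqrt ((\<gamma> n)\<^sup>2) \<le> sqrt ((\<gamma> n)\<^sup>2 + \<kappa> n)" by (rule real_sqrt_le_mono)
        also have "\<dots> = (d n)\<^sup>2" unfolding d_def using s0 l0 by (subst pow2) (auto simp: \<kappa>_eq add_nonneg_pos)
        finally show "\<gamma> n \<le> (d n)\<^sup>2" using \<gamma>[of n] by simp
        show "0 < r n" using s0 unfolding r_def by (metis powr_gt_zero less_irrefl)
        show "r n \<le> d n" "\<delta> n \<le> d n" unfolding r_def \<delta>_def d_def using s0 l0
          by (auto intro!: powr_mono2 simp: \<kappa>_eq add_increasing add_increasing2)
        show "(r n)\<^sup>2 \<le> t n" "(\<delta> n)\<^sup>2 \<le> t n" unfolding r_def \<delta>_def t_def pow2[OF s0] pow2[OF l0]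
          using s0 l0 by (auto simp: \<kappa>_eq)
        show "0 < \<delta> n" using l0 unfolding \<delta>_def by (metis powr_gt_zero less_irrefl)
        show "(\<sigma> n)\<^sup>2 = r n ^ 4 * (real n * p n)" unfolding r_def pow4[OF s0] using N0 unfolding N_def by (metis nonzero_eq_divide_eq less_irrefl)
        show "ln (real n) = \<delta> n ^ 4 * (real n * p n)" unfolding \<delta>_def pow4[OF l0] using N0 unfolding N_def by (metis nonzero_eq_divide_eq less_irrefl)
        show "d n \<le> 1/32" by (rule elim)
        show "4 * exp (- 1 / (8 * (r n)\<^sup>2)) / r n ^ 5 \<le> exp (- 1 / r n)" by (rule elim)
        have "sqrt (real n * ln (real n)) \<le> real n * (\<delta> n)\<^sup>2"
        proof -
          have "ln (real n) / real n \<le> ln (real n) / N n"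
            using elim N0 p[of n] by (intro divide_left_mono) (auto simp: N_def mult_left_le)
          then have "real n * sqrt (ln (real n) / real n) \<le> real n * sqrt (ln (real n) / N n)"
            by (intro mult_left_mono real_sqrt_le_mono) auto
          moreover have "real n * sqrt (ln (real n) / real n) = sqrt (real n * ln (real n))"
          proof -
            have "real n * sqrt (ln (real n) / real n) = sqrt ((real n)\<^sup>2 * (ln (real n) / real n))"
              by (simp only: real_sqrt_mult real_sqrt_abs)
            also have "(real n)\<^sup>2 * (ln (real n) / real n) = real n * ln (real n)"
              using elim by (simp add: power2_eq_square)
            finally show ?thesis .
          qed
          ultimately show ?thesis unfolding \<delta>_def pow2[OF l0] by simp
        qed
        then have "exp (- (real n * (\<delta> n)\<^sup>2 / 16)) \<le> exp (- (sqrt (real n * ln (real n)) / 16))" by simp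
        then show "3 / real n ^ 2 + real (2 * n) * exp (- (real n powr (1/3))) + exp (- (real n * (\<delta> n)\<^sup>2 / 16)) \<le> 1 / (2 * real n)"
          using elim(2) unfolding of_nat_mult of_nat_numeral by linarith
      qed
      then show "prob (?contracts n z' M A W) \<ge> 1 - 1 / (2 * real n) - exp (- ((real n * p n / (\<sigma> n)\<^sup>2) powr (1/4)))"
        unfolding r_inv by simp
    qed
  qed
  show ?thesis
  \<comment> \<open>The constants are those of the bound on one step for fixed n.\<close>
  proof (rule exI[of _ "\<lambda>n. 40000000 * t n"], rule exI[of _ "\<lambda>n. 80000000 * d n"], intro conjI)
    show "(\<lambda>n. 40000000 * t n) \<in> o(\<lambda>_. 1)"
      using tendsto_mult_right_zero[OF lim_t] by (intro smalloI_tendsto) auto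
    show "(\<lambda>n. 80000000 * d n) \<in> o(\<lambda>_. 1)"
      using tendsto_mult_right_zero[OF lim_d] by (intro smalloI_tendsto) auto
    show "(\<lambda>n. 40000000 * t n) \<in> O(\<lambda>n. sqrt ((ln (real n) + (\<sigma> n)\<^sup>2) / (real n * p n)))"
      by (simp add: t_def \<kappa>_def)
    show "(\<lambda>n. 80000000 * d n) \<in> O(\<lambda>n. ((\<gamma> n)\<^sup>2 + (ln (real n) + (\<sigma> n)\<^sup>2) / (real n * p n)) powr (1/4))"
      by (simp add: d_def \<kappa>_def)
    show "\<forall>\<^sub>F n in sequentially. \<forall>z' \<in> unit_vecs n. \<forall>M A W. synchronization_model M n (p n) A W \<longrightarrow>
       measure M (?contracts n z' M A W) \<ge> 1 - 1 / (2 * real n) - exp (- ((real n * p n / (\<sigma> n)\<^sup>2) powr (1/4)))"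
      by (rule main)
  qed
qed

end
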